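(* Let $F=F(t_0,\mathbf t,\bar{\mathbf t})$ be any symmetric formal solution to the dispersionless 2D Toda hierarchy, let $F(t_0):=F|_{t_0}$ denote its restriction to $t_1=\bar t_1=t_2=\bar t_2=\ldots=0$, and put $f(t_0)=\exp(\partial_0^2F(t_0))$. Then $$F=F(t_0)+\sum_{i>0} i f^i\,t_i\bar t_i+\sum_{|\Delta|=|\bar\Delta|}\ \sum_{\substack{s_1+\ldots+s_m=|\Delta|\\ r_1+\ldots+r_m=\ell(\Delta)+\ell(\bar\Delta)-2>0}} N_{(\Delta|\bar\Delta)}\begin{pmatrix}s_1\ldots s_m\\ r_1\ldots r_m\end{pmatrix}\,\partial_0^{r_1}(f^{s_1})\cdots\partial_0^{r_m}(f^{s_m})\;t_\Delta\,\bar t_{\bar\Delta},$$ where the outer sum runs over pairs of non-empty Young diagrams $\Delta,\bar\Delta$ with $|\Delta|=|\bar\Delta|$ and $\ell(\Delta)+\ell(\bar\Delta)>2$, the inner sum runs over all $m\ge1$ and all sequences of positive integers $(s_1,\ldots,s_m)$, $(r_1,\ldots,r_m)$ with the indicated sums, and the $N_{(\Delta|\bar\Delta)}$ are the universal combinatorial constants (independent of $F$) defined in the context.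
   Context: **Hierarchy.** $\mathbf t=\{t_1,t_2,\ldots\}$, $\bar{\mathbf t}=\{\bar t_1,\bar t_2,\ldots\}$ are independent formal variables (the bar is not complex conjugation), $\partial_k=\partial/\partial t_k$, $\bar\partial_k=\partial/\partial\bar t_k$, $D(z)=\sum_{k\ge1}\frac{z^{-k}}{k}\partial_k$, $\bar D(\bar z)=\sum_{k\ge1}\frac{\bar z^{-k}}{k}\bar\partial_k$. The dispersionless 2D Toda hierarchy is the system (understood as identities of formal series in $z^{-1},\xi^{-1},\bar z^{-1},\bar\xi^{-1}$, up to the polynomial prefactors) $$(z-\xi)e^{D(z)D(\xi)F}=ze^{-\partial_0D(z)F}-\xi e^{-\partial_0D(\xi)F},$$ $$(\bar z-\bar\xi)e^{\bar D(\bar z)\bar D(\bar\xi)F}=\bar ze^{-\partial_0\bar D(\bar z)F}-\bar\xi e^{-\partial_0\bar D(\bar\xi)F},$$ $$1-e^{-D(z)\bar D(\bar\xi)F}=\frac1{z\bar\xi}\,e^{\partial_0(\partial_0+D(z)+\bar D(\bar\xi))F}.$$ **Young diagrams.** $\Delta=[\mu_1\ge\ldots\ge\mu_\ell>0]$, $\ell(\Delta)=\ell$, $|\Delta|=\mu_1+\ldots+\mu_\ell$, $\sigma(\Delta)=\prod_{r\ge1}m_r!$ where $m_r$ is the number of parts of $\Delta$ equal to $r$; $t_\Delta=t_{\mu_1}\cdots t_{\mu_\ell}$, $\bar t_\Delta=\bar t_{\mu_1}\cdots\bar t_{\mu_\ell}$, $t_\emptyset=\bar t_\emptyset=1$. **Formal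 solutions.** A formal solution is a formal series $F=\sum_{\Delta,\bar\Delta}F(\Delta|\bar\Delta|t_0)\,t_\Delta\bar t_{\bar\Delta}$ (sum over all pairs of Young diagrams, including empty ones; coefficients are smooth functions of $t_0$) whose substitution into the three equations gives identities. $g|_{t_0}$ denotes restriction of $g$ to $t_1=\bar t_1=t_2=\bar t_2=\ldots=0$. A formal solution is symmetric if $\partial_kF|_{t_0}=\bar\partial_kF|_{t_0}=0$ for all $k\ge1$. **Combinatorial constants.** All indices below are positive integers. (1) $P_{ij}(r_1,\ldots,r_m)$ is the number of pairs of sequences of positive integers $(i_1,\ldots,i_m)$, $(j_1,\ldots,j_m)$ with $\sum i_a=i$, $\sum j_a=j$, $r_a=i_a+j_a$ for all $a$. (2) $$T_{ij}(p_1,\ldots,p_m)=\sum_{\substack{k>0,\ n_a>0\\ n_1+\ldots+n_k=m}}\frac{(-1)^{m+1}}{k\,n_1!\cdots n_k!}P_{ij}\Big(\sum_{a=1}^{n_1}p_a,\ \sum_{a=n_1+1}^{n_1+n_2}p_a,\ \ldots,\ \sum_{a=n_1+\ldots+n_{k-1}+1}^{m}p_a\Big).$$ (3) $T_{i_1i_2}\begin{pmatrix}s_1\ldots s_m\\ \ell_1\ldots\ell_m\end{pmatrix}=T_{i_1i_2}(s_1,\ldots,s_m)$ if $\ell_1=\ldots=\ell_m=1$, and $0$ otherwise. For $k>2$, $$T_{i_1\ldots i_k}\begin{pmatrix}s_1\ldots s_m\\ \ell_1\ldots\ell_m\end{pmatrix}=\sum_{1\le i\le j\le m}\frac{\ell!}{(\ell_i-1)!\cdots(\ell_j-1)!}\,T_{i_1\ldots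 i_{k-1}}\begin{pmatrix}s_1\ldots s_{i-1}&s&s_{j+1}\ldots s_m\\ \ell_1\ldots\ell_{i-1}&\ell&\ell_{j+1}\ldots\ell_m\end{pmatrix}T_{s,i_k}(s_i,s_{i+1},\ldots,s_j),$$ where $s=s_i+\ldots+s_j-i_k$ and $\ell=(\ell_i-1)+\ldots+(\ell_j-1)$, and only pairs $(i,j)$ with $s>0$, $\ell>0$ contribute. $T$ is $0$ if some lower entry is not positive. (4) A partition of a sequence $\{a_1,\ldots,a_v\}$ of type $\begin{pmatrix}s_1\ldots s_m\\ n_1\ldots n_m\end{pmatrix}$ is a representation of it as a disjoint union of non-empty subsequences (entries being distinguished by position) $\{b^j_1,\ldots,b^j_{n_j}\}$, $j=1,\ldots,m$, with $b^j_1+\ldots+b^j_{n_j}=s_j$. (5) For $k,\bar k>1$, $$\tilde N_{\left(\begin{smallmatrix}i_1\ldots i_k\\ \bar i_1\ldots\bar i_{\bar k}\end{smallmatrix}\right)}\begin{pmatrix}s_1\ldots s_m\\ r_1\ldots r_m\end{pmatrix}=\frac{i_1\cdots i_k\,\bar i_1\cdots\bar i_{\bar k}}{s_1\cdots s_m}\sum T_{i_1\ldots i_k}\begin{pmatrix}s_1&\ldots&s_m\\ r_1-n_1+1&\ldots&r_m-n_m+1\end{pmatrix},$$ summed over all partitions of $\{\bar i_1,\ldots,\bar i_{\bar k}\}$ of type $\begin{pmatrix}s_1\ldots s_m\\ n_1\ldots n_m\end{pmatrix}$ (over all possible $n_1,\ldots,n_m$). For $k>1$, $$\tilde N_{\left(\begin{smallmatrix}i\\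 i_1\ldots i_k\end{smallmatrix}\right)}\begin{pmatrix}s\\ r\end{pmatrix}=\tilde N_{\left(\begin{smallmatrix}i_1\ldots i_k\\ i\end{smallmatrix}\right)}\begin{pmatrix}s\\ r\end{pmatrix}=\delta_{i,i_1+\ldots+i_k}\,\delta_{s,i}\,\delta_{r,k-1}\,i_1\cdots i_k,$$ and these two quantities are $0$ for arguments with $m>1$ columns. (6) For $\Delta=[\mu_1,\ldots,\mu_k]$, $\bar\Delta=[\bar\mu_1,\ldots,\bar\mu_{\bar k}]$, $$N_{(\Delta|\bar\Delta)}\begin{pmatrix}s_1\ldots s_m\\ r_1\ldots r_m\end{pmatrix}=\frac1{\sigma(\Delta)\sigma(\bar\Delta)}\tilde N_{\left(\begin{smallmatrix}\mu_1\ldots\mu_k\\ \bar\mu_1\ldots\bar\mu_{\bar k}\end{smallmatrix}\right)}\begin{pmatrix}s_1\ldots s_m\\ r_1\ldots r_m\end{pmatrix}.$$ *)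

theory Defs
  imports
    "HOL-Analysis.Analysis"
    "HOL-Library.Multiset"
    "HOL-Library.Function_Algebras"
begin

section \<open>Formal series with coefficients depending on \<open>t\<^sub>0\<close>\<close>

text \<open>
  The formal variables: \<open>T k\<close> and \<open>Tb k\<close> stand for $t_k$ and $\bar t_k$ with $k \ge 1$ (the index 0
  is never used, see \<open>toda_series\<close>); the others stand for $z^{-1}$, $\xi^{-1}$, $\bar z^{-1}$ and
  $\bar\xi^{-1}$. A monomial is the multiset of its variables. The parameter $t_0$ is an ordinary
  real variable, ranging over an open set, and coefficients are complex-valued functions of it.
\<close>

datatype var = T nat | Tb nat | Zinv | Xinv | Zbinv | Xbinv

type_synonym series = "var multiset \<Rightarrow> real \<Rightarrow> complex"

text \<open>
  On series, \<open>+\<close>, \<open>-\<close> and unary minus are the pointwise (hence coefficientwise) operations on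
  functions. The pointwise \<open>*\<close>, \<open>^\<close> and \<open>1\<close> on functions are not the ring operations of
  formal series; these are the following ones. The sum in \<open>smult\<close> runs over the factorizations
  \<open>M = A + (M - A)\<close> of a monomial.
\<close>

definition smult :: "series \<Rightarrow> series \<Rightarrow> series" (infixl \<open>\<star>\<close> 70) where
  "(a \<star> b) M t = (\<Sum>A | A \<subseteq># M. a A t * b (M - A) t)"

definition sone :: series where
  "sone M t = (if M = {#} then 1 else 0)"

definition svar :: "var \<Rightarrow> series" where
  "svar w M t = (if M = {#w#} then 1 else 0)"

primrec spow :: "series \<Rightarrow> nat \<Rightarrow> series" where
  "spow a 0 = sone"
| "spow a (Suc n) = a \<star> spow a n"

text \<open>
  Writing $a = a_0 + a_+$ with $a_0$ the constant term, $e^a = e^{a_0} \sum_n a_+^n / n!$. Only the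
  $a_+^n$ with $n \le |M|$ contribute to the coefficient at a monomial of degree $|M|$.
\<close>

definition sexp :: "series \<Rightarrow> series" where
  "sexp a M t = exp (a {#} t) *
     (\<Sum>n\<le>size M. spow (\<lambda>M'. if M' = {#} then 0 else a M') n M t / fact n)"

definition dt0 :: "(real \<Rightarrow> complex) \<Rightarrow> real \<Rightarrow> complex" where
  "dt0 g t = vector_derivative g (at t)"

definition d0 :: "series \<Rightarrow> series" where
  "d0 a M = dt0 (a M)"

definition dvar :: "var \<Rightarrow> series \<Rightarrow> series" where
  "dvar v a M t = of_nat (count M v + 1) * a (add_mset v M) t"

text \<open>
  \<open>DD w\<close> and \<open>DDb w\<close> are the operators $\sum_{k \ge 1} \frac{w^k}{k} \partial_k$ and
  $\sum_{k \ge 1} \frac{w^k}{k} \bar\partial_k$, where \<open>w\<close> is the inverse of the spectral parameter.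
  The coefficient of $w^k b$ at \<open>M\<close> is that of \<open>b\<close> at \<open>M\<close> with \<open>k\<close> factors \<open>w\<close> removed,
  and 0 if \<open>w\<close> occurs less than \<open>k\<close> times in \<open>M\<close>.
\<close>

definition DD :: "var \<Rightarrow> series \<Rightarrow> series" where
  "DD w a M t = (\<Sum>k = 1..count M w. dvar (T k) a (M - replicate_mset k w) t / of_nat k)"

definition DDb :: "var \<Rightarrow> series \<Rightarrow> series" where
  "DDb w a M t = (\<Sum>k = 1..count M w. dvar (Tb k) a (M - replicate_mset k w) t / of_nat k)"

definition series_eq_on :: "real set \<Rightarrow> series \<Rightarrow> series \<Rightarrow> bool" where
  "series_eq_on U a b \<longleftrightarrow> (\<forall>M. \<forall>t\<in>U. a M t = b M t)"


section \<open>Young diagrams\<close>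

definition young :: "nat list \<Rightarrow> bool" where
  "young \<Delta> \<longleftrightarrow> sorted_wrt (\<ge>) \<Delta> \<and> 0 \<notin> set \<Delta>"

definition sigma :: "nat list \<Rightarrow> nat" where
  "sigma \<Delta> = (\<Prod>r\<in>set \<Delta>. fact (count_list \<Delta> r))"

text \<open>The monomial $t_\Delta \bar t_{\bar\Delta}$.\<close>

definition tmon :: "nat list \<Rightarrow> nat list \<Rightarrow> var multiset" where
  "tmon \<Delta> \<Delta>b = mset (map T \<Delta>) + mset (map Tb \<Delta>b)"


section \<open>Symmetric formal solutions of the dispersionless 2D Toda hierarchy\<close>

definition smooth_fun_on :: "real set \<Rightarrow> (real \<Rightarrow> complex) \<Rightarrow> bool" where
  "smooth_fun_on U g \<longleftrightarrow> (\<forall>n. \<forall>t\<in>U. (dt0 ^^ n) g differentiable (at t))"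

text \<open>A formal series $\sum F(\Delta|\bar\Delta|t_0)\, t_\Delta \bar t_{\bar\Delta}$.\<close>

definition toda_series :: "real set \<Rightarrow> series \<Rightarrow> bool" where
  "toda_series U F \<longleftrightarrow>
     (\<forall>\<Delta> \<Delta>b. young \<Delta> \<longrightarrow> young \<Delta>b \<longrightarrow> smooth_fun_on U (F (tmon \<Delta> \<Delta>b))) \<and>
     (\<forall>M. (\<nexists>\<Delta> \<Delta>b. young \<Delta> \<and> young \<Delta>b \<and> M = tmon \<Delta> \<Delta>b) \<longrightarrow> (\<forall>t\<in>U. F M t = 0))"

text \<open>
  The first two equations are divided by $z\xi$ and $\bar z\bar\xi$, so that only negative powers
  of the spectral parameters occur.
\<close>

definition toda_hierarchy :: "real set \<Rightarrow> series \<Rightarrow> bool" where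
  "toda_hierarchy U F \<longleftrightarrow>
     series_eq_on U
       ((svar Xinv - svar Zinv) \<star> sexp (DD Zinv (DD Xinv F)))
       (svar Xinv \<star> sexp (- d0 (DD Zinv F)) - svar Zinv \<star> sexp (- d0 (DD Xinv F))) \<and>
     series_eq_on U
       ((svar Xbinv - svar Zbinv) \<star> sexp (DDb Zbinv (DDb Xbinv F)))
       (svar Xbinv \<star> sexp (- d0 (DDb Zbinv F)) - svar Zbinv \<star> sexp (- d0 (DDb Xbinv F))) \<and>
     series_eq_on U
       (sone - sexp (- DD Zinv (DDb Xbinv F)))
       (svar Zinv \<star> svar Xbinv \<star> sexp (d0 (d0 F + DD Zinv F + DDb Xbinv F)))"

definition formal_solution :: "real set \<Rightarrow> series \<Rightarrow> bool" where
  "formal_solution U F \<longleftrightarrow> toda_series U F \<and> toda_hierarchy U F"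

text \<open>The restriction to $t_1 = \bar t_1 = t_2 = \bar t_2 = \dots = 0$.\<close>

definition restr :: "series \<Rightarrow> real \<Rightarrow> complex" where
  "restr F = F {#}"

definition symmetric_solution :: "real set \<Rightarrow> series \<Rightarrow> bool" where
  "symmetric_solution U F \<longleftrightarrow> formal_solution U F \<and>
     (\<forall>k\<ge>1. \<forall>t\<in>U. restr (dvar (T k) F) t = 0 \<and> restr (dvar (Tb k) F) t = 0)"


section \<open>Combinatorial constants\<close>

definition P :: "nat \<Rightarrow> nat \<Rightarrow> nat list \<Rightarrow> nat" where
  "P i j rs = card {(is, js). length is = length rs \<and> length js = length rs \<and>
     0 \<notin> set is \<and> 0 \<notin> set js \<and> sum_list is = i \<and> sum_list js = j \<and>
     (\<forall>a<length rs. rs ! a = is ! a + js ! a)}"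

text \<open>\<open>chunks [n\<^sub>1, \<dots>, n\<^sub>k] ps\<close> cuts \<open>ps\<close> into consecutive blocks of lengths \<open>n\<^sub>1, \<dots>, n\<^sub>k\<close>.\<close>

primrec chunks :: "nat list \<Rightarrow> 'a list \<Rightarrow> 'a list list" where
  "chunks [] ps = []"
| "chunks (n # ns) ps = take n ps # chunks ns (drop n ps)"

definition T2 :: "nat \<Rightarrow> nat \<Rightarrow> nat list \<Rightarrow> rat" where
  "T2 i j ps = (\<Sum>ns | ns \<noteq> [] \<and> 0 \<notin> set ns \<and> sum_list ns = length ps.
     (-1) ^ (length ps + 1) / (of_nat (length ns) * (\<Prod>n\<leftarrow>ns. fact n))
       * of_nat (P i j (map sum_list (chunks ns ps))))"

text \<open>
  The two-row array with columns \<open>(s\<^sub>1, \<ell>\<^sub>1), \<dots>, (s\<^sub>m, \<ell>\<^sub>m)\<close> is the list of its columns.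
  In the recursion \<open>(a, b)\<close> is the pair \<open>(i - 1, j - 1)\<close>, \<open>mid\<close> is the list of the columns
  from \<open>i\<close> to \<open>j\<close>, and \<open>last is\<close> is $i_k$. The condition $s > 0$ is tested before the truncated
  subtraction.
\<close>

fun Tk :: "nat list \<Rightarrow> (nat \<times> nat) list \<Rightarrow> rat" where
  "Tk is cols =
    (if \<exists>c\<in>set cols. snd c = 0 then 0
     else if length is = 2 then
       (if \<forall>c\<in>set cols. snd c = 1 then T2 (is ! 0) (is ! 1) (map fst cols) else 0)
     else if length is > 2 then
       (\<Sum>(a, b) \<in> {(a, b). a \<le> b \<and> b < length cols}.
          let mid = take (b + 1 - a) (drop a cols);
              s = sum_list (map fst mid) - last is;
              l = (\<Sum>c\<leftarrow>mid. snd c - 1)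
          in if sum_list (map fst mid) > last is \<and> l > 0
             then fact l / (\<Prod>c\<leftarrow>mid. fact (snd c - 1))
                    * Tk (butlast is) (take a cols @ [(s, l)] @ drop (b + 1) cols)
                    * T2 s (last is) (map fst mid)
             else 0)
     else 0)"

declare Tk.simps [simp del]

text \<open>
  A partition of the sequence \<open>as\<close> into subsequences with sums \<open>s\<^sub>1, \<dots>, s\<^sub>m\<close> is the list of the
  position sets of its blocks. It is labelled: the \<open>j\<close>-th block belongs to the \<open>j\<close>-th column. Its
  type has the block sizes \<open>card (Bs ! j)\<close> as lower row.
\<close>

definition seq_partitions :: "nat list \<Rightarrow> nat list \<Rightarrow> nat set list set" where
  "seq_partitions as ss = {Bs. length Bs = length ss \<and>
     (\<forall>j<length Bs. Bs ! j \<noteq> {} \<and> (\<Sum>p\<in>Bs ! j. as ! p) = ss ! j) \<and>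
     (\<forall>j<length Bs. \<forall>j'<length Bs. j \<noteq> j' \<longrightarrow> Bs ! j \<inter> Bs ! j' = {}) \<and>
     \<Union>(set Bs) = {..<length as}}"

text \<open>
  The truncated difference \<open>r + 1 - n\<close> is 0 exactly when $r - n + 1 \le 0$, and then the
  corresponding \<open>Tk\<close> is 0. The value for two index sequences of length 1 is not specified in the
  theory and is never used.
\<close>

definition Ntilde :: "nat list \<Rightarrow> nat list \<Rightarrow> (nat \<times> nat) list \<Rightarrow> rat" where
  "Ntilde is ibs cols =
    (if length is > 1 \<and> length ibs > 1 then
       of_nat (prod_list is * prod_list ibs) / of_nat (prod_list (map fst cols))
         * (\<Sum>Bs\<in>seq_partitions ibs (map fst cols).
              Tk is (map (\<lambda>((s, r), B). (s, r + 1 - card B)) (zip cols Bs)))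
     else if length is = 1 \<and> length ibs > 1 then
       (if hd is = sum_list ibs \<and> cols = [(hd is, length ibs - 1)]
        then of_nat (prod_list ibs) else 0)
     else if length is > 1 \<and> length ibs = 1 then
       (if hd ibs = sum_list is \<and> cols = [(hd ibs, length is - 1)]
        then of_nat (prod_list is) else 0)
     else 0)"

definition NN :: "nat list \<Rightarrow> nat list \<Rightarrow> (nat \<times> nat) list \<Rightarrow> rat" where
  "NN \<Delta> \<Delta>b cols = Ntilde \<Delta> \<Delta>b cols / of_nat (sigma \<Delta> * sigma \<Delta>b)"

text \<open>
  The arrays of positive integers with at least one column, with upper row of sum \<open>d\<close> and lower
  row of sum \<open>e\<close>.
\<close>

definition arrays :: "nat \<Rightarrow> nat \<Rightarrow> (nat \<times> nat) list set" where
  "arrays d e = {cols. cols \<noteq> [] \<and> (\<forall>(s, r)\<in>set cols. s > 0 \<and> r > 0) \<and>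
     sum_list (map fst cols) = d \<and> sum_list (map snd cols) = e}"

end

theory Submission
  imports Defs
begin

text \<open>
  Expanding the coefficients in Taylor series at a fixed $t_0$ turns the solution into a formal power
  series in $t_0$, $t_k$, $\bar t_k$, and all the partial derivatives into commuting derivations of a
  commutative ring. The first equation says $D(z)D(\xi)F = \log(1 - X)$, where
  $X = \sum_{i,j \ge 1} h_{i+j} z^{-i} \xi^{-j}$ and $\sum_n h_n z^{-n} = e^{-\partial_0 D(z)F}$;
  expanding the logarithm expresses $\partial_i\partial_jF$ by the $\partial_0\partial_kF$ with
  coefficients $T_{ij}$. Applying further $\partial_k$ to this formula yields the recursion that
  defines $T_{i_1 \ldots i_k}$, and applying $\bar\partial_{j_1}, \ldots, \bar\partial_{j_{\bar k}}$
  distributes these derivations over the factors, that is, sums over the labelled partitions of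
  $\{j_1, \ldots, j_{\bar k}\}$. For a symmetric solution a factor that receives none of them vanishes at
  $t_k = \bar t_k = 0$, and the others are determined by
  $\partial_i\bar\partial_jF|_{t_0} = \delta_{ij} i f^i$, which is what the third equation says there.
\<close>

subsection \<open>Formal power series in several variables\<close>

text \<open>The obstacle is that \<open>dt0\<close> obeys the Leibniz rule only on differentiable
  functions and that the equations hold only on \<open>U\<close>, so the coefficients are not
  elements of a ring with a derivation as they stand. Taylor expansion at a point of the open set
  \<open>U\<close> is what removes both conditions; smoothness and openness are needed for this
  passage and not in the algebra. The ring gets a type of its own, because functions already carry
  the pointwise product. The algebra is done in abstract locales, so that one argument serves both
  kinds of variables. Formal exponentials are taken only of series without constant term. The
  exponent on the right of the third equation has one, namely the second derivative of F(t_0); this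
  equation is therefore used only in restricted form, where the exponential of that term is f. The
  shift r - n + 1 in \<open>Ntilde\<close> has this origin: a column (s, l) of \<open>Tk\<close>
  stands for the factor (1/s) d0^l D_s F, and n barred derivations turn it, at the origin, into a
  multiple of d0^(l + n - 1) (f^s), so that r = l + n - 1.\<close>

typedef 'v mser = "UNIV :: ('v multiset \<Rightarrow> complex) set"
  morphisms mcf Mser ..

lemma mcf_Mser [simp]: "mcf (Mser f) = f"
  by (simp add: Mser_inverse)

lemma mser_eqI: "(\<And>M. mcf a M = mcf b M) \<Longrightarrow> a = b"
  by (metis ext mcf_inject)

lemma finite_submsets [simp, intro]: "finite {A. A \<subseteq># M}"
proof -
  have "{A. A \<subseteq># M} \<subseteq> mset ` {xs. set xs \<subseteq> set_mset M \<and> length xs \<le> size M}"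
  proof
    fix A assume "A \<in> {A. A \<subseteq># M}"
    then have A: "A \<subseteq># M" by simp
    obtain xs where xs: "mset xs = A" using ex_mset by blast
    then show "A \<in> mset ` {xs. set xs \<subseteq> set_mset M \<and> length xs \<le> size M}"
      using A set_mset_mono[OF A] size_mset_mono[OF A] by (intro image_eqI[of _ _ xs]) auto
  qed
  then show ?thesis
    by (rule finite_subset) (simp add: finite_lists_length_le)
qed

lemma sum_submsets_flip: "(\<Sum>A | A \<subseteq># M. g A (M - A)) = (\<Sum>A | A \<subseteq># M. g (M - A) A)"
  by (rule sum.reindex_bij_witness[of _ "\<lambda>A. M - A" "\<lambda>A. M - A"])
     (auto simp: subset_mset.diff_diff_right)

text \<open>Both sides run over the ways to write M as a sum of three multisets; this is
  associativity of the convolution product.\<close>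

lemma sum_submsets_assoc:
  "(\<Sum>A | A \<subseteq># M. \<Sum>B | B \<subseteq># A. g B (A - B) (M - A)) =
   (\<Sum>B | B \<subseteq># M. \<Sum>C | C \<subseteq># M - B. g B C (M - B - C))"
proof -
  have "(\<Sum>(A, B)\<in>(SIGMA A:{A. A \<subseteq># M}. {B. B \<subseteq># A}). g B (A - B) (M - A)) =
        (\<Sum>(B, C)\<in>(SIGMA B:{B. B \<subseteq># M}. {C. C \<subseteq># M - B}). g B C (M - B - C))"
    by (rule sum.reindex_bij_witness[of _ "\<lambda>(B, C). (B + C, B)" "\<lambda>(A, B). (B, A - B)"])
       (auto simp: subset_mset.le_diff_conv2 subset_mset.diff_diff_right subset_mset.add_diff_assoc2
         diff_diff_add_mset add.commute intro: subset_mset.order_trans)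
  then show ?thesis by (simp add: sum.Sigma)
qed

instantiation mser :: (type) comm_ring_1
begin
definition "0 = Mser (\<lambda>M. 0)"
definition "1 = Mser (\<lambda>M. if M = {#} then 1 else 0)"
definition "a + b = Mser (\<lambda>M. mcf a M + mcf b M)"
definition "a - b = Mser (\<lambda>M. mcf a M - mcf b M)"
definition "- a = Mser (\<lambda>M. - mcf a M)"
definition "a * b = Mser (\<lambda>M. \<Sum>A | A \<subseteq># M. mcf a A * mcf b (M - A))"
instance
proof
  fix a b c :: "'a mser"
  note defs = zero_mser_def one_mser_def plus_mser_def minus_mser_def uminus_mser_def
    times_mser_def
  show "a + b + c = a + (b + c)" "a + b = b + a" "0 + a = a" "- a + a = 0" "a - b = a + - b"
    by (simp_all add: defs algebra_simps mcf_inverse)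
  show "a * b = b * a"
    unfolding defs by (subst sum_submsets_flip) (simp add: mult.commute)
  show "a * b * c = a * (b * c)"
  proof (rule mser_eqI)
    fix M
    have "mcf (a * b * c) M =
        (\<Sum>A | A \<subseteq># M. \<Sum>B | B \<subseteq># A. mcf a B * mcf b (A - B) * mcf c (M - A))"
      by (simp add: defs sum_distrib_right)
    also have "\<dots> = (\<Sum>B | B \<subseteq># M. \<Sum>C | C \<subseteq># M - B. mcf a B * mcf b C * mcf c (M - B - C))"
      by (rule sum_submsets_assoc)
    also have "\<dots> = mcf (a * (b * c)) M"
      by (simp add: defs sum_distrib_left mult.assoc)
    finally show "mcf (a * b * c) M = mcf (a * (b * c)) M" .
  qed
  show "1 * a = a"
  proof (rule mser_eqI)
    fix M
    have "mcf (1 * a) M = (\<Sum>A | A \<subseteq># M. if A = {#} then mcf a M else 0)"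
      unfolding defs mcf_Mser by (rule sum.cong) auto
    then show "mcf (1 * a) M = mcf a M" by simp
  qed
  show "(a + b) * c = a * c + b * c"
    by (simp add: defs algebra_simps sum.distrib)
  have "mcf (0 :: 'a mser) {#} \<noteq> mcf (1 :: 'a mser) {#}"
    by (simp add: defs)
  then show "(0 :: 'a mser) \<noteq> 1" by metis
qed
end

instantiation mser :: (type) real_algebra_1
begin
definition "r *\<^sub>R a = Mser (\<lambda>M. r *\<^sub>R mcf a M)"
instance
proof
  fix a b :: "'a mser" and r s :: real
  note defs = plus_mser_def times_mser_def scaleR_mser_def
  show "r *\<^sub>R (a + b) = r *\<^sub>R a + r *\<^sub>R b" "(r + s) *\<^sub>R a = r *\<^sub>R a + s *\<^sub>R a"
    "r *\<^sub>R s *\<^sub>R a = (r * s) *\<^sub>R a" "1 *\<^sub>R a = a"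
    by (simp_all add: defs scaleR_add_right scaleR_add_left mcf_inverse)
  show "r *\<^sub>R a * b = r *\<^sub>R (a * b)" "a * r *\<^sub>R b = r *\<^sub>R (a * b)"
    by (simp_all add: defs scaleR_sum_right)
qed
end

lemma mcf_simps [simp]:
  "mcf 0 M = 0" "mcf 1 M = (if M = {#} then 1 else 0)"
  "mcf (a + b) M = mcf a M + mcf b M" "mcf (a - b) M = mcf a M - mcf b M"
  "mcf (- a) M = - mcf a M" "mcf (r *\<^sub>R a) M = r *\<^sub>R mcf a M"
  by (simp_all add: zero_mser_def one_mser_def plus_mser_def minus_mser_def uminus_mser_def
    scaleR_mser_def)

lemma mcf_mult: "mcf (a * b) M = (\<Sum>A | A \<subseteq># M. mcf a A * mcf b (M - A))"
  by (simp add: times_mser_def)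

lemma mcf_mult_empty [simp]: "mcf (a * b) {#} = mcf a {#} * mcf b {#}"
  by (simp add: mcf_mult)

lemma mcf_sum [simp]: "mcf (sum f S) M = (\<Sum>x\<in>S. mcf (f x) M)"
  by (induction S rule: infinite_finite_induct) auto

definition mvar :: "'v \<Rightarrow> 'v mser" where
  "mvar v = Mser (\<lambda>M. if M = {#v#} then 1 else 0)"

lemma mcf_mvar_mult:
  "mcf (mvar v * a) M = (if v \<in># M then mcf a (M - {#v#}) else 0)"
proof -
  have "mcf (mvar v * a) M = (\<Sum>A | A \<subseteq># M. if A = {#v#} then mcf a (M - {#v#}) else 0)"
    unfolding mcf_mult by (rule sum.cong) (auto simp: mvar_def)
  then show ?thesis by simp
qed

definition pd :: "'v \<Rightarrow> 'v mser \<Rightarrow> 'v mser" where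
  "pd v a = Mser (\<lambda>M. of_nat (count M v + 1) * mcf a (add_mset v M))"

lemma mcf_pd: "mcf (pd v a) M = of_nat (count M v + 1) * mcf a (add_mset v M)"
  by (simp add: pd_def)

lemma pd_linear:
  "pd v (a + b) = pd v a + pd v b" "pd v (r *\<^sub>R a) = r *\<^sub>R pd v a"
  by (rule mser_eqI; simp add: mcf_pd algebra_simps)+

lemma sum_submsets_add:
  assumes "\<And>A. v \<notin># A \<Longrightarrow> g A = 0"
  shows "(\<Sum>A | A \<subseteq># add_mset v M. g A) = (\<Sum>A | A \<subseteq># M. g (add_mset v A))"
proof -
  have "(\<Sum>A | A \<subseteq># add_mset v M. g A) = (\<Sum>A\<in>add_mset v ` {A. A \<subseteq># M}. g A)"
  proof (rule sum.mono_neutral_right)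
    show "\<forall>A\<in>{A. A \<subseteq># add_mset v M} - add_mset v ` {A. A \<subseteq># M}. g A = 0"
    proof
      fix A assume A: "A \<in> {A. A \<subseteq># add_mset v M} - add_mset v ` {A. A \<subseteq># M}"
      show "g A = 0"
      proof (rule assms, rule notI)
        assume "v \<in># A"
        then obtain B where "A = add_mset v B" by (metis mset_add)
        then show False using A by auto
      qed
    qed
  qed auto
  also have "\<dots> = (\<Sum>A | A \<subseteq># M. g (add_mset v A))"
    by (subst sum.reindex) (auto simp: inj_on_def)
  finally show ?thesis .
qed

lemma pd_mult: "pd v (a * b) = pd v a * b + a * pd v b"
proof (rule mser_eqI)
  fix M
  let ?N = "add_mset v M"
  have *: "(\<Sum>A | A \<subseteq># ?N. of_nat (count A v) * mcf a A * mcf b (?N - A)) = mcf (pd v a * b) M" for a b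
    by (subst sum_submsets_add) (auto simp: mcf_mult mcf_pd count_eq_zero_iff)
  \<comment> \<open>The factor \<open>count ?N v\<close> splits as
    \<open>count A v + count (?N - A) v\<close>, one part for each term of the Leibniz rule. Passing
    to complements makes the second part an instance of the auxiliary fact above.\<close>
  have "mcf (pd v (a * b)) M =
      (\<Sum>A | A \<subseteq># ?N. of_nat (count A v + count (?N - A) v) * (mcf a A * mcf b (?N - A)))"
    unfolding mcf_pd mcf_mult sum_distrib_left
  proof (rule sum.cong)
    fix A assume "A \<in> {A. A \<subseteq># ?N}"
    then have "count A v \<le> count ?N v" by (metis mem_Collect_eq mset_subset_eq_count)
    then show "of_nat (count M v + 1) * (mcf a A * mcf b (?N - A)) =
      of_nat (count A v + count (?N - A) v) * (mcf a A * mcf b (?N - A))" by auto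
  qed simp
  also have "\<dots> = (\<Sum>A | A \<subseteq># ?N. of_nat (count A v) * mcf a A * mcf b (?N - A)) +
      (\<Sum>A | A \<subseteq># ?N. of_nat (count (?N - A) v) * mcf b (?N - A) * mcf a A)"
    by (simp add: sum.distrib[symmetric] algebra_simps)
  also have "(\<Sum>A | A \<subseteq># ?N. of_nat (count (?N - A) v) * mcf b (?N - A) * mcf a A) =
      (\<Sum>A | A \<subseteq># ?N. of_nat (count A v) * mcf b A * mcf a (?N - A))"
    by (rule sum_submsets_flip[symmetric])
  finally show "mcf (pd v (a * b)) M = mcf (pd v a * b + a * pd v b) M"
    by (simp only: * mcf_simps) (simp add: mult.commute)
qed

lemma pd_commute: "pd v (pd w a) = pd w (pd v a)"
  by (rule mser_eqI) (auto simp: mcf_pd add_mset_commute)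

subsection \<open>Exponential and logarithm\<close>

lemma mcf_power_eq_0:
  assumes "mcf a {#} = 0" "size M < n"
  shows "mcf (a ^ n) M = 0"
  using assms(2)
proof (induction n arbitrary: M)
  case (Suc n)
  have "mcf a A * mcf (a ^ n) (M - A) = 0" if "A \<subseteq># M" for A
  proof (cases "A = {#}")
    case False
    then have "size A > 0" by (simp add: nonempty_has_size)
    then have "size (M - A) < n" using that Suc.prems size_mset_mono[OF that]
      by (simp add: size_Diff_submset)
    then show ?thesis using Suc.IH by simp
  qed (simp add: assms(1))
  then show ?case unfolding power_Suc mcf_mult by (intro sum.neutral) blast
qed simp

text \<open>Meant for series without constant term: powers with exponent above \<open>size M\<close>
  then have coefficient 0 at M, so the truncation is the full exponential series.\<close>

definition mexp :: "'v mser \<Rightarrow> 'v mser" where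
  "mexp a = Mser (\<lambda>M. \<Sum>n\<le>size M. mcf (a ^ n) M / fact n)"

lemma mcf_mexp:
  assumes "mcf a {#} = 0" "size M \<le> K"
  shows "mcf (mexp a) M = (\<Sum>n\<le>K. mcf (a ^ n) M / fact n)"
  unfolding mexp_def mcf_Mser
  by (rule sum.mono_neutral_left) (use assms mcf_power_eq_0[OF assms(1)] in auto)

text \<open>The Euler operator, a derivation that multiplies each homogeneous part by its degree. It
  determines every coefficient except the constant one, so a logarithm can be verified after
  applying it.\<close>

definition euler :: "'v mser \<Rightarrow> 'v mser" where
  "euler a = Mser (\<lambda>M. of_nat (size M) * mcf a M)"

lemma mcf_euler [simp]: "mcf (euler a) M = of_nat (size M) * mcf a M"
  by (simp add: euler_def)

lemma euler_mult: "euler (a * b) = euler a * b + a * euler b"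
proof (rule mser_eqI)
  fix M
  show "mcf (euler (a * b)) M = mcf (euler a * b + a * euler b) M"
    unfolding mcf_simps mcf_euler mcf_mult sum_distrib_left sum.distrib[symmetric]
  proof (rule sum.cong)
    fix A assume "A \<in> {A. A \<subseteq># M}"
    then have "size M = size A + size (M - A)"
      by (metis mem_Collect_eq size_union subset_mset.add_diff_inverse)
    then show "of_nat (size M) * (mcf a A * mcf b (M - A)) =
      of_nat (size A) * mcf a A * mcf b (M - A) + mcf a A * (of_nat (size (M - A)) * mcf b (M - A))"
      by (simp add: algebra_simps)
  qed simp
qed

lemma euler_linear [simp]:
  "euler (a + b) = euler a + euler b" "euler (a - b) = euler a - euler b"
  "euler (r *\<^sub>R a) = r *\<^sub>R euler a"
  "euler (sum f S) = (\<Sum>x\<in>S. euler (f x))" "euler 1 = 0"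
  by (rule mser_eqI; simp add: algebra_simps sum_distrib_left)+

lemma euler_power: "euler (a ^ Suc n) = real (Suc n) *\<^sub>R (a ^ n * euler a)"
proof (induction n)
  case (Suc n)
  have "euler (a ^ Suc (Suc n)) = euler a * a ^ Suc n + a * euler (a ^ Suc n)"
    by (simp only: power_Suc[of a "Suc n"] euler_mult)
  also have "\<dots> = real (Suc (Suc n)) *\<^sub>R (a ^ Suc n * euler a)"
    unfolding Suc.IH of_nat_Suc[of "Suc n"] scaleR_add_left by (simp add: algebra_simps)
  finally show ?case .
qed simp

lemma euler_mexp:
  fixes a :: "'a mser"
  assumes "mcf a {#} = 0"
  shows "euler (mexp a) = euler a * mexp a"
proof (rule mser_eqI)
  fix M :: "'a multiset"
  define K where "K = size M"
  have E: "mcf (mexp a) A = mcf (\<Sum>n\<le>K. (1 / fact n) *\<^sub>R a ^ n) A" if "A \<subseteq># M" for A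
    using size_mset_mono[OF that] by (simp add: mcf_mexp[OF assms, of A K] K_def scaleR_conv_of_real[where 'a=complex])
  \<comment> \<open>Differentiation lowers the truncation order by one. At submultisets of M both
    truncations agree with \<open>mexp a\<close>, because \<open>a ^ Suc K\<close> starts above
    degree K.\<close>
  have "euler (\<Sum>n\<le>Suc K. (1 / fact n) *\<^sub>R a ^ n) = euler a * (\<Sum>n\<le>K. (1 / fact n) *\<^sub>R a ^ n)"
    by (simp add: sum.atMost_Suc_shift euler_power sum_distrib_left
         del: sum.atMost_Suc power_Suc fact_Suc) (simp add: mult.commute)
  then have "mcf (euler (\<Sum>n\<le>Suc K. (1 / fact n) *\<^sub>R a ^ n)) M =
      mcf (euler a * (\<Sum>n\<le>K. (1 / fact n) *\<^sub>R a ^ n)) M" by simp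
  also have "\<dots> = mcf (euler a * mexp a) M"
    unfolding mcf_mult by (rule sum.cong) (simp_all add: E)
  also have "mcf (euler (\<Sum>n\<le>Suc K. (1 / fact n) *\<^sub>R a ^ n)) M = mcf (euler (mexp a)) M"
    using E[of M] mcf_power_eq_0[OF assms, of M "Suc K"]
    by (simp add: K_def sum_distrib_left del: power_Suc)
  finally show "mcf (euler (mexp a)) M = mcf (euler a * mexp a) M" by simp
qed

lemma mcf_mexp_empty: "mcf a {#} = 0 \<Longrightarrow> mcf (mexp a) {#} = 1"
  by (simp add: mexp_def)

text \<open>Induction on the degree: every term of the product at M other than
  \<open>mcf c M * mcf b {#}\<close> contains a coefficient of c at a smaller multiset. This cancels
  a unit although the product is known to vanish only at submultisets of M.\<close>

lemma mcf_mult_unit_eq_0: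
  assumes "mcf b {#} = 1" "\<And>A. A \<subseteq># M \<Longrightarrow> mcf (c * b) A = 0"
  shows "mcf c M = 0"
  using assms(2)
proof (induction "size M" arbitrary: M rule: less_induct)
  case less
  have "mcf c A * mcf b (M - A) = 0" if "A \<subseteq># M" "A \<noteq> M" for A
  proof -
    have "A \<subset># M" using that by simp
    then have "size A < size M" by (rule mset_subset_size)
    then have "mcf c A = 0" using less.hyps less.prems that
      by (meson subset_mset.order_trans)
    then show ?thesis by simp
  qed
  then have "mcf (c * b) M = (\<Sum>A\<in>{M}. mcf c A * mcf b (M - A))"
    unfolding mcf_mult by (intro sum.mono_neutral_right) auto
  then show ?case using less.prems[of M] assms(1) by simp
qed

text \<open>Both sides of \<open>W = log (1 - X)\<close> have the same Euler derivative.\<close>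

lemma mcf_log:
  assumes "mcf W {#} = 0" "size M \<le> K"
  shows "mcf W M = - (\<Sum>k=1..K. mcf ((1 - mexp W) ^ k) M / of_nat k)"
proof (cases "M = {#}")
  case True
  have "mcf ((1 - mexp W) ^ k) {#} = 0" if "k \<ge> 1" for k
    using that mcf_mexp_empty[OF assms(1)] by (intro mcf_power_eq_0) auto
  then show ?thesis using True assms by simp
next
  case False
  define X where "X = 1 - mexp W"
  define G where "G = - (\<Sum>k<K. (1 / real (Suc k)) *\<^sub>R X ^ Suc k)"
  have X0: "mcf X {#} = 0" by (simp add: X_def mcf_mexp_empty assms)
  have geo: "(1 - X) * (\<Sum>k<K. X ^ k) = 1 - X ^ K"
    by (metis one_diff_power_eq)
  have eG: "euler G = - ((\<Sum>k<K. X ^ k) * euler X)"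
  proof -
    have "euler G = - euler (\<Sum>k<K. (1 / real (Suc k)) *\<^sub>R X ^ Suc k)"
      by (rule mser_eqI) (simp only: G_def mcf_euler mcf_simps mult_minus_right)
    then show ?thesis by (simp add: euler_power sum_distrib_right del: power_Suc of_nat_Suc)
  qed
  have "euler G * (1 - X) = - ((1 - X) * (\<Sum>k<K. X ^ k) * euler X)"
    unfolding eG by (simp add: algebra_simps)
  then have 1: "euler G * (1 - X) = X ^ K * euler X - euler X"
    unfolding geo by (simp add: algebra_simps)
  have E1: "1 - X = mexp W" by (simp add: X_def)
  have "euler W * (1 - X) = euler (1 - X)"
    unfolding E1 by (simp add: euler_mexp[OF assms(1)])
  then have "euler W * (1 - X) = - euler X" by simp
  then have 2: "euler (W - G) * (1 - X) = - (X ^ K * euler X)"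
    using 1 by (simp only: euler_linear left_diff_distrib) simp
  \<comment> \<open>\<open>X ^ K * euler X\<close> is the error caused by truncating the logarithm
    after K terms. It starts above degree K, since neither X nor \<open>euler X\<close> has a
    constant term.\<close>
  have 3: "mcf (X ^ K * euler X) A = 0" if "A \<subseteq># M" for A
  proof -
    have "mcf (X ^ K) B * mcf (euler X) (A - B) = 0" if B: "B \<subseteq># A" for B
    proof (cases "B = A")
      case False
      then have "B \<subset># M" using B \<open>A \<subseteq># M\<close> by (metis subset_mset.le_neq_trans subset_mset.less_le_trans)
      then have "size B < K" using mset_subset_size assms(2) by fastforce
      then show ?thesis using mcf_power_eq_0[OF X0] by simp
    qed simp
    then show ?thesis unfolding mcf_mult by (intro sum.neutral) blast
  qed
  have "mcf (euler (W - G)) M = 0"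
    by (rule mcf_mult_unit_eq_0[of "1 - X"]) (use X0 2 3 in auto)
  then have "mcf W M = mcf G M" using False by simp
  also have "\<dots> = - (\<Sum>k=1..K. mcf (X ^ k) M / of_nat k)"
    unfolding G_def
    by (simp add: scaleR_conv_of_real[where 'a=complex] sum.atLeast1_atMost_eq
        del: power_Suc of_nat_Suc)
  finally show ?thesis by (simp add: X_def)
qed

subsection \<open>Coefficients with respect to two of the variables\<close>

lemma sum_submsets_replicate:
  assumes "v \<notin># M"
  shows "(\<Sum>A | A \<subseteq># M + replicate_mset n v. g A) =
    (\<Sum>k\<le>n. \<Sum>A | A \<subseteq># M. g (A + replicate_mset k v))"
proof -
  have *: "filter_mset ((\<noteq>) v) A \<subseteq># M \<and> count A v \<le> n" if "A \<subseteq># M + replicate_mset n v" for A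
  proof
    have "filter_mset ((\<noteq>) v) A \<subseteq># filter_mset ((\<noteq>) v) (M + replicate_mset n v)"
      using that by (rule multiset_filter_mono)
    also have "\<dots> \<subseteq># M" by (auto simp: subseteq_mset_def)
    finally show "filter_mset ((\<noteq>) v) A \<subseteq># M" .
    show "count A v \<le> n"
      using mset_subset_eq_count[OF that, of v] assms by (simp add: not_in_iff)
  qed
  have "(\<Sum>A | A \<subseteq># M + replicate_mset n v. g A) =
      (\<Sum>(k, A)\<in>(SIGMA k:{..n}. {A. A \<subseteq># M}). g (A + replicate_mset k v))"
  proof (rule sum.reindex_bij_witness[of _ "\<lambda>(k, A). A + replicate_mset k v"
        "\<lambda>A. (count A v, filter_mset ((\<noteq>) v) A)"], goal_cases)
    case (1 A)
    show ?case by (simp add: multiset_eq_iff)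
  next
    case (2 A)
    then show ?case using * by auto
  next
    case (3 b)
    then obtain k A where b: "b = (k, A)" "k \<le> n" "A \<subseteq># M" by auto
    then have "v \<notin># A" using assms by (meson mset_subset_eqD)
    then show ?case using b by (auto simp: multiset_eq_iff count_eq_zero_iff)
  next
    case (4 b)
    then show ?case
      by (auto simp: subseteq_mset_def intro!: add_mono)
  next
    case (5 A)
    have "filter_mset ((\<noteq>) v) A + replicate_mset (count A v) v = A" by (simp add: multiset_eq_iff)
    then show ?case by simp
  qed
  then show ?thesis by (simp add: sum.Sigma)
qed

text \<open>The coefficient of x^i y^j, a series in the other variables. It is kept in the same type
  and set to 0 at monomials containing x or y, so that such coefficients can be multiplied in the
  same ring.\<close>

definition cf :: "'v \<Rightarrow> 'v \<Rightarrow> nat \<Rightarrow> nat \<Rightarrow> 'v mser \<Rightarrow> 'v mser" where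
  "cf x y i j a = Mser (\<lambda>N. if x \<in># N \<or> y \<in># N then 0
     else mcf a (N + replicate_mset i x + replicate_mset j y))"

lemma mcf_cf: "mcf (cf x y i j a) N = (if x \<in># N \<or> y \<in># N then 0
     else mcf a (N + replicate_mset i x + replicate_mset j y))"
  by (simp add: cf_def)

lemma cf_swap: "cf x y i j a = cf y x j i a"
  by (rule mser_eqI) (auto simp: mcf_cf add_ac)

lemma cf_linear [simp]:
  "cf x y i j (a + b) = cf x y i j a + cf x y i j b"
  "cf x y i j (a - b) = cf x y i j a - cf x y i j b"
  "cf x y i j (- a) = - cf x y i j a"
  "cf x y i j (r *\<^sub>R a) = r *\<^sub>R cf x y i j a"
  by (rule mser_eqI; simp add: mcf_cf)+

lemma cf_1: "cf x y i j 1 = (if i = 0 \<and> j = 0 then 1 else 0)"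
  by (rule mser_eqI) (auto simp: mcf_cf)

lemma cf_mvar_mult:
  assumes "x \<noteq> y"
  shows "cf x y i j (mvar x * a) = (if i = 0 then 0 else cf x y (i - 1) j a)"
    and "cf x y i j (mvar y * a) = (if j = 0 then 0 else cf x y i (j - 1) a)"
  using assms by (intro mser_eqI; cases i; cases j; auto simp: mcf_cf mcf_mvar_mult)+

lemma cf_mult:
  assumes "x \<noteq> y"
  shows "cf x y i j (a * b) = (\<Sum>p\<le>i. \<Sum>q\<le>j. cf x y p q a * cf x y (i - p) (j - q) b)"
proof (rule mser_eqI)
  fix N
  show "mcf (cf x y i j (a * b)) N =
    mcf (\<Sum>p\<le>i. \<Sum>q\<le>j. cf x y p q a * cf x y (i - p) (j - q) b) N"
  proof (cases "x \<in># N \<or> y \<in># N")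
    case True
    have "mcf (cf x y p q a) A * mcf (cf x y p' q' b) (N - A) = 0" if "A \<subseteq># N" for A p q p' q'
    proof -
      have "x \<in># A \<or> x \<in># N - A \<or> y \<in># A \<or> y \<in># N - A"
        using True that by (metis subset_mset.add_diff_inverse union_iff)
      then show ?thesis by (auto simp: mcf_cf)
    qed
    then have "mcf (cf x y p q a * cf x y p' q' b) N = 0" for p q p' q'
      unfolding mcf_mult by (intro sum.neutral) blast
    then show ?thesis using True by (simp add: mcf_cf)
  next
    case False
    have sub: "mcf (cf x y p q a) A = mcf a (A + replicate_mset p x + replicate_mset q y)"
      if "A \<subseteq># N" for A p q a
      using False that by (auto simp: mcf_cf dest: mset_subset_eqD)
    have diff: "N + replicate_mset i x + replicate_mset j y - (A + replicate_mset p x + replicate_mset q y) =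
        N - A + replicate_mset (i - p) x + replicate_mset (j - q) y"
      if "A \<subseteq># N" "p \<le> i" "q \<le> j" for A p q
      using that assms by (auto simp: multiset_eq_iff subseteq_mset_def)
    have "mcf (cf x y i j (a * b)) N =
      (\<Sum>A | A \<subseteq># N + replicate_mset i x + replicate_mset j y.
        mcf a A * mcf b (N + replicate_mset i x + replicate_mset j y - A))"
      using False by (simp add: mcf_cf mcf_mult)
    also have "\<dots> = (\<Sum>q\<le>j. \<Sum>p\<le>i. \<Sum>A | A \<subseteq># N.
        mcf a (A + replicate_mset p x + replicate_mset q y) *
        mcf b (N + replicate_mset i x + replicate_mset j y - (A + replicate_mset p x + replicate_mset q y)))"
      using False assms by (simp add: sum_submsets_replicate)
    also have "\<dots> = (\<Sum>q\<le>j. \<Sum>p\<le>i. mcf (cf x y p q a * cf x y (i - p) (j - q) b) N)"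
      unfolding mcf_mult by (intro sum.cong refl) (auto simp: sub diff)
    also have "\<dots> = (\<Sum>p\<le>i. \<Sum>q\<le>j. mcf (cf x y p q a * cf x y (i - p) (j - q) b) N)"
      by (rule sum.swap)
    finally show ?thesis by simp
  qed
qed

text \<open>Index set for the coefficient of x^i y^j in an n-th power: the pairs of exponents
  contributed by the n factors.\<close>

definition cells :: "nat \<Rightarrow> nat \<Rightarrow> nat \<Rightarrow> (nat \<times> nat) list set" where
  "cells n i j = {ps. length ps = n \<and> sum_list (map fst ps) = i \<and> sum_list (map snd ps) = j}"

lemma finite_cells [simp]: "finite (cells n i j)"
proof (rule finite_subset)
  show "cells n i j \<subseteq> {ps. set ps \<subseteq> {..i} \<times> {..j} \<and> length ps = n}"
    using member_le_sum_list[of _ "map fst _"] member_le_sum_list[of _ "map snd _"]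
    by (fastforce simp: cells_def)
qed (simp add: finite_lists_length_eq)

lemma cells_0: "cells 0 i j = (if i = 0 \<and> j = 0 then {[]} else {})"
  by (auto simp: cells_def)

lemma sum_cells_Suc:
  "(\<Sum>ps\<in>cells (Suc n) i j. g ps) = (\<Sum>p\<le>i. \<Sum>q\<le>j. \<Sum>ps\<in>cells n (i - p) (j - q). g ((p, q) # ps))"
proof -
  have "(\<Sum>ps\<in>cells (Suc n) i j. g ps) =
    (\<Sum>((p, q), ps)\<in>(SIGMA pq:{..i} \<times> {..j}. cells n (i - fst pq) (j - snd pq)). g ((p, q) # ps))"
    by (rule sum.reindex_bij_witness[of _ "\<lambda>(pq, ps). pq # ps" "\<lambda>ps. (hd ps, tl ps)"])
       (auto simp: cells_def length_Suc_conv)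
  also have "\<dots> = (\<Sum>pq\<in>{..i} \<times> {..j}. \<Sum>ps\<in>cells n (i - fst pq) (j - snd pq). g ((fst pq, snd pq) # ps))"
    by (subst sum.Sigma) (auto intro: sum.cong)
  finally show ?thesis by (simp add: sum.cartesian_product case_prod_beta)
qed

lemma cf_power:
  assumes "x \<noteq> y"
  shows "cf x y i j (a ^ n) = (\<Sum>ps\<in>cells n i j. \<Prod>(p, q)\<leftarrow>ps. cf x y p q a)"
proof (induction n arbitrary: i j)
  case 0
  then show ?case by (simp add: cells_0 cf_1)
next
  case (Suc n)
  then show ?case by (simp add: cf_mult[OF assms] sum_cells_Suc sum_distrib_left)
qed

lemma prod_list_eq_0: "(0 :: 'a :: comm_ring_1) \<in> set xs \<Longrightarrow> prod_list xs = 0"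
  by (induction xs) auto

text \<open>Among n factors of total x-degree i < n one has x-degree 0. This bounds the exponents in
  \<open>cf_log\<close> and \<open>cf_mexp\<close> by i, whatever the remaining monomial is, so that
  both become identities of series.\<close>

lemma cells_prod_eq_0:
  fixes c :: "nat \<Rightarrow> nat \<Rightarrow> 'a :: comm_ring_1"
  assumes "ps \<in> cells n i j" "i < n" "\<And>q. c 0 q = 0"
  shows "(\<Prod>(p, q)\<leftarrow>ps. c p q) = 0"
proof -
  have "\<exists>q. (0, q) \<in> set ps"
  proof (rule ccontr)
    assume *: "\<nexists>q. (0, q) \<in> set ps"
    have "length ps \<le> sum_list (map fst ps)"
      using * by (induction ps) force+
    then show False using assms by (simp add: cells_def)
  qed
  then show ?thesis using assms(3) by (intro prod_list_eq_0) force
qed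

lemma cf_log:
  assumes "x \<noteq> y" "mcf W {#} = 0" "\<And>q. cf x y 0 q (1 - mexp W) = 0"
  shows "cf x y i j W =
    - (\<Sum>k=1..i. (1 / real k) *\<^sub>R (\<Sum>ps\<in>cells k i j. \<Prod>(p, q)\<leftarrow>ps. cf x y p q (1 - mexp W)))"
proof (rule mser_eqI)
  fix N
  define X where "X = 1 - mexp W"
  define M where "M = N + replicate_mset i x + replicate_mset j y"
  have z: "cf x y i j (X ^ k) = 0" if "i < k" for k
    unfolding cf_power[OF assms(1)]
    by (intro sum.neutral ballI cells_prod_eq_0[of _ k i j]) (use that assms(3) in \<open>auto simp: X_def\<close>)
  show "mcf (cf x y i j W) N =
    mcf (- (\<Sum>k=1..i. (1 / real k) *\<^sub>R (\<Sum>ps\<in>cells k i j. \<Prod>(p, q)\<leftarrow>ps. cf x y p q (1 - mexp W)))) N"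
  proof (cases "x \<in># N \<or> y \<in># N")
    case True
    then have "mcf (cf x y i j b) N = 0" for b by (simp add: mcf_cf)
    then show ?thesis
      by (simp add: cf_power[OF assms(1), symmetric] del: mcf_sum cf_linear)
         (simp add: mcf_sum del: cf_linear)
  next
    case False
    have "mcf (cf x y i j W) N = mcf W M" using False by (simp add: mcf_cf M_def)
    also have "\<dots> = - (\<Sum>k=1..size M. mcf (X ^ k) M / of_nat k)"
      unfolding X_def by (rule mcf_log[OF assms(2)]) simp
    also have "\<dots> = - (\<Sum>k=1..size M. mcf (cf x y i j (X ^ k)) N / of_nat k)"
      using False by (simp add: mcf_cf M_def)
    also have "(\<Sum>k=1..size M. mcf (cf x y i j (X ^ k)) N / of_nat k) =
        (\<Sum>k=1..i. mcf (cf x y i j (X ^ k)) N / of_nat k)"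
      by (rule sum.mono_neutral_right) (auto simp: M_def z)
    finally show ?thesis
      unfolding cf_power[OF assms(1)] X_def
      by (simp add: scaleR_conv_of_real[where 'a=complex] del: cf_linear)
  qed
qed

lemma cf_mexp:
  assumes "x \<noteq> y" "mcf a {#} = 0" "\<And>q. cf x y 0 q a = 0"
  shows "cf x y i j (mexp a) = (\<Sum>n\<le>i. (1 / fact n) *\<^sub>R (\<Sum>ps\<in>cells n i j. \<Prod>(p, q)\<leftarrow>ps. cf x y p q a))"
proof (rule mser_eqI)
  fix N
  define M where "M = N + replicate_mset i x + replicate_mset j y"
  have z: "cf x y i j (a ^ n) = 0" if "i < n" for n
    unfolding cf_power[OF assms(1)]
    by (intro sum.neutral ballI cells_prod_eq_0[of _ n i j]) (use that assms(3) in auto)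
  show "mcf (cf x y i j (mexp a)) N =
    mcf (\<Sum>n\<le>i. (1 / fact n) *\<^sub>R (\<Sum>ps\<in>cells n i j. \<Prod>(p, q)\<leftarrow>ps. cf x y p q a)) N"
  proof (cases "x \<in># N \<or> y \<in># N")
    case True
    then have "mcf (cf x y i j b) N = 0" for b by (simp add: mcf_cf)
    then show ?thesis
      by (simp add: cf_power[OF assms(1), symmetric] del: mcf_sum cf_linear)
         (simp add: mcf_sum del: cf_linear)
  next
    case False
    have "mcf (cf x y i j (mexp a)) N = mcf (mexp a) M" using False by (simp add: mcf_cf M_def)
    also have "\<dots> = (\<Sum>n\<le>size M. mcf (cf x y i j (a ^ n)) N / fact n)"
      using False by (simp add: mcf_cf M_def mcf_mexp[OF assms(2) order_refl])
    also have "\<dots> = (\<Sum>n\<le>i. mcf (cf x y i j (a ^ n)) N / fact n)"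
      by (rule sum.mono_neutral_right) (auto simp: M_def z)
    finally show ?thesis
      unfolding cf_power[OF assms(1)]
      by (simp add: scaleR_conv_of_real[where 'a=complex] del: cf_linear)
  qed
qed

subsection \<open>The first equation\<close>

definition comps :: "nat \<Rightarrow> nat list set" where
  "comps n = {ps. 0 \<notin> set ps \<and> sum_list ps = n}"

lemma length_le_sum_list: "(0::nat) \<notin> set ps \<Longrightarrow> length ps \<le> sum_list ps"
  by (induction ps) force+

lemma finite_comps [simp]: "finite (comps n)"
proof (rule finite_subset)
  show "comps n \<subseteq> {ps. set ps \<subseteq> {..n} \<and> length ps \<le> n}"
    by (auto simp: comps_def length_le_sum_list member_le_sum_list)
qed (simp add: finite_lists_length_le)

lemma comps_0: "comps 0 = {[]}"
  by (auto simp: comps_def) (metis list.set_intros(1) neq_Nil_conv)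

lemma prod_list_scaleR:
  fixes g :: "'b \<Rightarrow> 'a :: {comm_ring_1, real_algebra_1}"
  shows "(\<Prod>x\<leftarrow>xs. c x *\<^sub>R g x) = (\<Prod>x\<leftarrow>xs. c x) *\<^sub>R (\<Prod>x\<leftarrow>xs. g x)"
  by (induction xs) auto

text \<open>The coefficient of x^n in the exponential of - sum_p u_p x^p, which is the h_n of the
  overview when u_p = (1/p) d0 D_p F.\<close>

definition hcoef :: "(nat \<Rightarrow> 'a :: {comm_ring_1, real_algebra_1}) \<Rightarrow> nat \<Rightarrow> 'a" where
  "hcoef u n = (\<Sum>ps\<in>comps n. ((-1) ^ length ps / fact (length ps)) *\<^sub>R (\<Prod>p\<leftarrow>ps. u p))"

lemma cf_mexp_single:
  assumes "x \<noteq> y" and "mcf a {#} = 0"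
    and a: "\<And>i j. cf x y i j a = (if i \<ge> 1 \<and> j = 0 then - u i else 0)"
  shows "cf x y i j (mexp a) = (if j = 0 then hcoef u i else 0)"
proof (cases "j = 0")
  case False
  have "(\<Prod>(p, q)\<leftarrow>ps. cf x y p q a) = 0" if ps: "ps \<in> cells n i j" for ps n
  proof -
    have "\<exists>p q. (p, q) \<in> set ps \<and> q \<noteq> 0"
    proof (rule ccontr)
      assume "\<not> ?thesis"
      then have "\<forall>q\<in>set (map snd ps). q = 0" by auto
      then have "sum_list (map snd ps) = 0" by (simp only: sum_list_eq_0_iff)
      then show False using ps False by (simp add: cells_def del: sum_list_eq_0_iff)
    qed
    then show ?thesis by (intro prod_list_eq_0) (force simp: a)
  qed
  then show ?thesis using False a by (subst cf_mexp[OF assms(1,2)]) auto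
next
  case True
  define C where "C n = {ps \<in> comps i. length ps = n}" for n
  have "(\<Sum>ps\<in>cells n i 0. \<Prod>(p, q)\<leftarrow>ps. cf x y p q a) = (\<Sum>ps\<in>C n. (-1) ^ n *\<^sub>R (\<Prod>p\<leftarrow>ps. u p))" for n
  proof -
    have "(\<Sum>ps\<in>cells n i 0. \<Prod>(p, q)\<leftarrow>ps. cf x y p q a) =
       (\<Sum>ps\<in>(map (\<lambda>p. (p, 0)) ` C n). \<Prod>(p, q)\<leftarrow>ps. cf x y p q a)"
    proof (rule sum.mono_neutral_right)
      show "map (\<lambda>p. (p, 0)) ` C n \<subseteq> cells n i 0"
        by (auto simp: C_def cells_def comps_def comp_def)
      show "\<forall>ps\<in>cells n i 0 - map (\<lambda>p. (p, 0)) ` C n. (\<Prod>(p, q)\<leftarrow>ps. cf x y p q a) = 0"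
      proof
        fix ps assume ps: "ps \<in> cells n i 0 - map (\<lambda>p. (p, 0)) ` C n"
        then have snd0: "\<forall>q\<in>set (map snd ps). q = 0"
          using sum_list_eq_0_iff[of "map snd ps"] by (simp add: cells_def)
        then have eq: "ps = map (\<lambda>p. (p, 0)) (map fst ps)"
          by (induction ps) auto
        have "(0, 0) \<in> set ps"
        proof (rule ccontr)
          assume "(0, 0) \<notin> set ps"
          then have "0 \<notin> set (map fst ps)" using snd0 by force
          then have "map fst ps \<in> C n" using ps by (auto simp: C_def comps_def cells_def)
          then show False using ps eq by blast
        qed
        then show "(\<Prod>(p, q)\<leftarrow>ps. cf x y p q a) = 0" by (intro prod_list_eq_0) (force simp: a)
      qed
    qed simp
    also have "\<dots> = (\<Sum>ps\<in>C n. \<Prod>p\<leftarrow>ps. cf x y p 0 a)"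
      by (subst sum.reindex) (auto simp: inj_on_def comp_def)
    also have "\<dots> = (\<Sum>ps\<in>C n. \<Prod>p\<leftarrow>ps. (-1) *\<^sub>R u p)"
    proof (intro sum.cong refl arg_cong[of _ _ prod_list] map_cong)
      fix ps p assume "ps \<in> C n" "p \<in> set ps"
      then have "p \<noteq> 0" by (auto simp: C_def comps_def intro: gr0I)
      then show "cf x y p 0 a = (-1) *\<^sub>R u p" by (simp add: a)
    qed
    also have "\<dots> = (\<Sum>ps\<in>C n. (-1) ^ n *\<^sub>R (\<Prod>p\<leftarrow>ps. u p))"
      unfolding prod_list_scaleR by (rule sum.cong) (auto simp: C_def map_replicate_const)
    finally show ?thesis .
  qed
  then have "cf x y i 0 (mexp a) = (\<Sum>n\<le>i. \<Sum>ps\<in>C n. ((-1) ^ length ps / fact (length ps)) *\<^sub>R (\<Prod>p\<leftarrow>ps. u p))"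
    by (subst cf_mexp[OF assms(1,2)]) (auto simp: a scaleR_sum_right C_def intro!: sum.cong)
  also have "\<dots> = hcoef u i"
    unfolding hcoef_def C_def
  proof (rule sum.group)
    show "length ` comps i \<subseteq> {..i}" by (auto simp: comps_def length_le_sum_list)
  qed simp_all
  finally show ?thesis using True by simp
qed

section \<open>The constants \<open>T2\<close> as coefficients of a logarithm\<close>

lemma prod_list_sum_listset:
  fixes g :: "'b \<Rightarrow> 'a :: comm_ring_1"
  assumes "\<And>r. finite (S r)"
  shows "(\<Prod>r\<leftarrow>rs. \<Sum>x\<in>S r. g x) = (\<Sum>xs\<in>listset (map S rs). \<Prod>x\<leftarrow>xs. g x)"
proof (induction rs)
  case (Cons r rs)
  have "listset (map S (r # rs)) = (\<lambda>(x, xs). x # xs) ` (S r \<times> listset (map S rs))"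
    by (auto simp: set_Cons_def)
  then have "(\<Sum>xs\<in>listset (map S (r # rs)). \<Prod>x\<leftarrow>xs. g x) =
      (\<Sum>(x, xs)\<in>S r \<times> listset (map S rs). g x * (\<Prod>x\<leftarrow>xs. g x))"
    by (simp only:) (subst sum.reindex, auto simp: inj_on_def case_prod_beta)
  then show ?case
    using Cons by (simp add: sum_product sum.cartesian_product)
qed simp

lemma listset_map_comps:
  "listset (map comps rs) = {pss. 0 \<notin> set (concat pss) \<and> map sum_list pss = rs}"
  by (induction rs) (auto simp: set_Cons_def comps_def Cons_eq_map_conv map_eq_Cons_conv)

text \<open>The pairs of sequences that \<open>P\<close> counts, zipped into one list, before the
  sums r_a = i_a + j_a are prescribed.\<close>

definition pcells :: "nat \<Rightarrow> nat \<Rightarrow> (nat \<times> nat) list set" where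
  "pcells i j = {ps. (\<forall>(p, q)\<in>set ps. 0 < p \<and> 0 < q) \<and>
     sum_list (map fst ps) = i \<and> sum_list (map snd ps) = j}"

lemma card_pcells: "card {ps \<in> pcells i j. map (\<lambda>(p, q). p + q) ps = rs} = P i j rs"
  unfolding P_def
proof (rule bij_betw_same_card[of "\<lambda>ps. (map fst ps, map snd ps)"],
    rule bij_betw_byWitness[of _ "\<lambda>(ks, js). zip ks js"], goal_cases)
  case 1 show ?case by (auto simp: zip_map_fst_snd)
next
  case 2 show ?case by (auto simp: map_fst_zip map_snd_zip)
next
  case 3
  show ?case by (force simp: pcells_def case_prod_beta)
next
  case 4
  show ?case
  proof (clarsimp simp: pcells_def map_fst_zip map_snd_zip, intro conjI)
    fix ks js
    assume *: "length ks = length rs" "length js = length rs" "0 \<notin> set ks" "0 \<notin> set js"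
      "\<forall>a<length rs. rs ! a = ks ! a + js ! a"
    show "\<forall>x\<in>set (zip ks js). case x of (p, q) \<Rightarrow> 0 < p \<and> 0 < q"
      using *(3,4) by (metis (mono_tags, lifting) case_prodI2 gr0I set_zip_leftD set_zip_rightD)
    show "map (\<lambda>(p, q). p + q) (zip ks js) = rs"
      using * by (auto intro!: nth_equalityI)
  qed
qed

lemma concat_chunks:
  "sum_list ns = length ps \<Longrightarrow> concat (chunks ns ps) = ps"
  "sum_list ns = length ps \<Longrightarrow> map length (chunks ns ps) = ns"
  by (induction ns arbitrary: ps) auto

lemma chunks_concat: "chunks (map length pss) (concat pss) = pss"
  by (induction pss) auto

lemma sum_list_map_sum_list: "sum_list (map sum_list xss) = sum_list (concat xss)"
  by (induction xss) auto

lemma of_rat_fact: "(of_rat (fact n) :: 'a :: field_char_0) = fact n"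
  by (metis of_nat_fact of_rat_of_nat_eq)

text \<open>The origin of \<open>T2\<close>. In the k-th power of X the terms at (i, j) group by r_a
  = i_a + j_a into \<open>P i j rs\<close> times the product of the h_(r_a). Each h_(r_a) is a sum
  over compositions of r_a; their concatenation is the sequence ps, cut into k blocks of lengths
  n_a. The factors 1/n_a! and the signs (-1)^(n_a) come from the exponential, 1/k and one more sign
  from the logarithm.\<close>

lemma log_hcoef:
  fixes u :: "nat \<Rightarrow> 'a :: {comm_ring_1, real_algebra_1}"
  assumes "i \<ge> 1"
  shows "- (\<Sum>k=1..i. (1 / real k) *\<^sub>R (\<Sum>ps\<in>cells k i j. \<Prod>(p, q)\<leftarrow>ps.
      if p \<ge> 1 \<and> q \<ge> 1 then hcoef u (p + q) else 0)) =
    (\<Sum>ps\<in>comps (i + j). (of_rat (T2 i j ps) :: real) *\<^sub>R (\<Prod>p\<leftarrow>ps. u p))"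
proof -
  define H where "H rs = (1 / real (length rs)) *\<^sub>R (\<Prod>r\<leftarrow>rs. hcoef u r)" for rs
  define g where "g ps = ((-1) ^ length ps / fact (length ps)) *\<^sub>R (\<Prod>p\<leftarrow>ps. u p)" for ps
  define add where "add = map (\<lambda>(p::nat, q). p + q)"
  define CC where "CC = {pss. [] \<notin> set pss \<and> 0 \<notin> set (concat pss) \<and> sum_list (concat pss) = i + j}"
  define NS where "NS ps = {ns. ns \<noteq> [] \<and> 0 \<notin> set ns \<and> sum_list ns = length (ps :: nat list)}" for ps
  have fin_NS: "finite (NS ps)" for ps
    by (rule finite_subset[OF _ finite_comps[of "length ps"]]) (auto simp: NS_def comps_def)
  have len: "length ps \<in> {1..i}" if "ps \<in> pcells i j" for ps
  proof -
    have "0 \<notin> set (map fst ps)" using that by (force simp: pcells_def)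
    then have "length (map fst ps) \<le> sum_list (map fst ps)" by (rule length_le_sum_list)
    moreover have "ps \<noteq> []" using that assms by (auto simp: pcells_def)
    ultimately show ?thesis using that by (cases ps) (auto simp: pcells_def)
  qed
  have "pcells i j \<subseteq> (\<Union>k\<in>{1..i}. cells k i j)"
    using len by (auto simp: cells_def pcells_def)
  then have fin_pc: "finite (pcells i j)"
    by (rule finite_subset) simp
  have 1: "(\<Sum>ps\<in>cells k i j. \<Prod>(p, q)\<leftarrow>ps. if p \<ge> 1 \<and> q \<ge> 1 then hcoef u (p + q) else 0) =
      (\<Sum>ps\<in>{ps \<in> pcells i j. length ps = k}. \<Prod>r\<leftarrow>add ps. hcoef u r)" for k
  proof -
    have "(\<Sum>ps\<in>cells k i j. \<Prod>(p, q)\<leftarrow>ps. if p \<ge> 1 \<and> q \<ge> 1 then hcoef u (p + q) else 0) =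
      (\<Sum>ps\<in>{ps \<in> pcells i j. length ps = k}. \<Prod>(p, q)\<leftarrow>ps. if p \<ge> 1 \<and> q \<ge> 1 then hcoef u (p + q) else 0)"
    proof (rule sum.mono_neutral_right)
      show "\<forall>ps\<in>cells k i j - {ps \<in> pcells i j. length ps = k}.
          (\<Prod>(p, q)\<leftarrow>ps. if p \<ge> 1 \<and> q \<ge> 1 then hcoef u (p + q) else 0) = 0"
      proof
        fix ps assume "ps \<in> cells k i j - {ps \<in> pcells i j. length ps = k}"
        then obtain p q where "(p, q) \<in> set ps" "\<not> (p \<ge> 1 \<and> q \<ge> 1)"
          by (fastforce simp: cells_def pcells_def)
        then have "0 \<in> set (map (\<lambda>(p, q). if p \<ge> 1 \<and> q \<ge> 1 then hcoef u (p + q) else 0) ps)"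
          unfolding set_map by (intro image_eqI[of _ _ "(p, q)"]) auto
        then show "(\<Prod>(p, q)\<leftarrow>ps. if p \<ge> 1 \<and> q \<ge> 1 then hcoef u (p + q) else 0) = 0"
          by (rule prod_list_eq_0)
      qed
      show "{ps \<in> pcells i j. length ps = k} \<subseteq> cells k i j"
        by (auto simp: cells_def pcells_def)
    qed simp
    also have "\<dots> = (\<Sum>ps\<in>{ps \<in> pcells i j. length ps = k}. \<Prod>r\<leftarrow>add ps. hcoef u r)"
      by (intro sum.cong refl arg_cong[of _ _ prod_list])
         (force simp: add_def pcells_def)
    finally show ?thesis .
  qed
  have "(\<Sum>k=1..i. (1 / real k) *\<^sub>R (\<Sum>ps\<in>cells k i j. \<Prod>(p, q)\<leftarrow>ps.
      if p \<ge> 1 \<and> q \<ge> 1 then hcoef u (p + q) else 0)) =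
      (\<Sum>k=1..i. \<Sum>ps\<in>{ps \<in> pcells i j. length ps = k}. H (add ps))"
    unfolding 1 scaleR_sum_right by (intro sum.cong refl) (auto simp: H_def add_def)
  also have "\<dots> = (\<Sum>ps\<in>pcells i j. H (add ps))"
    by (rule sum.group) (use len fin_pc in auto)
  also have "\<dots> = (\<Sum>rs\<in>comps (i + j). \<Sum>ps\<in>{ps \<in> pcells i j. add ps = rs}. H (add ps))"
  proof (rule sum.group[symmetric])
    show "add ` pcells i j \<subseteq> comps (i + j)"
    proof
      fix rs assume "rs \<in> add ` pcells i j"
      then obtain ps where ps: "ps \<in> pcells i j" "rs = add ps" by blast
      have "sum_list (add ps) = sum_list (map fst ps) + sum_list (map snd ps)"
        by (induction ps) (auto simp: add_def)
      then show "rs \<in> comps (i + j)"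
        using ps by (force simp: comps_def pcells_def add_def)
    qed
  qed (simp_all add: fin_pc)
  also have "\<dots> = (\<Sum>rs\<in>comps (i + j). real (P i j rs) *\<^sub>R H rs)"
    by (intro sum.cong refl)
       (simp add: card_pcells[symmetric] add_def[symmetric] sum_constant_scaleR
         del: sum_constant)
  also have "\<dots> = (\<Sum>rs\<in>comps (i + j). \<Sum>pss\<in>listset (map comps rs).
      (real (P i j rs) / real (length rs)) *\<^sub>R (\<Prod>ps\<leftarrow>pss. g ps))"
    unfolding H_def hcoef_def g_def[symmetric]
    by (simp add: prod_list_sum_listset scaleR_sum_right)
  also have "\<dots> = (\<Sum>rs\<in>comps (i + j). \<Sum>pss\<in>{pss \<in> CC. map sum_list pss = rs}.
      (real (P i j (map sum_list pss)) / real (length pss)) *\<^sub>R (\<Prod>ps\<leftarrow>pss. g ps))"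
  proof (intro sum.cong refl)
    fix rs assume rs: "rs \<in> comps (i + j)"
    show "listset (map comps rs) = {pss \<in> CC. map sum_list pss = rs}"
      using rs by (auto simp: listset_map_comps CC_def comps_def sum_list_map_sum_list) force
  qed (auto simp: listset_map_comps)
  also have "\<dots> = (\<Sum>pss\<in>CC. (real (P i j (map sum_list pss)) / real (length pss)) *\<^sub>R (\<Prod>ps\<leftarrow>pss. g ps))"
  proof (rule sum.group)
    have "map sum_list pss \<in> comps (i + j)" if "pss \<in> CC" for pss
    proof -
      have "sum_list ps \<noteq> 0" if "ps \<in> set pss" for ps
      proof
        assume "sum_list ps = 0"
        then have "\<forall>p\<in>set ps. p = 0" by (simp add: sum_list_eq_0_iff)
        moreover have "0 \<notin> set ps" "ps \<noteq> []" using that \<open>pss \<in> CC\<close> by (auto simp: CC_def)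
        ultimately show False by (cases ps) auto
      qed
      then show ?thesis using that by (force simp: comps_def CC_def sum_list_map_sum_list)
    qed
    then show *: "map sum_list ` CC \<subseteq> comps (i + j)" by blast
    show "finite CC"
    proof (rule finite_subset)
      show "CC \<subseteq> (\<Union>ps\<in>comps (i + j). \<Union>ns\<in>comps (length ps). {chunks ns ps})"
      proof
        fix pss assume "pss \<in> CC"
        then have "concat pss \<in> comps (i + j)" "map length pss \<in> comps (length (concat pss))"
          by (auto simp: CC_def comps_def length_concat)
        then show "pss \<in> (\<Union>ps\<in>comps (i + j). \<Union>ns\<in>comps (length ps). {chunks ns ps})"
          by (intro UN_I[of "concat pss"] UN_I[of "map length pss"]) (simp_all add: chunks_concat)
      qed
    qed auto
  qed simp
  also have "\<dots> = (\<Sum>pss\<in>CC. - ((of_rat ((-1) ^ (length (concat pss) + 1) /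
      (of_nat (length pss) * (\<Prod>n\<leftarrow>map length pss. fact n)) * of_nat (P i j (map sum_list pss))) :: real)
      *\<^sub>R (\<Prod>p\<leftarrow>concat pss. u p)))"
  proof (rule sum.cong, rule refl)
    fix pss
    have 1: "(\<Prod>ps\<leftarrow>pss. g ps) = ((-1) ^ length (concat pss) / (\<Prod>n\<leftarrow>map length pss. fact n)) *\<^sub>R
        (\<Prod>p\<leftarrow>concat pss. u p)"
      by (induction pss) (auto simp: g_def power_add mult.commute)
    have 2: "of_rat (\<Prod>n\<leftarrow>map length pss. fact n) = (\<Prod>n\<leftarrow>map length pss. fact n :: real)"
      by (induction pss) (auto simp: of_rat_mult of_rat_fact)
    show "(real (P i j (map sum_list pss)) / real (length pss)) *\<^sub>R (\<Prod>ps\<leftarrow>pss. g ps) =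
      - ((of_rat ((-1) ^ (length (concat pss) + 1) /
      (of_nat (length pss) * (\<Prod>n\<leftarrow>map length pss. fact n)) * of_nat (P i j (map sum_list pss))) :: real)
      *\<^sub>R (\<Prod>p\<leftarrow>concat pss. u p))"
      unfolding 1 by (simp add: of_rat_mult of_rat_divide of_rat_power of_rat_minus 2 del: map_map)
  qed
  \<comment> \<open>A list of non-empty blocks is the same as its concatenation together with the
    sequence of block lengths; \<open>chunks\<close> is the inverse.\<close>
  also have "\<dots> = - (\<Sum>(ps, ns)\<in>(SIGMA ps:comps (i + j). NS ps).
      (of_rat ((-1) ^ (length ps + 1) / (of_nat (length ns) * (\<Prod>n\<leftarrow>ns. fact n)) *
        of_nat (P i j (map sum_list (chunks ns ps)))) :: real) *\<^sub>R (\<Prod>p\<leftarrow>ps. u p))"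
    unfolding sum_negf
  proof (rule arg_cong[of _ _ uminus], rule sum.reindex_bij_witness[of _
        "\<lambda>(ps, ns). chunks ns ps" "\<lambda>pss. (concat pss, map length pss)"], goal_cases)
    case (1 pss)
    then show ?case by (simp add: chunks_concat)
  next
    case (2 pss)
    then show ?case using assms by (auto simp: CC_def comps_def NS_def length_concat)
  next
    case (3 b)
    then show ?case by (auto simp: NS_def concat_chunks)
  next
    case (4 b)
    then obtain ps ns where b: "b = (ps, ns)" "ps \<in> comps (i + j)" "ns \<in> NS ps" by auto
    have "0 \<notin> set (map length (chunks ns ps))" using b by (simp add: NS_def concat_chunks)
    then have "[] \<notin> set (chunks ns ps)" by force
    then show ?case using b by (simp add: CC_def NS_def comps_def concat_chunks del: set_concat)
  next
    case (5 pss)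
    then show ?case by (simp add: chunks_concat)
  qed
  also have "\<dots> = - (\<Sum>ps\<in>comps (i + j). (of_rat (T2 i j ps) :: real) *\<^sub>R (\<Prod>p\<leftarrow>ps. u p))"
    using fin_NS by (simp add: sum.Sigma[symmetric] T2_def NS_def[symmetric] of_rat_sum scaleR_sum_left)
  finally show ?thesis by simp
qed

text \<open>Among x and y, the series A involves only x and B only y. Comparing coefficients
  therefore gives a difference equation for those of \<open>mexp W\<close>, whose solution at i, j
  >= 1 is the negative of h_(i + j). This is the X of the overview, and \<open>log_hcoef\<close>
  applies to its logarithm.\<close>

lemma log_equation:
  fixes u :: "nat \<Rightarrow> 'v mser"
  assumes "x \<noteq> y" and W0: "mcf W {#} = 0" and A0: "mcf A {#} = 0" "mcf B {#} = 0"
    and A: "\<And>i j. cf x y i j A = (if i \<ge> 1 \<and> j = 0 then - u i else 0)"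
    and B: "\<And>i j. cf y x i j B = (if i \<ge> 1 \<and> j = 0 then - u i else 0)"
    and eq: "(mvar y - mvar x) * mexp W = mvar y * mexp A - mvar x * mexp B"
    and "i \<ge> 1" "j \<ge> 1"
  shows "cf x y i j W = (\<Sum>ps\<in>comps (i + j). (of_rat (T2 i j ps) :: real) *\<^sub>R (\<Prod>p\<leftarrow>ps. u p))"
proof -
  define E where "E i j = cf x y i j (mexp W)" for i j
  have h0: "hcoef u 0 = 1" by (simp add: hcoef_def comps_0)
  have EA: "cf x y i j (mexp A) = (if j = 0 then hcoef u i else 0)" for i j
    by (rule cf_mexp_single[OF assms(1) A0(1) A])
  have EB: "cf x y i j (mexp B) = (if i = 0 then hcoef u j else 0)" for i j
    using cf_mexp_single[OF assms(1)[symmetric] A0(2) B, of j i] by (simp add: cf_swap[of x y])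
  have rec: "(if j = 0 then 0 else E i (j - 1)) - (if i = 0 then 0 else E (i - 1) j) =
      (if j = 1 then hcoef u i else 0) - (if i = 1 then hcoef u j else 0)" for i j
  proof -
    have "cf x y i j ((mvar y - mvar x) * mexp W) = cf x y i j (mvar y * mexp A - mvar x * mexp B)"
      using eq by simp
    then show ?thesis
      unfolding left_diff_distrib cf_linear cf_mvar_mult[OF assms(1)] E_def EA EB
      by (cases i; cases j) auto
  qed
  have E0: "E 0 j = (if j = 0 then 1 else 0)" for j
    using rec[of "Suc j" 0] by (simp add: h0)
  have E1: "E i 0 = (if i = 0 then 1 else 0)" for i
    using rec[of 0 "Suc i"] by (simp add: h0)
  \<comment> \<open>Where both indices in \<open>rec\<close> exceed 1, it says that E is constant
    along lines of fixed i + j; the value on each line is read off at second index 1.\<close>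
  have E: "E (Suc i) (Suc j) = - hcoef u (Suc i + Suc j)" for i j
  proof (induction j arbitrary: i)
    case 0
    have "- E (Suc i) (Suc 0) = hcoef u (Suc (Suc i))"
      using rec[of 1 "Suc (Suc i)"] E1[of "Suc (Suc i)"] by simp
    then show ?case by (metis add.commute minus_minus plus_1_eq_Suc add_Suc_right add_0_right)
  next
    case (Suc j)
    show ?case using rec[of "Suc (Suc j)" "Suc (Suc i)"] Suc.IH[of "Suc i"]
      by (simp add: algebra_simps)
  qed
  have X: "cf x y i j (1 - mexp W) = (if i \<ge> 1 \<and> j \<ge> 1 then hcoef u (i + j) else 0)" for i j
    using E0[of j] E1[of i] E[of "i - 1" "j - 1"]
    by (cases i; cases j) (auto simp: cf_1 E_def)
  have "cf x y i j W = - (\<Sum>k=1..i. (1 / real k) *\<^sub>R (\<Sum>ps\<in>cells k i j.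
      \<Prod>(p, q)\<leftarrow>ps. if p \<ge> 1 \<and> q \<ge> 1 then hcoef u (p + q) else 0))"
    unfolding X[symmetric] by (rule cf_log[OF assms(1) W0]) (simp add: X del: cf_linear)
  then show ?thesis
    using log_hcoef[OF \<open>i \<ge> 1\<close>] by simp
qed

subsection \<open>Derivations\<close>

text \<open>Pascal's rule in the form that the induction for the Leibniz formula needs. It serves
  the formal derivations here and \<open>dt0\<close> on functions later.\<close>

lemma sum_binomial_Suc:
  fixes a :: "nat \<Rightarrow> nat \<Rightarrow> 'a :: real_vector"
  shows "(\<Sum>k\<le>n. real (n choose k) *\<^sub>R (a (Suc k) (n - k) + a k (Suc (n - k)))) =
    (\<Sum>k\<le>Suc n. real (Suc n choose k) *\<^sub>R a k (Suc n - k))"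
proof -
  have "(\<Sum>k\<le>n. real (n choose k) *\<^sub>R (a (Suc k) (n - k) + a k (Suc (n - k)))) =
      (\<Sum>k\<le>n. real (n choose k) *\<^sub>R a (Suc k) (n - k)) + (\<Sum>k\<le>Suc n. real (n choose k) *\<^sub>R a k (Suc n - k))"
    by (simp add: sum.distrib scaleR_add_right Suc_diff_le)
  also have "(\<Sum>k\<le>Suc n. real (n choose k) *\<^sub>R a k (Suc n - k)) =
      a 0 (Suc n) + (\<Sum>k\<le>n. real (n choose Suc k) *\<^sub>R a (Suc k) (n - k))"
    by (subst sum.atMost_Suc_shift) simp
  also have "(\<Sum>k\<le>n. real (n choose k) *\<^sub>R a (Suc k) (n - k)) + \<dots> =
      a 0 (Suc n) + (\<Sum>k\<le>n. real (Suc n choose Suc k) *\<^sub>R a (Suc k) (n - k))"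
    by (simp add: scaleR_add_left sum.distrib algebra_simps)
  also have "\<dots> = (\<Sum>k\<le>Suc n. real (Suc n choose k) *\<^sub>R a k (Suc n - k))"
    by (subst sum.atMost_Suc_shift) simp
  finally show ?thesis .
qed

locale derivation =
  fixes d :: "'a :: {comm_ring_1, real_algebra_1} \<Rightarrow> 'a"
  assumes add [simp]: "d (x + y) = d x + d y"
    and scaleR [simp]: "d (r *\<^sub>R x) = r *\<^sub>R d x"
    and mult: "d (x * y) = d x * y + x * d y"
begin

lemma zero [simp]: "d 0 = 0"
  using scaleR[of 0 0] by simp

lemma one [simp]: "d 1 = 0"
  using mult[of 1 1] by simp

lemma sum [simp]: "d (sum f S) = (\<Sum>x\<in>S. d (f x))"
  by (induction S rule: infinite_finite_induct) auto

lemma prod_list: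
  "d (prod_list xs) = (\<Sum>a<length xs. prod_list (take a xs) * d (xs ! a) * prod_list (drop (Suc a) xs))"
proof (induction xs)
  case (Cons x xs)
  have "d (prod_list (x # xs)) = d x * prod_list xs + x * d (prod_list xs)"
    by (simp add: mult)
  also have "\<dots> = (\<Sum>a<Suc (length xs). prod_list (take a (x # xs)) * d ((x # xs) ! a) * prod_list (drop (Suc a) (x # xs)))"
    unfolding Cons.IH by (simp only: sum.lessThan_Suc_shift) (simp add: sum_distrib_left mult.assoc)
  finally show ?case by simp
qed simp

lemma pow_linear [simp]:
  "(d ^^ n) 0 = 0" "(d ^^ n) (x + y) = (d ^^ n) x + (d ^^ n) y" "(d ^^ n) (r *\<^sub>R x) = r *\<^sub>R (d ^^ n) x"
  "(d ^^ n) (sum f S) = (\<Sum>x\<in>S. (d ^^ n) (f x))"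
  by (induction n) auto

lemma pow_mult: "(d ^^ n) (x * y) = (\<Sum>k\<le>n. real (n choose k) *\<^sub>R ((d ^^ k) x * (d ^^ (n - k)) y))"
proof (induction n)
  case (Suc n)
  have "(d ^^ Suc n) (x * y) = (\<Sum>k\<le>n. real (n choose k) *\<^sub>R
      ((d ^^ Suc k) x * (d ^^ (n - k)) y + (d ^^ k) x * (d ^^ Suc (n - k)) y))"
    by (simp add: Suc.IH mult)
  then show ?case by (simp only: sum_binomial_Suc[of n "\<lambda>k m. (d ^^ k) x * (d ^^ m) y"])
qed simp

end

definition wcomps :: "nat \<Rightarrow> nat \<Rightarrow> nat list set" where
  "wcomps m l = {ls. length ls = m \<and> sum_list ls = l}"

lemma finite_wcomps [simp]: "finite (wcomps m l)"
  by (rule finite_subset[of _ "{ls. set ls \<subseteq> {..l} \<and> length ls = m}"])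
     (auto simp: wcomps_def member_le_sum_list finite_lists_length_eq)

lemma sum_wcomps_Suc:
  "(\<Sum>ls\<in>wcomps (Suc m) l. g ls) = (\<Sum>k\<le>l. \<Sum>ls\<in>wcomps m (l - k). g (k # ls))"
proof -
  have "(\<Sum>ls\<in>wcomps (Suc m) l. g ls) = (\<Sum>(k, ls)\<in>(SIGMA k:{..l}. wcomps m (l - k)). g (k # ls))"
    by (rule sum.reindex_bij_witness[of _ "\<lambda>(k, ks). k # ks" "\<lambda>ks. (hd ks, tl ks)"])
       (auto simp: wcomps_def length_Suc_conv)
  then show ?thesis by (simp add: sum.Sigma)
qed

lemma (in derivation) pow_prod_list:
  "(d ^^ l) (\<Prod>x\<leftarrow>xs. g x) = (\<Sum>ls\<in>wcomps (length xs) l.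
     (fact l / (\<Prod>n\<leftarrow>ls. fact n)) *\<^sub>R (\<Prod>(x, n)\<leftarrow>zip xs ls. (d ^^ n) (g x)))"
proof (induction xs arbitrary: l)
  case Nil
  have w: "wcomps 0 0 = {[]}" "wcomps 0 (Suc n) = {}" for n by (auto simp: wcomps_def)
  have "(d ^^ Suc n) 1 = 0" for n by (simp add: funpow_Suc_right del: funpow.simps)
  then show ?case by (cases l) (simp_all add: w del: funpow.simps)
next
  case (Cons x xs)
  have "(d ^^ l) (\<Prod>x\<leftarrow>x # xs. g x) = (\<Sum>k\<le>l. \<Sum>ls\<in>wcomps (length xs) (l - k).
     (real (l choose k) * (fact (l - k) / (\<Prod>n\<leftarrow>ls. fact n))) *\<^sub>R
     ((d ^^ k) (g x) * (\<Prod>(x, n)\<leftarrow>zip xs ls. (d ^^ n) (g x))))"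
    by (simp add: pow_mult Cons.IH sum_distrib_left scaleR_sum_right)
  also have "\<dots> = (\<Sum>k\<le>l. \<Sum>ls\<in>wcomps (length xs) (l - k).
     (fact l / (\<Prod>n\<leftarrow>k # ls. fact n)) *\<^sub>R (\<Prod>(x, n)\<leftarrow>zip (x # xs) (k # ls). (d ^^ n) (g x)))"
    by (intro sum.cong refl) (simp add: binomial_fact)
  finally show ?case by (simp add: sum_wcomps_Suc)
qed

subsection \<open>Iterated derivatives in the variables of one kind\<close>

text \<open>A column (s, l) stands for the factor (1/s) d0^l D_s F. The number e is the sum of l - 1
  over the columns: it is 0 in the formula for a second derivative of F, and every further D_k
  raises it by 1.\<close>

definition arr :: "nat \<Rightarrow> nat \<Rightarrow> (nat \<times> nat) list set" where
  "arr S e = {cols. (\<forall>(s, l)\<in>set cols. 0 < s \<and> 0 < l) \<and>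
     sum_list (map fst cols) = S \<and> sum_list (map snd cols) = length cols + e}"

text \<open>The blocks that replace a column (s, l) when D_k acts on it, with S = s + k, see
  \<open>D_v\<close>. The set agrees with \<open>arr\<close>; the condition on the lower row is
  written as in the recursion for \<open>Tk\<close>.\<close>

definition mids :: "nat \<Rightarrow> nat \<Rightarrow> (nat \<times> nat) list set" where
  "mids S l = {mid. (\<forall>(s, l)\<in>set mid. 0 < s \<and> 0 < l) \<and>
     sum_list (map fst mid) = S \<and> (\<Sum>c\<leftarrow>mid. snd c - 1) = l}"

lemma mids_eq: "(\<forall>(s, l)\<in>set mid. 0 < s \<and> 0 < l) \<Longrightarrow>
    sum_list (map snd mid) = length mid + (\<Sum>c\<leftarrow>mid. snd c - (1::nat))"
  by (induction mid) auto

lemma arr_eq_mids: "arr S e = mids S e"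
  by (auto simp: arr_def mids_def mids_eq[unfolded One_nat_def])

lemma finite_mids [simp]: "finite (mids S l)"
proof (rule finite_subset)
  show "mids S l \<subseteq> {mid. set mid \<subseteq> {..S} \<times> {..Suc l} \<and> length mid \<le> S}"
  proof
    fix mid assume mid: "mid \<in> mids S l"
    have "0 \<notin> set (map fst mid)" using mid by (force simp: mids_def)
    then have "length mid \<le> S"
      using length_le_sum_list[of "map fst mid"] mid by (simp add: mids_def)
    moreover have "fst c \<le> S" "snd c - 1 \<le> l" if "c \<in> set mid" for c
      using member_le_sum_list[of "fst c" "map fst mid"]
        member_le_sum_list[of "snd c - 1" "map (\<lambda>c. snd c - 1) mid"] that mid
      by (auto simp: mids_def)
    ultimately show "mid \<in> {mid. set mid \<subseteq> {..S} \<times> {..Suc l} \<and> length mid \<le> S}"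
      by fastforce
  qed
qed (simp add: finite_lists_length_le)

lemma finite_arr [simp]: "finite (arr S e)"
  by (simp add: arr_eq_mids)

text \<open>The part of the argument that concerns variables of one kind; it is used once for the
  t_k and once for the barred variables. The assumption \<open>D_D_F\<close> is the first,
  respectively second, equation of the hierarchy solved by the logarithm.\<close>

locale toda_half = d0: derivation d0
  for d0 :: "'a :: {comm_ring_1, real_algebra_1} \<Rightarrow> 'a" +
  fixes D :: "nat \<Rightarrow> 'a \<Rightarrow> 'a" and F :: 'a
  assumes D: "\<And>i. derivation (D i)"
    and d0_D: "\<And>i x. D i (d0 x) = d0 (D i x)"
    and D_D: "\<And>i j x. D i (D j x) = D j (D i x)"
    and D_D_F: "\<And>i j. i \<ge> 1 \<Longrightarrow> j \<ge> 1 \<Longrightarrow> D i (D j F) = (real i * real j) *\<^sub>R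
      (\<Sum>ps\<in>comps (i + j). (of_rat (T2 i j ps) :: real) *\<^sub>R (\<Prod>p\<leftarrow>ps. (1 / real p) *\<^sub>R d0 (D p F)))"
begin

sublocale D: derivation "D i" for i by (rule D)

definition v :: "nat \<Rightarrow> nat \<Rightarrow> 'a" where
  "v s l = (1 / real s) *\<^sub>R (d0 ^^ l) (D s F)"

definition V :: "(nat \<times> nat) list \<Rightarrow> 'a" where
  "V cols = (\<Prod>(s, l)\<leftarrow>cols. v s l)"

lemma V_append: "V (xs @ ys) = V xs * V ys"
  by (simp add: V_def)

lemma d0_pow_D: "D i ((d0 ^^ l) x) = (d0 ^^ l) (D i x)"
  by (induction l) (simp_all add: d0_D)

lemma d0_pow_v: "(d0 ^^ l) (v s m) = v s (l + m)"
  by (simp add: v_def funpow_add)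

text \<open>By commutation D_k maps \<open>v s l\<close> to (1/s) d0^l D_s D_k F. In the formula for
  D_s D_k F the l derivations d0 are distributed over the factors \<open>v p 1\<close>; a factor
  that receives n of them becomes \<open>v p (Suc n)\<close>, whence the factorials of
  \<open>snd c - 1\<close> in the multinomial coefficient.\<close>

lemma D_v:
  assumes "s \<ge> 1" "k \<ge> 1"
  shows "D k (v s l) = real k *\<^sub>R (\<Sum>mid\<in>mids (s + k) l.
    (of_rat (T2 s k (map fst mid)) * (fact l / (\<Prod>c\<leftarrow>mid. fact (snd c - 1))) :: real) *\<^sub>R V mid)"
proof -
  have "D k (v s l) = (1 / real s) *\<^sub>R (d0 ^^ l) (D s (D k F))"
    by (simp add: v_def d0_pow_D D_D)
  also have "\<dots> = real k *\<^sub>R (d0 ^^ l) (\<Sum>ps\<in>comps (s + k). (of_rat (T2 s k ps) :: real) *\<^sub>R (\<Prod>p\<leftarrow>ps. v p 1))"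
    using assms by (subst D_D_F) (simp_all add: v_def)
  also have "\<dots> = real k *\<^sub>R (\<Sum>ps\<in>comps (s + k). \<Sum>ls\<in>wcomps (length ps) l.
      (of_rat (T2 s k ps) * (fact l / (\<Prod>n\<leftarrow>ls. fact n)) :: real) *\<^sub>R (\<Prod>(p, n)\<leftarrow>zip ps ls. v p (Suc n)))"
    by (simp add: d0.pow_prod_list d0_pow_v scaleR_sum_right)
  also have "(\<Sum>ps\<in>comps (s + k). \<Sum>ls\<in>wcomps (length ps) l.
      (of_rat (T2 s k ps) * (fact l / (\<Prod>n\<leftarrow>ls. fact n)) :: real) *\<^sub>R (\<Prod>(p, n)\<leftarrow>zip ps ls. v p (Suc n))) =
     (\<Sum>(ps, ls)\<in>(SIGMA ps:comps (s + k). wcomps (length ps) l).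
      (of_rat (T2 s k ps) * (fact l / (\<Prod>n\<leftarrow>ls. fact n)) :: real) *\<^sub>R (\<Prod>(p, n)\<leftarrow>zip ps ls. v p (Suc n)))"
    by (simp add: sum.Sigma)
  also have "\<dots> = (\<Sum>mid\<in>mids (s + k) l.
    (of_rat (T2 s k (map fst mid)) * (fact l / (\<Prod>c\<leftarrow>mid. fact (snd c - 1))) :: real) *\<^sub>R V mid)"
  proof (rule sum.reindex_bij_witness[of _ "\<lambda>mid. (map fst mid, map (\<lambda>c. snd c - 1) mid)"
        "\<lambda>(ps, ls). zip ps (map Suc ls)"], goal_cases)
    case (1 b)
    then show ?case by (auto simp: wcomps_def map_snd_zip comp_def zip_map2 split_beta)
  next
    case (2 b)
    then obtain ps ls where b: "b = (ps, ls)" "ps \<in> comps (s + k)" "length ls = length ps" "sum_list ls = l"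
      by (auto simp: wcomps_def)
    have "0 < p" if "(p, n) \<in> set (zip ps ls)" for p n
      using set_zip_leftD[OF that] b(2) by (auto simp: comps_def intro: gr0I)
    then show ?case using b
      by (auto simp: mids_def comps_def zip_map2 comp_def split_beta)
  next
    case (3 mid)
    have "zip (map fst mid) (map Suc (map (\<lambda>c. snd c - 1) mid)) = mid"
      if "\<forall>(s, l)\<in>set mid. 0 < s \<and> 0 < l" for mid :: "(nat \<times> nat) list"
      using that by (induction mid) auto
    then show ?case using 3 by (simp add: mids_def)
  next
    case (4 mid)
    then show ?case by (force simp: mids_def comps_def wcomps_def)
  next
    case (5 b)
    then obtain ps ls where b: "b = (ps, ls)" "length ls = length ps"
      by (auto simp: wcomps_def)
    have "(\<Prod>c\<leftarrow>zip ps (map Suc ls). fact (snd c - 1)) = (\<Prod>n\<leftarrow>ls. fact n :: real)"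
      using b(2) by (induction ls ps rule: list_induct2) auto
    moreover have "V (zip ps (map Suc ls)) = (\<Prod>(p, n)\<leftarrow>zip ps ls. v p (Suc n))"
      using b(2) by (induction ls ps rule: list_induct2) (auto simp: V_def)
    ultimately show ?case using b by simp
  qed
  finally show ?thesis .
qed

lemma D_V: "D k (V cols) = (\<Sum>a<length cols.
    V (take a cols) * D k (v (fst (cols ! a)) (snd (cols ! a))) * V (drop (Suc a) cols))"
  unfolding V_def by (subst D.prod_list) (simp add: take_map drop_map split_beta)

end

text \<open>
  A term of the recursion for \<open>Tk\<close> is given by an array with an interval of columns (\<open>wide\<close>), a
  term of the derivative of a product by an array with one column and the block that the derivative
  puts in its place (\<open>narrow\<close>); \<open>expand\<close> and \<open>contract\<close> are inverse bijections between them.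
\<close>

definition expand :: "(nat \<times> nat) list \<times> nat \<times> (nat \<times> nat) list \<Rightarrow> (nat \<times> nat) list \<times> nat \<times> nat" where
  "expand = (\<lambda>(cols, a, mid). (take a cols @ mid @ drop (Suc a) cols, a, a + length mid - 1))"

definition contract :: "nat \<Rightarrow> (nat \<times> nat) list \<times> nat \<times> nat \<Rightarrow> (nat \<times> nat) list \<times> nat \<times> (nat \<times> nat) list" where
  "contract k = (\<lambda>(cols, a, b). let mid = take (b + 1 - a) (drop a cols) in
     (take a cols @ [(sum_list (map fst mid) - k, \<Sum>c\<leftarrow>mid. snd c - 1)] @ drop (b + 1) cols, a, mid))"

definition wide :: "nat \<Rightarrow> nat \<Rightarrow> nat \<Rightarrow> ((nat \<times> nat) list \<times> nat \<times> nat) set" where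
  "wide k S e = {(cols, a, b). cols \<in> arr (S + k) (Suc e) \<and> a \<le> b \<and> b < length cols \<and>
     k < sum_list (map fst (take (b + 1 - a) (drop a cols))) \<and>
     0 < (\<Sum>c\<leftarrow>take (b + 1 - a) (drop a cols). snd c - 1)}"

definition narrow :: "nat \<Rightarrow> nat \<Rightarrow> nat \<Rightarrow> ((nat \<times> nat) list \<times> nat \<times> (nat \<times> nat) list) set" where
  "narrow k S e = {(cols, a, mid). cols \<in> arr S e \<and> a < length cols \<and>
     mid \<in> mids (fst (cols ! a) + k) (snd (cols ! a))}"

lemma split3: "a \<le> b \<Longrightarrow> b < length xs \<Longrightarrow>
    xs = take a xs @ take (b + 1 - a) (drop a xs) @ drop (b + 1) xs"
  by (metis append_assoc append_take_drop_id le_add_diff_inverse le_SucI Suc_eq_plus1 take_add)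

lemma expand_contract:
  assumes "x \<in> narrow k S e"
  shows "expand x \<in> wide k S e" "contract k (expand x) = x"
proof -
  obtain cols a mid where x: "x = (cols, a, mid)" by (metis prod_cases3)
  have c: "cols \<in> arr S e" "a < length cols" and m0: "mid \<in> mids (fst (cols ! a) + k) (snd (cols ! a))"
    using assms by (auto simp: narrow_def x)
  define us ws where "us = take a cols" and "ws = drop (Suc a) cols"
  obtain s l where sl: "cols ! a = (s, l)" by fastforce
  have m: "mid \<in> mids (s + k) l" using m0 by (simp add: sl)
  have eq: "cols = us @ (s, l) # ws" using c by (simp add: us_def ws_def id_take_nth_drop sl[symmetric])
  have len: "length us = a" using c by (simp add: us_def)
  have pos: "0 < s" "0 < l" using c(1) by (auto simp: eq arr_def)
  have "mid \<noteq> []" using m pos by (auto simp: mids_def)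
  then have lm: "Suc (a + length mid - 1) = a + length mid" "a + length mid - 1 + 1 - a = length mid"
    by (cases mid; simp)+
  have mid: "take (length mid) (drop a (us @ mid @ ws)) = mid" using len by simp
  have ex: "expand x = (us @ mid @ ws, a, a + length mid - 1)"
    by (simp add: expand_def x us_def ws_def)
  \<comment> \<open>A column contributing l - 1 to the excess is replaced by a block contributing l,
    so the excess grows from e to \<open>Suc e\<close>.\<close>
  have "us @ mid @ ws \<in> arr (S + k) (Suc e)"
    using c(1) m by (auto simp: eq arr_def mids_def mids_eq)
  then show "expand x \<in> wide k S e"
    using m pos \<open>mid \<noteq> []\<close> len unfolding ex wide_def
    by (auto simp: lm mid mids_def simp del: One_nat_def) (auto simp: neq_Nil_conv)
  show "contract k (expand x) = x"
    using m len unfolding ex contract_def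
    by (simp add: Let_def lm mid mids_def x eq del: One_nat_def) (simp add: lm[simplified])
qed

lemma contract_expand:
  assumes "y \<in> wide k S e"
  shows "contract k y \<in> narrow k S e" "expand (contract k y) = y"
proof -
  obtain cols a b where y: "y = (cols, a, b)" by (metis prod_cases3)
  have c: "cols \<in> arr (S + k) (Suc e)" and ab: "a \<le> b" "b < length cols"
    using assms by (auto simp: wide_def y)
  define us mid ws where "us = take a cols" and "mid = take (b + 1 - a) (drop a cols)"
    and "ws = drop (b + 1) cols"
  define s l where "s = sum_list (map fst mid) - k" and "l = (\<Sum>c\<leftarrow>mid. snd c - 1)"
  have pos: "k < sum_list (map fst mid)" "0 < l"
    using assms by (auto simp: wide_def y mid_def l_def)
  have eq: "cols = us @ mid @ ws" unfolding us_def mid_def ws_def using ab by (rule split3)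
  have len: "length us = a" "length mid = b + 1 - a" using ab by (auto simp: us_def mid_def)
  have co: "contract k y = (us @ (s, l) # ws, a, mid)"
    by (simp add: contract_def y us_def mid_def ws_def s_def l_def Let_def)
  \<comment> \<open>The condition k < \<open>sum_list (map fst mid)\<close> from \<open>wide\<close>
    makes the truncated difference s exact.\<close>
  have m: "mid \<in> mids (s + k) l"
    using c pos by (auto simp: eq arr_def mids_def s_def l_def)
  have "us @ (s, l) # ws \<in> arr S e"
    using c pos mids_eq[of mid] by (auto simp: eq arr_def s_def l_def)
  then show "contract k y \<in> narrow k S e"
    using m len unfolding co narrow_def by (auto simp: nth_append)
  show "expand (contract k y) = y"
    using len ab unfolding co expand_def by (auto simp: y eq)
qed

lemma finite_narrow [simp]: "finite (narrow k S e)"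
proof -
  have "narrow k S e = (SIGMA cols:arr S e. SIGMA a:{..<length cols}. mids (fst (cols ! a) + k) (snd (cols ! a)))"
    by (auto simp: narrow_def)
  then show ?thesis by simp
qed

text \<open>The recursion expressed through \<open>contract\<close>, so that the passage between
  \<open>wide\<close> and \<open>narrow\<close> can be made term by term. Membership in
  \<open>arr\<close> excludes the arrays with a zero in the lower row, at which \<open>Tk\<close> is
  0 by convention.\<close>

lemma Tk_snoc:
  assumes "length ks \<ge> 2" "cols \<in> arr S e"
  shows "Tk (ks @ [k]) cols = (\<Sum>(a, b) | a \<le> b \<and> b < length cols \<and>
     k < sum_list (map fst (take (b + 1 - a) (drop a cols))) \<and>
     0 < (\<Sum>c\<leftarrow>take (b + 1 - a) (drop a cols). snd c - 1).
     case contract k (cols, a, b) of (cols', a, mid) \<Rightarrow>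
       Tk ks cols' * T2 (fst (cols' ! a)) k (map fst mid) *
       (fact (snd (cols' ! a)) / (\<Prod>c\<leftarrow>mid. fact (snd c - 1))))"
proof -
  have no0: "(\<exists>c\<in>set cols. snd c = 0) = False" using assms(2) by (fastforce simp: arr_def)
  then have "Tk (ks @ [k]) cols = (\<Sum>(a, b) \<in> {(a, b). a \<le> b \<and> b < length cols}.
          let mid = take (b + 1 - a) (drop a cols);
              s = sum_list (map fst mid) - k;
              l = (\<Sum>c\<leftarrow>mid. snd c - 1)
          in if sum_list (map fst mid) > k \<and> l > 0
             then fact l / (\<Prod>c\<leftarrow>mid. fact (snd c - 1))
                    * Tk ks (take a cols @ [(s, l)] @ drop (b + 1) cols)
                    * T2 s k (map fst mid)
             else 0)"
    using assms(1) by (subst Tk.simps, unfold butlast_snoc last_snoc no0) simp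
  also have "\<dots> = (\<Sum>(a, b) | a \<le> b \<and> b < length cols \<and>
     k < sum_list (map fst (take (b + 1 - a) (drop a cols))) \<and>
     0 < (\<Sum>c\<leftarrow>take (b + 1 - a) (drop a cols). snd c - 1).
     case contract k (cols, a, b) of (cols', a, mid) \<Rightarrow>
       Tk ks cols' * T2 (fst (cols' ! a)) k (map fst mid) *
       (fact (snd (cols' ! a)) / (\<Prod>c\<leftarrow>mid. fact (snd c - 1))))"
  proof (rule sum.mono_neutral_cong_right)
    show "finite {(a, b). a \<le> b \<and> b < length cols}"
      by (rule finite_subset[of _ "{..<length cols} \<times> {..<length cols}"]) auto
  qed (auto simp: Let_def contract_def nth_append min_def split: if_split_asm)
  finally show ?thesis .
qed

context toda_half begin

text \<open>The induction removes the last index, because \<open>fold\<close> applies it last and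
  the recursion for \<open>Tk\<close> splits it off. A further D_k acts by the Leibniz rule and
  \<open>D_v\<close>, and summing over \<open>wide\<close> instead of \<open>narrow\<close> turns
  the result into that recursion. The division by s inside \<open>v\<close> is what leaves just the
  product of the indices in front.\<close>

theorem iterated_D:
  assumes "length ks \<ge> 2" "0 \<notin> set ks"
  shows "fold D ks F = real (prod_list ks) *\<^sub>R
    (\<Sum>cols\<in>arr (sum_list ks) (length ks - 2). (of_rat (Tk ks cols) :: real) *\<^sub>R V cols)"
  using assms
proof (induction ks rule: rev_induct)
  case (snoc k ks)
  have k: "k \<ge> 1" using snoc.prems by auto
  show ?case
  proof (cases "length ks \<ge> 2")
    case False
    then obtain i where ks: "ks = [i]" using snoc.prems by (cases ks) (auto simp: Suc_le_eq)
    have i: "i \<ge> 1" using snoc.prems by (auto simp: ks)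
    have "(\<Sum>ps\<in>comps (i + k). (of_rat (T2 i k ps) :: real) *\<^sub>R (\<Prod>p\<leftarrow>ps. (1 / real p) *\<^sub>R d0 (D p F))) =
      (\<Sum>cols\<in>arr (i + k) 0. (of_rat (Tk [i, k] cols) :: real) *\<^sub>R V cols)"
    proof (rule sum.reindex_bij_witness[of _ "map fst" "map (\<lambda>p. (p, 1))"], goal_cases)
      case (1 ps)
      then show ?case by (simp add: comp_def)
    next
      case (2 ps)
      then show ?case by (force simp: comps_def arr_def comp_def sum_list_triv intro: gr0I)
    next
      case (3 cols)
      \<comment> \<open>Excess 0 forces the lower row to consist of ones, the case in which
        \<open>Tk\<close> of two indices is given by \<open>T2\<close>.\<close>
      have "snd c = 1" if "c \<in> set cols" for c
      proof -
        have "(\<Sum>c\<leftarrow>cols. snd c - 1) = 0" using 3 by (simp add: arr_eq_mids mids_def)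
        then have "snd c - 1 = 0" using that by auto
        moreover have "snd c > 0" using 3 that by (auto simp: arr_def)
        ultimately show ?thesis by simp
      qed
      then show ?case by (auto intro!: map_idI simp: prod_eq_iff)
    next
      case (4 cols)
      then show ?case by (force simp: comps_def arr_def)
    next
      case (5 ps)
      then show ?case by (subst Tk.simps) (simp add: comp_def V_def v_def)
    qed
    then show ?thesis using i k by (simp add: ks D_D[of k i] D_D_F)
  next
    case True
    define S e where "S = sum_list ks" and "e = length ks - 2"
    define G where "G = (\<lambda>(cols, a, mid). (of_rat (Tk ks cols) * (of_rat (T2 (fst (cols ! a)) k (map fst mid)) *
      (fact (snd (cols ! a)) / (\<Prod>c\<leftarrow>mid. fact (snd c - 1)))) :: real) *\<^sub>R V (take a cols @ mid @ drop (Suc a) cols))"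
    have len: "length (ks @ [k]) - 2 = Suc e" using True by (simp add: e_def)
    have IH: "fold D ks F = real (prod_list ks) *\<^sub>R (\<Sum>cols\<in>arr S e. (of_rat (Tk ks cols) :: real) *\<^sub>R V cols)"
      using snoc True by (simp add: S_def e_def)
    have DV: "D k (V cols) = real k *\<^sub>R (\<Sum>a<length cols. \<Sum>mid\<in>mids (fst (cols ! a) + k) (snd (cols ! a)).
        (of_rat (T2 (fst (cols ! a)) k (map fst mid)) * (fact (snd (cols ! a)) / (\<Prod>c\<leftarrow>mid. fact (snd c - 1))) :: real)
        *\<^sub>R V (take a cols @ mid @ drop (Suc a) cols))" if "cols \<in> arr S e" for cols
    proof -
      have "fst (cols ! a) \<ge> 1" if "a < length cols" for a
        using nth_mem[OF that] \<open>cols \<in> arr S e\<close> by (fastforce simp: arr_def)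
      then show ?thesis
        using k unfolding D_V scaleR_sum_right[of "real k"]
        by (intro sum.cong refl) (simp add: D_v V_append sum_distrib_left sum_distrib_right scaleR_sum_right mult.assoc)
    qed
    have "D k (fold D ks F) = real (prod_list (ks @ [k])) *\<^sub>R (\<Sum>cols\<in>arr S e. \<Sum>a<length cols.
        \<Sum>mid\<in>mids (fst (cols ! a) + k) (snd (cols ! a)). G (cols, a, mid))"
      unfolding IH by (simp add: DV scaleR_sum_right G_def mult_ac)
    also have "(\<Sum>cols\<in>arr S e. \<Sum>a<length cols. \<Sum>mid\<in>mids (fst (cols ! a) + k) (snd (cols ! a)). G (cols, a, mid)) =
        (\<Sum>x\<in>narrow k S e. G x)"
    proof -
      have "narrow k S e = (SIGMA cols:arr S e. SIGMA a:{..<length cols}. mids (fst (cols ! a) + k) (snd (cols ! a)))"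
        by (auto simp: narrow_def)
      then show ?thesis by (simp add: sum.Sigma split_beta)
    qed
    also have "\<dots> = (\<Sum>y\<in>wide k S e. G (contract k y))"
      by (rule sum.reindex_bij_witness[of _ "contract k" expand]) (simp_all add: expand_contract contract_expand)
    also have "\<dots> = (\<Sum>cols\<in>arr (S + k) (Suc e). \<Sum>ab | fst ab \<le> snd ab \<and> snd ab < length cols \<and>
       k < sum_list (map fst (take (snd ab + 1 - fst ab) (drop (fst ab) cols))) \<and>
       0 < (\<Sum>c\<leftarrow>take (snd ab + 1 - fst ab) (drop (fst ab) cols). snd c - 1).
       G (contract k (cols, ab)))"
    proof (subst sum.Sigma)
      show "\<forall>cols\<in>arr (S + k) (Suc e). finite {ab. fst ab \<le> snd ab \<and> snd ab < length cols \<and>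
       k < sum_list (map fst (take (snd ab + 1 - fst ab) (drop (fst ab) cols))) \<and>
       0 < (\<Sum>c\<leftarrow>take (snd ab + 1 - fst ab) (drop (fst ab) cols). snd c - 1)}"
      proof
        fix cols :: "(nat \<times> nat) list"
        show "finite {ab. fst ab \<le> snd ab \<and> snd ab < length cols \<and>
         k < sum_list (map fst (take (snd ab + 1 - fst ab) (drop (fst ab) cols))) \<and>
         0 < (\<Sum>c\<leftarrow>take (snd ab + 1 - fst ab) (drop (fst ab) cols). snd c - 1)}"
          by (rule finite_subset[of _ "{..<length cols} \<times> {..<length cols}"]) auto
      qed
    qed (auto simp: wide_def intro!: sum.cong)
    also have "\<dots> = (\<Sum>cols\<in>arr (S + k) (Suc e). (of_rat (Tk (ks @ [k]) cols) :: real) *\<^sub>R V cols)"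
    proof (rule sum.cong, rule refl)
      fix cols assume cols: "cols \<in> arr (S + k) (Suc e)"
      have G: "G (contract k (cols, a, b)) = (of_rat (case contract k (cols, a, b) of (cols', a, mid) \<Rightarrow>
         Tk ks cols' * T2 (fst (cols' ! a)) k (map fst mid) *
         (fact (snd (cols' ! a)) / (\<Prod>c\<leftarrow>mid. fact (snd c - 1)))) :: real) *\<^sub>R V cols"
        if "a \<le> b" "b < length cols" "k < sum_list (map fst (take (b + 1 - a) (drop a cols)))"
         "0 < (\<Sum>c\<leftarrow>take (b + 1 - a) (drop a cols). snd c - 1)" for a b
      proof -
        obtain cols' a' mid where c: "contract k (cols, a, b) = (cols', a', mid)" by (metis prod_cases3)
        have "(cols, a, b) \<in> wide k S e" using that cols by (simp add: wide_def)
        from contract_expand(2)[OF this, unfolded c expand_def split_conv prod.inject] have "take a' cols' @ mid @ drop (Suc a') cols' = cols"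
          by (rule conjunct1)
        moreover have "of_rat (\<Prod>c\<leftarrow>mid. fact (snd c - 1)) = (\<Prod>c\<leftarrow>mid. fact (snd c - 1) :: real)"
          by (induction mid) (auto simp: of_rat_mult of_rat_fact)
        ultimately show ?thesis by (simp add: c G_def of_rat_mult of_rat_divide of_rat_fact mult.assoc)
      qed
      show "(\<Sum>ab | fst ab \<le> snd ab \<and> snd ab < length cols \<and>
       k < sum_list (map fst (take (snd ab + 1 - fst ab) (drop (fst ab) cols))) \<and>
       0 < (\<Sum>c\<leftarrow>take (snd ab + 1 - fst ab) (drop (fst ab) cols). snd c - 1).
       G (contract k (cols, ab))) = (of_rat (Tk (ks @ [k]) cols) :: real) *\<^sub>R V cols"
        unfolding Tk_snoc[OF True cols] of_rat_sum scaleR_sum_left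
        by (rule sum.cong) (auto simp: G)
    qed
    finally show ?thesis unfolding len by (simp add: S_def)
  qed
qed simp

end

subsection \<open>Mixed derivatives\<close>

text \<open>Labelled partitions whose blocks may be empty, as the Leibniz rule produces them;
  \<open>seq_partitions\<close> keeps those with non-empty blocks of prescribed sums.\<close>

definition lparts :: "nat set \<Rightarrow> nat \<Rightarrow> nat set list set" where
  "lparts A m = {Bs. length Bs = m \<and>
     (\<forall>j<length Bs. \<forall>j'<length Bs. j \<noteq> j' \<longrightarrow> Bs ! j \<inter> Bs ! j' = {}) \<and> \<Union>(set Bs) = A}"

lemma lparts_0: "lparts A 0 = (if A = {} then {[]} else {})"
  by (auto simp: lparts_def)

lemma Cons_in_lparts: "B # Bs \<in> lparts A (Suc m) \<longleftrightarrow> B \<subseteq> A \<and> Bs \<in> lparts (A - B) m"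
proof -
  have "(\<forall>j<length (B # Bs). \<forall>j'<length (B # Bs). j \<noteq> j' \<longrightarrow> (B # Bs) ! j \<inter> (B # Bs) ! j' = {}) \<longleftrightarrow>
    (\<forall>j<length Bs. B \<inter> Bs ! j = {}) \<and>
    (\<forall>j<length Bs. \<forall>j'<length Bs. j \<noteq> j' \<longrightarrow> Bs ! j \<inter> Bs ! j' = {})"
    by (simp add: All_less_Suc2 Int_commute) blast
  also have "(\<forall>j<length Bs. B \<inter> Bs ! j = {}) \<longleftrightarrow> B \<inter> \<Union>(set Bs) = {}"
    by (auto simp: set_conv_nth)
  finally show ?thesis by (auto simp: lparts_def)
qed

lemma finite_lparts [simp]: "finite A \<Longrightarrow> finite (lparts A m)"
  by (rule finite_subset[of _ "{Bs. set Bs \<subseteq> Pow A \<and> length Bs = m}"])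
     (auto simp: lparts_def finite_lists_length_eq)

lemma sum_lparts_Suc:
  assumes "finite A"
  shows "(\<Sum>Bs\<in>lparts A (Suc m). g Bs) = (\<Sum>B\<in>Pow A. \<Sum>Bs\<in>lparts (A - B) m. g (B # Bs))"
proof -
  have "(\<Sum>Bs\<in>lparts A (Suc m). g Bs) = (\<Sum>(B, Bs)\<in>(SIGMA B:Pow A. lparts (A - B) m). g (B # Bs))"
  proof (rule sum.reindex_bij_witness[of _ "\<lambda>(B, Bs). B # Bs" "\<lambda>Bs. (hd Bs, tl Bs)"], goal_cases)
    case (1 Bs)
    then show ?case by (cases Bs) (auto simp: lparts_def)
  next
    case (2 Bs)
    then obtain B Cs where "Bs = B # Cs" by (cases Bs) (auto simp: lparts_def)
    then show ?case using 2 by (simp add: Cons_in_lparts)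
  next
    case (5 Bs)
    then show ?case by (cases Bs) (auto simp: lparts_def)
  qed (auto simp: Cons_in_lparts)
  then show ?thesis using assms by (simp add: sum.Sigma)
qed

lemma seq_partitions_lparts:
  "seq_partitions as ss = {Bs \<in> lparts {..<length as} (length ss).
     list_all2 (\<lambda>s B. B \<noteq> {} \<and> (\<Sum>p\<in>B. as ! p) = s) ss Bs}"
  by (auto simp: seq_partitions_def lparts_def list_all2_conv_all_nth)

lemma lparts_finite: "Bs \<in> lparts A m \<Longrightarrow> finite A \<Longrightarrow> B \<in> set Bs \<Longrightarrow> finite B"
  by (auto simp: lparts_def intro: finite_subset)

lemma lparts_sum:
  assumes "finite A" "Bs \<in> lparts A m"
  shows "(\<Sum>B\<leftarrow>Bs. \<Sum>p\<in>B. g p) = (\<Sum>p\<in>A. g p :: nat)"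
  using assms
proof (induction Bs arbitrary: A m)
  case (Cons B Bs)
  then obtain n where m: "m = Suc n" by (cases m) (auto simp: lparts_def)
  then have "B \<subseteq> A" "Bs \<in> lparts (A - B) n" using Cons.prems by (auto simp: Cons_in_lparts)
  then show ?case using Cons.IH[of "A - B" n] Cons.prems sum.subset_diff[of B A g]
    by (simp add: add.commute)
qed (auto simp: lparts_def)

lemma lparts_prod:
  assumes "finite A" "Bs \<in> lparts A m"
  shows "(\<Prod>B\<leftarrow>Bs. \<Prod>p\<in>B. g p) = (\<Prod>p\<in>A. g p :: real)"
  using assms
proof (induction Bs arbitrary: A m)
  case (Cons B Bs)
  then obtain n where m: "m = Suc n" by (cases m) (auto simp: lparts_def)
  then have "B \<subseteq> A" "Bs \<in> lparts (A - B) n" using Cons.prems by (auto simp: Cons_in_lparts)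
  then show ?case using Cons.IH[of "A - B" n] Cons.prems prod.subset_diff[of B A g]
    by (simp add: mult.commute)
qed (auto simp: lparts_def)

text \<open>B consists of positions, since one index may occur several times in js. Sorting merely
  selects an order, which is immaterial for commuting derivations, see
  \<open>dset_insert\<close>.\<close>

definition dset :: "(nat \<Rightarrow> 'a \<Rightarrow> 'a) \<Rightarrow> nat list \<Rightarrow> nat set \<Rightarrow> 'a \<Rightarrow> 'a" where
  "dset D js B = fold D (map ((!) js) (sorted_list_of_set B))"

lemma dset_empty [simp]: "dset D js {} x = x"
  by (simp add: dset_def)

lemma dset_all: "dset D js {..<length js} = fold D js"
  by (simp add: dset_def lessThan_atLeast0 map_nth)

locale derivations =
  fixes D :: "nat \<Rightarrow> 'a :: {comm_ring_1, real_algebra_1} \<Rightarrow> 'a"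
  assumes D: "\<And>i. derivation (D i)"
    and D_D: "\<And>i j x. D i (D j x) = D j (D i x)"
begin

sublocale derivation "D i" for i by (rule D)

lemma dset_insert:
  assumes "finite B" "p \<notin> B"
  shows "dset D js (insert p B) x = D (js ! p) (dset D js B x)"
proof -
  have "fold D (map ((!) js) (sorted_list_of_set (insert p B))) =
      fold D (map ((!) js) (sorted_list_of_set B @ [p]))"
  proof (rule fold_multiset_equiv)
    have "mset (sorted_list_of_set (insert p B)) = mset (sorted_list_of_set B @ [p])"
      using assms by (simp flip: sorted_list_of_mset_set mset_set_set add: ac_simps)
    then show "mset (map ((!) js) (sorted_list_of_set (insert p B))) =
      mset (map ((!) js) (sorted_list_of_set B @ [p]))"
      by (simp only: mset_map)
  qed (auto simp: D_D)
  then show ?thesis by (simp add: dset_def)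
qed

lemma fold_D:
  "fold D ks (x + y) = fold D ks x + fold D ks y" "fold D ks (r *\<^sub>R x) = r *\<^sub>R fold D ks x"
  "fold D ks 0 = 0" "fold D ks (sum f S) = (\<Sum>x\<in>S. fold D ks (f x))"
proof -
  show 1: "fold D ks (x + y) = fold D ks x + fold D ks y" for x y by (induction ks arbitrary: x y) auto
  show "fold D ks (r *\<^sub>R x) = r *\<^sub>R fold D ks x" by (induction ks arbitrary: x) auto
  show 2: "fold D ks 0 = 0" by (induction ks) auto
  show "fold D ks (sum f S) = (\<Sum>x\<in>S. fold D ks (f x))"
    by (induction S rule: infinite_finite_induct) (auto simp: 1 2)
qed

lemma fold_D_commute:
  assumes "\<And>j x. j \<in> set ks \<Longrightarrow> E (D j x) = D j (E x)"
  shows "fold D ks (E x) = E (fold D ks x)"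
  using assms
proof (induction ks arbitrary: x)
  case (Cons k ks)
  have 1: "D k (E x) = E (D k x)" using Cons.prems by simp
  have "fold D ks (E (D k x)) = E (fold D ks (D k x))"
    by (rule Cons.IH, rule Cons.prems) simp
  then show ?case by (simp add: 1)
qed simp

text \<open>Each derivation acts on one of the two factors; B collects the positions of those that
  act on x.\<close>

lemma dset_mult:
  assumes "finite A"
  shows "dset D js A (x * y) = (\<Sum>B\<in>Pow A. dset D js B x * dset D js (A - B) y)"
  using assms
proof (induction A rule: finite_induct)
  case (insert p A)
  have 1: "dset D js (insert p A - B) y = D (js ! p) (dset D js (A - B) y)" if "B \<in> Pow A" for B
  proof -
    have "insert p A - B = insert p (A - B)" using insert that by auto
    then show ?thesis using insert by (simp add: dset_insert)
  qed
  have 2: "dset D js (insert p B) x = D (js ! p) (dset D js B x)" "insert p A - insert p B = A - B"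
    if "B \<in> Pow A" for B
  proof -
    have "finite B" "p \<notin> B" using that insert by (auto intro: finite_subset)
    then show "dset D js (insert p B) x = D (js ! p) (dset D js B x)" by (rule dset_insert)
    show "insert p A - insert p B = A - B" using insert by auto
  qed
  have "dset D js (insert p A) (x * y) =
      (\<Sum>B\<in>Pow A. dset D js B x * D (js ! p) (dset D js (A - B) y)) +
      (\<Sum>B\<in>Pow A. D (js ! p) (dset D js B x) * dset D js (A - B) y)"
    using insert by (simp add: dset_insert mult sum.distrib)
  also have "(\<Sum>B\<in>Pow A. D (js ! p) (dset D js B x) * dset D js (A - B) y) =
      (\<Sum>B\<in>insert p ` Pow A. dset D js B x * dset D js (insert p A - B) y)"
    using insert by (subst sum.reindex) (auto simp: inj_on_def 2 insert_ident intro!: sum.cong)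
  also have "(\<Sum>B\<in>Pow A. dset D js B x * D (js ! p) (dset D js (A - B) y)) =
      (\<Sum>B\<in>Pow A. dset D js B x * dset D js (insert p A - B) y)"
    by (intro sum.cong refl) (simp add: 1)
  also have "\<dots> + (\<Sum>B\<in>insert p ` Pow A. dset D js B x * dset D js (insert p A - B) y) =
      (\<Sum>B\<in>Pow (insert p A). dset D js B x * dset D js (insert p A - B) y)"
    unfolding Pow_insert by (rule sum.union_disjoint[symmetric]) (use insert in auto)
  finally show ?case .
qed simp

lemma dset_prod_list:
  assumes "finite A"
  shows "dset D js A (prod_list xs) = (\<Sum>Bs\<in>lparts A (length xs). \<Prod>(x, B)\<leftarrow>zip xs Bs. dset D js B x)"
  using assms
proof (induction xs arbitrary: A)
  case Nil
  have "dset D js A 1 = 0" if "A \<noteq> {}" "finite A" for A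
    using that(2,1)
  proof (induction A rule: finite_induct)
    case (insert p A)
    then show ?case by (cases "A = {}") (simp_all add: dset_insert)
  qed simp
  then show ?case using Nil by (simp add: lparts_0)
next
  case (Cons x xs)
  then show ?case
    by (simp add: dset_mult sum_lparts_Suc sum_distrib_left)
qed

end

sublocale toda_half \<subseteq> derivations D
  by unfold_locales (rule D_D)

section \<open>Arrays with one column\<close>

lemma T2_single:
  assumes "i \<ge> 1" "j \<ge> 1"
  shows "T2 i j [i + j] = 1"
proof -
  have P1: "P i j [i + j] = 1"
  proof -
    have "{(ks, js). length ks = length [i + j] \<and> length js = length [i + j] \<and>
     0 \<notin> set ks \<and> 0 \<notin> set js \<and> sum_list ks = i \<and> sum_list js = j \<and>
     (\<forall>a<length [i + j]. [i + j] ! a = ks ! a + js ! a)} = {([i], [j])}"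
      using assms by (auto simp: length_Suc_conv)
    then show ?thesis unfolding P_def by simp
  qed
  have "{ns. ns \<noteq> [] \<and> 0 \<notin> set ns \<and> sum_list ns = length [i + j]} = {[1]}"
  proof (intro equalityI subsetI)
    fix ns assume "ns \<in> {ns. ns \<noteq> [] \<and> 0 \<notin> set ns \<and> sum_list ns = length [i + j]}"
    then have ns: "ns \<noteq> []" "0 \<notin> set ns" "sum_list ns = 1" by auto
    then have "length ns \<le> 1" using length_le_sum_list[of ns] by simp
    then show "ns \<in> {[1]}" using ns by (cases ns) auto
  qed auto
  then show ?thesis by (simp add: T2_def P1)
qed

text \<open>For a single column the recursion has one term, in which the quotient of factorials and
  \<open>T2\<close> are both 1. The value 1 is the reason for the separate clauses of
  \<open>Ntilde\<close> with a single index on one side: there only this array survives the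
  restriction, see \<open>rho_D_fold_Db\<close>.\<close>

lemma Tk_single:
  assumes "length ks \<ge> 2" "0 \<notin> set ks"
  shows "Tk ks [(sum_list ks, length ks - 1)] = 1"
  using assms
proof (induction ks rule: rev_induct)
  case (snoc k ks)
  have k: "k \<ge> 1" using snoc.prems by auto
  show ?case
  proof (cases "length ks \<ge> 2")
    case False
    then obtain i where ks: "ks = [i]" using snoc.prems by (cases ks) (auto simp: Suc_le_eq)
    then have "i \<ge> 1" using snoc.prems by auto
    then show ?thesis using k by (subst Tk.simps) (simp add: ks T2_single[simplified])
  next
    case True
    have "ks \<noteq> []" using True by auto
    then obtain i ks' where "ks = i # ks'" by (cases ks) auto
    then have s: "sum_list ks \<ge> 1" using snoc.prems by auto
    have e: "Suc (length ks - 2) = length ks - 1" using True by simp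
    have cols: "[(sum_list ks + k, length ks)] \<in> arr (sum_list ks + k) (Suc (length ks - 2))"
      using True k \<open>ks \<noteq> []\<close> by (simp add: arr_def e)
    have "{(a, b). a \<le> b \<and> b < length [(sum_list ks + k, length ks)] \<and>
     k < sum_list (map fst (take (b + 1 - a) (drop a [(sum_list ks + k, length ks)]))) \<and>
     0 < (\<Sum>c\<leftarrow>take (b + 1 - a) (drop a [(sum_list ks + k, length ks)]). snd c - 1)} = {(0, 0)}"
      using True s by auto
    then have "Tk (ks @ [k]) [(sum_list ks + k, length ks)] = 1"
      using snoc True k s T2_single[of "sum_list ks" k]
      by (simp only: Tk_snoc[OF True cols]) (simp add: contract_def)
    then show ?thesis by simp
  qed
qed simp

text \<open>\<open>rho\<close> stands for the restriction to t_k = 0 of both kinds and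
  \<open>phi\<close> for f. \<open>rho\<close> is assumed to commute with d0 only, so it has to be
  applied after all the D and Db. The assumptions \<open>rho_D\<close> and \<open>rho_Db\<close>
  express that the solution is symmetric, and \<open>rho_D_Db\<close> is what the third equation
  provides.\<close>

locale toda_ring =
  D: toda_half d0 D F + Db: toda_half d0 Db F
  for d0 :: "'a :: {comm_ring_1, real_algebra_1} \<Rightarrow> 'a" and D Db :: "nat \<Rightarrow> 'a \<Rightarrow> 'a" and F :: 'a +
  fixes rho :: "'a \<Rightarrow> 'a" and phi :: 'a
  assumes D_Db: "\<And>i j x. D i (Db j x) = Db j (D i x)"
    and rho_add [simp]: "\<And>x y. rho (x + y) = rho x + rho y"
    and rho_scaleR [simp]: "\<And>r x. rho (r *\<^sub>R x) = r *\<^sub>R rho x"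
    and rho_mult [simp]: "\<And>x y. rho (x * y) = rho x * rho y"
    and rho_one [simp]: "rho 1 = 1"
    and rho_d0: "\<And>x. rho (d0 x) = d0 (rho x)"
    and rho_D: "\<And>i. i \<ge> 1 \<Longrightarrow> rho (D i F) = 0"
    and rho_Db: "\<And>i. i \<ge> 1 \<Longrightarrow> rho (Db i F) = 0"
    and rho_D_Db: "\<And>i j. i \<ge> 1 \<Longrightarrow> j \<ge> 1 \<Longrightarrow>
      rho (D i (Db j F)) = (if i = j then real i *\<^sub>R phi ^ i else 0)"
begin

lemma swapped: "toda_ring d0 Db D F rho phi"
  by unfold_locales
     (simp_all add: rho_d0 rho_D rho_Db rho_D_Db flip: D_Db)

lemma rho_sum [simp]: "rho (sum f S) = (\<Sum>x\<in>S. rho (f x))"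
proof -
  have "rho 0 = 0" using rho_scaleR[of 0 0] by simp
  then show ?thesis by (induction S rule: infinite_finite_induct) auto
qed

lemma rho_prod_list: "rho (prod_list xs) = prod_list (map rho xs)"
  by (induction xs) auto

lemma rho_d0_pow: "rho ((d0 ^^ l) x) = (d0 ^^ l) (rho x)"
  by (induction l) (auto simp: rho_d0)

lemma rho_v: "s \<ge> 1 \<Longrightarrow> rho (D.v s l) = 0"
  by (simp add: D.v_def rho_d0_pow rho_D)

lemma rho_V: "s \<ge> 1 \<Longrightarrow> (s, l) \<in> set cols \<Longrightarrow> rho (D.V cols) = 0"
  unfolding D.V_def rho_prod_list by (rule prod_list_eq_0) (force simp: rho_v)

text \<open>An upper row of positive sum has at least one column, and the corresponding factor
  vanishes under \<open>rho\<close>. Hence coefficients with exactly one empty diagram are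
  0.\<close>

lemma rho_fold_D:
  assumes "ks \<noteq> []" "0 \<notin> set ks"
  shows "rho (fold D ks F) = 0"
proof (cases "length ks \<ge> 2")
  case False
  then obtain k where "ks = [k]" using assms by (cases ks) (auto simp: Suc_le_eq)
  then show ?thesis using assms by (auto simp: rho_D)
next
  case True
  have "rho (D.V cols) = 0" if "cols \<in> arr (sum_list ks) (length ks - 2)" for cols
  proof -
    have "sum_list ks > 0" using True length_le_sum_list[OF assms(2)] by linarith
    then have "cols \<noteq> []" using that by (auto simp: arr_def simp del: sum_list_eq_0_iff)
    then obtain s l cols' where "cols = (s, l) # cols'" by (metis neq_Nil_conv prod.exhaust)
    then show ?thesis using that rho_V[of s l cols] by (auto simp: arr_def)
  qed
  then show ?thesis using assms by (simp add: D.iterated_D[OF True])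
qed

end

text \<open>D_s acts on one factor at a time, so a product of two or more factors \<open>v\<close>
  keeps one that \<open>rho\<close> sends to 0. What survives is the single column (S, length ks -
  1), with coefficient 1 by \<open>Tk_single\<close>; there \<open>rho_D_Db\<close> gives S phi^S if
  s = S, and S cancels against the 1/S in \<open>v\<close>.\<close>

lemma (in toda_ring) rho_D_fold_Db:
  assumes "ks \<noteq> []" "0 \<notin> set ks" "s \<ge> 1"
  shows "rho (D s (fold Db ks F)) =
    (if sum_list ks = s then real (prod_list ks) *\<^sub>R (d0 ^^ (length ks - 1)) (phi ^ s) else 0)"
proof (cases "length ks \<ge> 2")
  case False
  then obtain k where "ks = [k]" using assms by (cases ks) (auto simp: Suc_le_eq)
  then show ?thesis using assms by (auto simp: rho_D_Db)
next
  case True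
  interpret sw: toda_ring d0 Db D F rho phi by (rule swapped)
  define S where "S = sum_list ks"
  define A where "A = arr S (length ks - 2)"
  have S: "S \<ge> 1" using length_le_sum_list[OF assms(2)] True by (simp add: S_def)
  have single: "[(S, length ks - 1)] \<in> A" using S True by (simp add: A_def arr_def)
  have z: "rho (D s (Db.V cols)) = 0" if cols: "cols \<in> A" "cols \<noteq> [(S, length ks - 1)]" for cols
  proof -
    have "cols \<noteq> []" using cols S by (auto simp: A_def arr_def)
    moreover have "length cols \<noteq> 1"
    proof
      assume "length cols = 1"
      then obtain c where "cols = [c]" by (cases cols) auto
      then show False using cols True by (cases c) (auto simp: A_def arr_def)
    qed
    ultimately have len: "length cols \<ge> 2" by (cases cols) (auto simp: Suc_le_eq)
    have pos: "\<And>s l. (s, l) \<in> set cols \<Longrightarrow> s \<ge> 1" using cols by (force simp: A_def arr_def)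
    have "D s (Db.V cols) = (\<Sum>a<length cols. Db.V (take a cols) *
        D s (Db.v (fst (cols ! a)) (snd (cols ! a))) * Db.V (drop (Suc a) cols))"
      unfolding Db.V_def by (subst D.D.prod_list) (simp add: take_map drop_map split_beta)
    moreover have "rho (Db.V (take a cols)) = 0 \<or> rho (Db.V (drop (Suc a) cols)) = 0"
      if "a < length cols" for a
    proof (cases "a = 0")
      case True
      then have "hd (drop (Suc a) cols) \<in> set (drop (Suc a) cols)" using len by (intro list.set_sel) auto
      then show ?thesis
        using sw.rho_V[of "fst (hd (drop (Suc a) cols))" "snd (hd (drop (Suc a) cols))"] pos
        by (metis in_set_dropD prod.collapse)
    next
      case False
      then have "hd (take a cols) \<in> set (take a cols)" using len by (intro list.set_sel) auto
      then show ?thesis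
        using sw.rho_V[of "fst (hd (take a cols))" "snd (hd (take a cols))"] pos
        by (metis in_set_takeD prod.collapse)
    qed
    ultimately show ?thesis by (force intro!: sum.neutral)
  qed
  have "rho (D s (fold Db ks F)) = real (prod_list ks) *\<^sub>R
      (\<Sum>cols\<in>A. (of_rat (Tk ks cols) :: real) *\<^sub>R rho (D s (Db.V cols)))"
    by (simp add: Db.iterated_D[OF True assms(2)] A_def S_def)
  also have "(\<Sum>cols\<in>A. (of_rat (Tk ks cols) :: real) *\<^sub>R rho (D s (Db.V cols))) =
      rho (D s (Db.V [(S, length ks - 1)]))"
    by (subst sum.remove[OF _ single])
       (use z in \<open>auto simp: A_def S_def Tk_single[OF True assms(2), simplified] intro!: sum.neutral\<close>)
  also have "\<dots> = (1 / real S) *\<^sub>R (d0 ^^ (length ks - 1)) (rho (D s (Db S F)))"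
    by (simp add: Db.V_def Db.v_def D.d0_pow_D rho_d0_pow)
  finally show ?thesis using S assms by (auto simp: rho_D_Db S_def)
qed

lemma prod_nth: "(\<Prod>p<length xs. real (xs ! p)) = real (prod_list xs)"
  by (induction xs) (simp_all add: prod.lessThan_Suc_shift del: prod.lessThan_Suc)

text \<open>The derivations in js are distributed over the factors. A factor that receives none
  vanishes under \<open>rho\<close>. A factor \<open>v s l\<close> that receives the block B
  commutes past it to an instance of \<open>rho_D_fold_Db\<close>, which is nonzero only if the
  indices in B have sum s. This produces both the labelled partitions and the denominator s_1 ...
  s_m of \<open>Ntilde\<close>.\<close>

lemma (in toda_ring) rho_fold_Db_V:
  assumes js: "0 \<notin> set js" and cols: "\<And>s l. (s, l) \<in> set cols \<Longrightarrow> s \<ge> 1"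
  shows "rho (fold Db js (D.V cols)) = (real (prod_list js) / real (prod_list (map fst cols))) *\<^sub>R
    (\<Sum>Bs\<in>seq_partitions js (map fst cols).
      \<Prod>((s, l), B)\<leftarrow>zip cols Bs. (d0 ^^ (l + card B - 1)) (phi ^ s))"
proof -
  define h where "h s l B = (d0 ^^ (l + card B - 1)) (phi ^ s)" for s l and B :: "nat set"
  have rho_dset: "rho (dset Db js B (D.v s l)) =
      (if B \<noteq> {} \<and> (\<Sum>p\<in>B. js ! p) = s then ((\<Prod>p\<in>B. real (js ! p)) / real s) *\<^sub>R h s l B else 0)"
    if B: "B \<subseteq> {..<length js}" and s: "s \<ge> 1" for B s l
  proof (cases "B = {}")
    case True
    then show ?thesis using rho_v[OF s] by simp
  next
    case False
    define ks where "ks = map ((!) js) (sorted_list_of_set B)"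
    have fin: "finite B" using B finite_subset by blast
    have ks: "ks \<noteq> []" "0 \<notin> set ks" "length ks = card B" "sum_list ks = (\<Sum>p\<in>B. js ! p)"
      "real (prod_list ks) = (\<Prod>p\<in>B. real (js ! p))"
    proof -
      show "ks \<noteq> []" using False fin by (simp add: ks_def)
      show "0 \<notin> set ks" using B js fin by (auto simp: ks_def) (metis lessThan_iff nth_mem subsetD)
      show "length ks = card B" by (simp add: ks_def)
      show "sum_list ks = (\<Sum>p\<in>B. js ! p)"
        using fin by (simp add: ks_def sum_list_distinct_conv_sum_set)
      show "real (prod_list ks) = (\<Prod>p\<in>B. real (js ! p))"
        using fin by (simp add: ks_def flip: prod.distinct_set_conv_list)
    qed
    have "dset Db js B (D.v s l) = (1 / real s) *\<^sub>R (d0 ^^ l) (D s (dset Db js B F))"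
      unfolding dset_def D.v_def Db.fold_D
      by (subst Db.fold_D_commute[where E = "d0 ^^ l"], simp add: Db.d0_pow_D)
         (subst Db.fold_D_commute[where E = "D s"], simp_all add: D_Db)
    then have "rho (dset Db js B (D.v s l)) = (1 / real s) *\<^sub>R (d0 ^^ l) (rho (D s (fold Db ks F)))"
      by (simp add: rho_d0_pow dset_def ks_def)
    also have "\<dots> = (if (\<Sum>p\<in>B. js ! p) = s then ((\<Prod>p\<in>B. real (js ! p)) / real s) *\<^sub>R
        (d0 ^^ l) ((d0 ^^ (card B - 1)) (phi ^ s)) else 0)"
      by (simp add: rho_D_fold_Db[OF ks(1,2) s] ks(3-5))
    also have "(d0 ^^ l) ((d0 ^^ (card B - 1)) (phi ^ s)) = h s l B"
      using False fin by (simp add: h_def funpow_add[symmetric, THEN fun_cong, unfolded comp_def]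
          Suc_le_eq card_gt_0_iff)
    finally show ?thesis using False by simp
  qed
  have prod: "(\<Prod>((s, l), B)\<leftarrow>zip cols Bs. rho (dset Db js B (D.v s l))) =
      (if list_all2 (\<lambda>s B. B \<noteq> {} \<and> (\<Sum>p\<in>B. js ! p) = s) (map fst cols) Bs
       then ((\<Prod>B\<leftarrow>Bs. \<Prod>p\<in>B. real (js ! p)) / real (prod_list (map fst cols))) *\<^sub>R
         (\<Prod>((s, l), B)\<leftarrow>zip cols Bs. h s l B) else 0)"
    if "length cols = length Bs" "\<forall>B\<in>set Bs. B \<subseteq> {..<length js}" for Bs
    using that cols
  proof (induction cols Bs rule: list_induct2)
    case (Cons c cols B Bs)
    obtain s l where c: "c = (s, l)" by fastforce
    have "rho (dset Db js B (D.v s l)) =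
      (if B \<noteq> {} \<and> (\<Sum>p\<in>B. js ! p) = s then ((\<Prod>p\<in>B. real (js ! p)) / real s) *\<^sub>R h s l B else 0)"
      using Cons.prems c by (intro rho_dset) auto
    moreover have "(\<Prod>((s, l), B)\<leftarrow>zip cols Bs. rho (dset Db js B (D.v s l))) =
      (if list_all2 (\<lambda>s B. B \<noteq> {} \<and> (\<Sum>p\<in>B. js ! p) = s) (map fst cols) Bs
       then ((\<Prod>B\<leftarrow>Bs. \<Prod>p\<in>B. real (js ! p)) / real (prod_list (map fst cols))) *\<^sub>R
         (\<Prod>((s, l), B)\<leftarrow>zip cols Bs. h s l B) else 0)"
      using Cons.prems by (intro Cons.IH) auto
    ultimately show ?case by (simp add: c mult.commute)
  qed simp
  have "rho (fold Db js (D.V cols)) =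
      (\<Sum>Bs\<in>lparts {..<length js} (length cols). \<Prod>((s, l), B)\<leftarrow>zip cols Bs. rho (dset Db js B (D.v s l)))"
    unfolding dset_all[symmetric] D.V_def
    by (simp add: Db.dset_prod_list rho_prod_list zip_map1 comp_def case_prod_unfold)
  also have "\<dots> = (\<Sum>Bs\<in>lparts {..<length js} (length cols).
      if list_all2 (\<lambda>s B. B \<noteq> {} \<and> (\<Sum>p\<in>B. js ! p) = s) (map fst cols) Bs
       then (real (prod_list js) / real (prod_list (map fst cols))) *\<^sub>R
         (\<Prod>((s, l), B)\<leftarrow>zip cols Bs. h s l B) else 0)"
  proof (rule sum.cong, rule refl)
    fix Bs assume Bs: "Bs \<in> lparts {..<length js} (length cols)"
    have "(\<Prod>B\<leftarrow>Bs. \<Prod>p\<in>B. real (js ! p)) = (\<Prod>p<length js. real (js ! p))"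
      using Bs by (intro lparts_prod) auto
    also have "\<dots> = real (prod_list js)"
      by (rule prod_nth)
    finally show "(\<Prod>((s, l), B)\<leftarrow>zip cols Bs. rho (dset Db js B (D.v s l))) =
      (if list_all2 (\<lambda>s B. B \<noteq> {} \<and> (\<Sum>p\<in>B. js ! p) = s) (map fst cols) Bs
       then (real (prod_list js) / real (prod_list (map fst cols))) *\<^sub>R
         (\<Prod>((s, l), B)\<leftarrow>zip cols Bs. h s l B) else 0)"
      using Bs by (subst prod) (auto simp: lparts_def)
  qed
  also have "\<dots> = (\<Sum>Bs\<in>seq_partitions js (map fst cols).
      (real (prod_list js) / real (prod_list (map fst cols))) *\<^sub>R (\<Prod>((s, l), B)\<leftarrow>zip cols Bs. h s l B))"
    unfolding seq_partitions_lparts by (simp add: sum.inter_filter)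
  finally show ?thesis by (simp add: h_def scaleR_sum_right)
qed

section \<open>From the arrays of \<open>Tk\<close> to those of \<open>Ntilde\<close>\<close>

lemma finite_arrays [simp]: "finite (arrays S r)"
proof (rule finite_subset)
  show "arrays S r \<subseteq> (\<Union>l\<le>r. mids S l)"
  proof
    fix cols assume cols: "cols \<in> arrays S r"
    then have "sum_list (map snd cols) = length cols + (\<Sum>c\<leftarrow>cols. snd c - 1)"
      by (intro mids_eq) (auto simp: arrays_def)
    then have "(\<Sum>c\<leftarrow>cols. snd c - 1) \<le> r" using cols by (simp add: arrays_def)
    then show "cols \<in> (\<Union>l\<le>r. mids S l)" using cols by (auto simp: arrays_def mids_def)
  qed
qed simp

lemma finite_seq_partitions [simp]: "finite (seq_partitions as ss)"
  by (simp add: seq_partitions_lparts)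

lemma seq_partitionsD:
  assumes "Bs \<in> seq_partitions as ss"
  shows "length Bs = length ss" "sum_list ss = sum_list as" "(\<Sum>B\<leftarrow>Bs. card B) = length as"
    "\<And>B. B \<in> set Bs \<Longrightarrow> card B > 0"
proof -
  have Bs: "Bs \<in> lparts {..<length as} (length ss)"
      "list_all2 (\<lambda>s B. B \<noteq> {} \<and> (\<Sum>p\<in>B. as ! p) = s) ss Bs"
    using assms by (auto simp: seq_partitions_lparts)
  show "length Bs = length ss" using Bs by (simp add: lparts_def)
  have "(\<Sum>B\<leftarrow>Bs. \<Sum>p\<in>B. as ! p) = sum_list ss"
    using Bs(2) by (induction rule: list_all2_induct) auto
  then show "sum_list ss = sum_list as"
    using lparts_sum[OF _ Bs(1), of "(!) as"] by (simp add: sum_list_sum_nth lessThan_atLeast0)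
  show "(\<Sum>B\<leftarrow>Bs. card B) = length as"
    using lparts_sum[OF _ Bs(1), of "\<lambda>_. 1"] by simp
  show "card B > 0" if "B \<in> set Bs" for B
  proof -
    have "finite B" using lparts_finite[OF Bs(1) _ that] by simp
    moreover have "B \<noteq> {}" using Bs(2) that by (auto simp: list_all2_conv_all_nth in_set_conv_nth)
    ultimately show ?thesis by (simp add: card_gt_0_iff)
  qed
qed

text \<open>Change of the lower row between \<open>Ntilde\<close> and \<open>Tk\<close>: a column
  (s, l) that absorbs n barred derivations leaves a d0-derivative of order r = l + n - 1. The
  difference in \<open>lower\<close> is truncated, so \<open>raise\<close> undoes it only where n is
  at most r.\<close>

definition lower :: "(nat \<times> nat) list \<Rightarrow> nat set list \<Rightarrow> (nat \<times> nat) list" where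
  "lower cols Bs = map (\<lambda>((s, r), B). (s, r + 1 - card B)) (zip cols Bs)"

definition raise :: "(nat \<times> nat) list \<Rightarrow> nat set list \<Rightarrow> (nat \<times> nat) list" where
  "raise cols Bs = map (\<lambda>((s, l), B). (s, l + card B - 1)) (zip cols Bs)"

lemma lower_raise:
  assumes "length cols = length Bs" "\<And>B. B \<in> set Bs \<Longrightarrow> card B > 0"
  shows "map fst (lower cols Bs) = map fst cols" "map fst (raise cols Bs) = map fst cols"
    "lower (raise cols Bs) Bs = cols"
    "\<forall>((s, r), B)\<in>set (zip cols Bs). card B \<le> r \<Longrightarrow> raise (lower cols Bs) Bs = cols"
    "\<forall>((s, r), B)\<in>set (zip cols Bs). card B \<le> r \<Longrightarrow>
      sum_list (map snd (lower cols Bs)) + (\<Sum>B\<leftarrow>Bs. card B) = sum_list (map snd cols) + length Bs"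
    "sum_list (map snd (raise cols Bs)) + length Bs = sum_list (map snd cols) + (\<Sum>B\<leftarrow>Bs. card B)"
proof -
  have pos: "\<forall>B\<in>set Bs. 0 < card B" using assms(2) by blast
  show "map fst (lower cols Bs) = map fst cols" "map fst (raise cols Bs) = map fst cols"
    using assms(1) by (induction cols Bs rule: list_induct2) (auto simp: lower_def raise_def)
  show "lower (raise cols Bs) Bs = cols"
    using assms(1) pos by (induction cols Bs rule: list_induct2) (auto simp: lower_def raise_def)
  show "sum_list (map snd (raise cols Bs)) + length Bs = sum_list (map snd cols) + (\<Sum>B\<leftarrow>Bs. card B)"
    using assms(1) pos by (induction cols Bs rule: list_induct2) (auto simp: lower_def raise_def)
  assume "\<forall>((s, r), B)\<in>set (zip cols Bs). card B \<le> r"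
  with assms(1) pos show "raise (lower cols Bs) Bs = cols"
      "sum_list (map snd (lower cols Bs)) + (\<Sum>B\<leftarrow>Bs. card B) = sum_list (map snd cols) + length Bs"
    by (induction cols Bs rule: list_induct2) (auto simp: lower_def raise_def)
qed

text \<open>If one side consists of a single index, this is \<open>rho_D_fold_Db\<close>, read with
  the two kinds of variables exchanged if necessary. Otherwise \<open>iterated_D\<close> expands the
  unbarred derivatives, \<open>rho_fold_Db_V\<close> evaluates the barred ones on each product, and
  the substitution l = r - n + 1 collects equal products of derivatives of phi^s.\<close>

theorem (in toda_ring) rho_mixed:
  assumes ks: "ks \<noteq> []" "0 \<notin> set ks" and js: "js \<noteq> []" "0 \<notin> set js"
    and len: "length ks + length js > 2"
  shows "rho (fold Db js (fold D ks F)) = (if sum_list ks = sum_list js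
    then \<Sum>cols\<in>arrays (sum_list ks) (length ks + length js - 2).
      (of_rat (Ntilde ks js cols) :: real) *\<^sub>R (\<Prod>(s, r)\<leftarrow>cols. (d0 ^^ r) (phi ^ s))
    else 0)"
proof -
  define Q where "Q cols = (\<Prod>(s, r)\<leftarrow>cols. (d0 ^^ r) (phi ^ s))" for cols
  define S e r where "S = sum_list ks" and "e = length ks - 2" and "r = length ks + length js - 2"
  have pos: "sum_list ks > 0" "sum_list js > 0"
    using length_le_sum_list[OF ks(2)] length_le_sum_list[OF js(2)] ks js
    by (metis length_greater_0_conv order_less_le_trans)+
  consider "length ks = 1" | "length js = 1" "length ks \<ge> 2" | "length ks \<ge> 2" "length js \<ge> 2"
    using ks js by (cases ks; cases js) (auto simp: Suc_le_eq)
  then show ?thesis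
  proof cases
    case 1
    then obtain i where i: "ks = [i]" by (cases ks) auto
    have js2: "length js \<ge> 2" using 1 len by simp
    have "fold Db js (D i F) = D i (fold Db js F)"
      by (rule Db.fold_D_commute) (simp add: D_Db)
    then have "rho (fold Db js (fold D ks F)) =
       (if sum_list js = i then real (prod_list js) *\<^sub>R (d0 ^^ (length js - 1)) (phi ^ i) else 0)"
      using rho_D_fold_Db[OF js, of i] pos by (simp add: i)
    moreover have "(\<Sum>cols\<in>arrays (sum_list js) (length ks + length js - 2).
        (of_rat (Ntilde [sum_list js] js cols) :: real) *\<^sub>R (\<Prod>(s, r)\<leftarrow>cols. (d0 ^^ r) (phi ^ s))) =
      (\<Sum>cols\<in>{[(sum_list js, length js - 1)]}.
        (of_rat (Ntilde [sum_list js] js cols) :: real) *\<^sub>R (\<Prod>(s, r)\<leftarrow>cols. (d0 ^^ r) (phi ^ s)))"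
      using js2 pos by (intro sum.mono_neutral_right[OF finite_arrays]) (auto simp: Ntilde_def arrays_def i simp del: sum_list_eq_0_iff)
    ultimately show ?thesis using js2 by (auto simp: i Ntilde_def)
  next
    case 2
    interpret sw: toda_ring d0 Db D F rho phi by (rule swapped)
    obtain j where j: "js = [j]" using 2 by (cases js) auto
    have "rho (fold Db js (fold D ks F)) =
       (if sum_list ks = j then real (prod_list ks) *\<^sub>R (d0 ^^ (length ks - 1)) (phi ^ j) else 0)"
      using sw.rho_D_fold_Db[OF ks, of j] pos by (simp add: j)
    moreover have "(\<Sum>cols\<in>arrays (sum_list ks) (length ks + length js - 2).
        (of_rat (Ntilde ks [sum_list ks] cols) :: real) *\<^sub>R (\<Prod>(s, r)\<leftarrow>cols. (d0 ^^ r) (phi ^ s))) =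
      (\<Sum>cols\<in>{[(sum_list ks, length ks - 1)]}.
        (of_rat (Ntilde ks [sum_list ks] cols) :: real) *\<^sub>R (\<Prod>(s, r)\<leftarrow>cols. (d0 ^^ r) (phi ^ s)))"
      using 2 pos by (intro sum.mono_neutral_right[OF finite_arrays]) (auto simp: Ntilde_def arrays_def j simp del: sum_list_eq_0_iff)
    ultimately show ?thesis using 2 by (auto simp: j Ntilde_def)
  next
    case 3
    define c where "c cols = real (prod_list ks) * (real (prod_list js) / real (prod_list (map fst cols)))"
      for cols :: "(nat \<times> nat) list"
    define SP where "SP cols = seq_partitions js (map fst cols)" for cols :: "(nat \<times> nat) list"
    have Q_raise: "(\<Prod>((s, l), B)\<leftarrow>zip cols Bs. (d0 ^^ (l + card B - 1)) (phi ^ s)) = Q (raise cols Bs)"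
      for cols and Bs :: "nat set list"
      by (simp add: Q_def raise_def comp_def case_prod_unfold)
    have "rho (fold Db js (fold D ks F)) = real (prod_list ks) *\<^sub>R
        (\<Sum>cols\<in>arr S e. (of_rat (Tk ks cols) :: real) *\<^sub>R rho (fold Db js (D.V cols)))"
      by (simp add: D.iterated_D[OF 3(1) ks(2)] Db.fold_D S_def e_def)
    also have "\<dots> = (\<Sum>cols\<in>arr S e. \<Sum>Bs\<in>SP cols. (c cols * of_rat (Tk ks cols)) *\<^sub>R Q (raise cols Bs))"
      unfolding scaleR_sum_right
    proof (rule sum.cong, rule refl)
      fix cols assume "cols \<in> arr S e"
      then have pos: "s \<ge> 1" if "(s, l) \<in> set cols" for s l using that by (force simp: arr_def)
      show "real (prod_list ks) *\<^sub>R (of_rat (Tk ks cols) :: real) *\<^sub>R rho (fold Db js (D.V cols)) =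
        (\<Sum>Bs\<in>SP cols. (c cols * of_rat (Tk ks cols)) *\<^sub>R Q (raise cols Bs))"
        by (subst rho_fold_Db_V[OF js(2) pos], assumption, unfold Q_raise)
           (simp add: c_def SP_def scaleR_sum_right mult_ac)
    qed
    finally have lhs: "rho (fold Db js (fold D ks F)) =
      (\<Sum>cols\<in>arr S e. \<Sum>Bs\<in>SP cols. (c cols * of_rat (Tk ks cols)) *\<^sub>R Q (raise cols Bs))" .
    show ?thesis
    proof (cases "sum_list ks = sum_list js")
      case False
      \<comment> \<open>A partition of js forces the upper row to have the sum of js, whereas
        \<open>arr\<close> prescribes the sum of ks.\<close>
      have "SP cols = {}" if "cols \<in> arr S e" for cols
        using that False seq_partitionsD(2)[of _ js "map fst cols"] by (auto simp: SP_def arr_def S_def)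
      then show ?thesis using False by (simp add: lhs)
    next
      case True
      have Nt: "Ntilde ks js cols = of_nat (prod_list ks * prod_list js) / of_nat (prod_list (map fst cols)) *
        (\<Sum>Bs\<in>SP cols. Tk ks (lower cols Bs))" for cols
        using 3 by (simp add: Ntilde_def SP_def lower_def)
      \<comment> \<open>Where \<open>ok\<close> fails, some r + 1 - card B is truncated to 0 and
        \<open>Tk\<close> vanishes. Where it holds, \<open>lower\<close> and \<open>raise\<close>
        are inverse to each other, which transports the sum between \<open>arr\<close> and
        \<open>arrays\<close>.\<close>
      define ok where "ok = (\<lambda>(cols, Bs). \<forall>((s :: nat, r :: nat), B :: nat set)\<in>set (zip cols Bs). card B \<le> r)"
      have "(\<Sum>cols\<in>arr S e. \<Sum>Bs\<in>SP cols. (c cols * of_rat (Tk ks cols)) *\<^sub>R Q (raise cols Bs)) =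
        (\<Sum>(cols, Bs)\<in>(SIGMA cols:arr S e. SP cols). (c cols * of_rat (Tk ks cols)) *\<^sub>R Q (raise cols Bs))"
        by (simp add: sum.Sigma SP_def)
      also have "\<dots> = (\<Sum>(cols, Bs)\<in>{x \<in> (SIGMA cols:arrays S r. SP cols). ok x}.
          (c cols * of_rat (Tk ks (lower cols Bs))) *\<^sub>R Q cols)"
      proof (rule sum.reindex_bij_witness[of _ "\<lambda>(cols, Bs). (lower cols Bs, Bs)"
            "\<lambda>(cols, Bs). (raise cols Bs, Bs)"], goal_cases)
        case (1 x)
        then show ?case
          using lower_raise(3) seq_partitionsD(1,4) by (fastforce simp: SP_def)
      next
        case (2 x)
        then obtain cols Bs where x: "x = (cols, Bs)" "cols \<in> arr S e" "Bs \<in> SP cols" by auto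
        note Bs = seq_partitionsD[OF x(3)[unfolded SP_def]]
        have l: "length cols = length Bs" using Bs(1) by simp
        \<comment> \<open>The lower row of cols has sum length cols + (length ks - 2); the blocks
          add length js in total, and each column loses 1.\<close>
        have "sum_list (map snd (raise cols Bs)) = r"
          using lower_raise(6)[OF l Bs(4)] Bs(3) x(2) 3 l by (simp add: arr_def e_def r_def)
        moreover have "raise cols Bs \<noteq> []"
          using x(2) pos lower_raise(2)[OF l Bs(4)] by (auto simp: arr_def S_def simp del: sum_list_eq_0_iff)
        moreover have "0 < s \<and> 0 < n" if sn: "(s, n) \<in> set (raise cols Bs)" for s n
        proof -
          obtain l B where "((s, l), B) \<in> set (zip cols Bs)" "n = l + card B - 1"
            using sn by (auto simp: raise_def)
          moreover have "0 < s" "0 < l" "0 < card B"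
            using calculation(1) x(2) Bs(4) by (auto simp: arr_def dest: set_zip_leftD set_zip_rightD)
          ultimately show ?thesis by simp
        qed
        ultimately have "raise cols Bs \<in> arrays S r"
          using lower_raise(2)[OF l Bs(4)] x(2) l by (auto simp: arrays_def arr_def)
        moreover have "\<forall>(s, l)\<in>set cols. 0 < l" using x(2) by (auto simp: arr_def)
        with l have "ok (raise cols Bs, Bs)" unfolding ok_def split_conv raise_def
          by (induction cols Bs rule: list_induct2) auto
        ultimately show ?case using x lower_raise(2)[OF l Bs(4)] by (simp add: SP_def)
      next
        case (3 x)
        then show ?case
          using lower_raise(4) seq_partitionsD(1,4) by (fastforce simp: SP_def ok_def)
      next
        case (4 x)
        then obtain cols Bs where x: "x = (cols, Bs)" "cols \<in> arrays S r" "Bs \<in> SP cols" "ok (cols, Bs)" by auto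
        note Bs = seq_partitionsD[OF x(3)[unfolded SP_def]]
        have l: "length cols = length Bs" using Bs(1) by simp
        have "sum_list (map snd (lower cols Bs)) = length Bs + e"
          using lower_raise(5)[OF l Bs(4)] Bs(3) x(2,4) \<open>length ks \<ge> 2\<close> by (simp add: arrays_def e_def r_def ok_def)
        moreover have "0 < s \<and> 0 < n" if sn: "(s, n) \<in> set (lower cols Bs)" for s n
        proof -
          obtain l B where "((s, l), B) \<in> set (zip cols Bs)" "n = l + 1 - card B"
            using sn by (auto simp: lower_def)
          moreover have "0 < s" "card B \<le> l"
            using calculation(1) x(2,4) by (auto simp: arrays_def ok_def dest: set_zip_leftD)
          ultimately show ?thesis by simp
        qed
        moreover have "length (lower cols Bs) = length Bs" using l by (simp add: lower_def)
        ultimately have "lower cols Bs \<in> arr S e"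
          using lower_raise(1)[OF l Bs(4)] x(2) l by (auto simp: arrays_def arr_def)
        then show ?case using x lower_raise(1)[OF l Bs(4)] by (simp add: SP_def)
      next
        case (5 x)
        then obtain cols Bs where x: "x = (cols, Bs)" "Bs \<in> SP cols" by auto
        note Bs = seq_partitionsD[OF x(2)[unfolded SP_def]]
        have l: "length cols = length Bs" using Bs(1) by simp
        show ?case using lower_raise(2,3)[OF l Bs(4)] by (simp add: x c_def)
      qed
      also have "\<dots> = (\<Sum>(cols, Bs)\<in>(SIGMA cols:arrays S r. SP cols).
          (c cols * of_rat (Tk ks (lower cols Bs))) *\<^sub>R Q cols)"
      proof (rule sum.mono_neutral_left)
        show "\<forall>x\<in>(SIGMA cols:arrays S r. SP cols) - {x \<in> (SIGMA cols:arrays S r. SP cols). ok x}.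
          (case x of (cols, Bs) \<Rightarrow> (c cols * of_rat (Tk ks (lower cols Bs))) *\<^sub>R Q cols) = 0"
        proof
          fix x assume "x \<in> (SIGMA cols:arrays S r. SP cols) - {x \<in> (SIGMA cols:arrays S r. SP cols). ok x}"
          then obtain cols Bs where x: "x = (cols, Bs)" "\<not> ok (cols, Bs)" by auto
          then obtain s r B where B: "((s, r), B) \<in> set (zip cols Bs)" "r < card B"
            by (fastforce simp: ok_def)
          then have "(s, 0) \<in> set (lower cols Bs)"
            unfolding lower_def set_map by (intro image_eqI[of _ _ "((s, r), B)"]) auto
          then have "\<exists>c\<in>set (lower cols Bs). snd c = 0" by force
          then have "Tk ks (lower cols Bs) = 0" by (subst Tk.simps) simp
          then show "(case x of (cols, Bs) \<Rightarrow> (c cols * of_rat (Tk ks (lower cols Bs))) *\<^sub>R Q cols) = 0"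
            by (simp add: x)
        qed
      qed (auto simp: SP_def)
      also have "\<dots> = (\<Sum>cols\<in>arrays S r. \<Sum>Bs\<in>SP cols. (c cols * of_rat (Tk ks (lower cols Bs))) *\<^sub>R Q cols)"
        by (simp add: sum.Sigma SP_def)
      also have "\<dots> = (\<Sum>cols\<in>arrays S r. (of_rat (Ntilde ks js cols) :: real) *\<^sub>R Q cols)"
        by (simp add: Nt c_def of_rat_mult of_rat_divide of_rat_sum sum_distrib_left scaleR_sum_left)
      finally show ?thesis using True by (simp add: lhs Q_def S_def r_def)
    qed
  qed
qed

subsection \<open>Taylor expansion of the coefficients\<close>

lemma dt0_cong:
  assumes "open U" "t \<in> U" "\<And>t. t \<in> U \<Longrightarrow> g t = h t"
  shows "dt0 g t = dt0 h t"
  unfolding dt0_def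
  by (rule vector_derivative_cong_eq)
     (use assms in \<open>auto simp: eventually_nhds\<close>)

lemma dt0_pow_cong:
  assumes "open U" "t \<in> U" "\<And>t. t \<in> U \<Longrightarrow> g t = h t"
  shows "(dt0 ^^ n) g t = (dt0 ^^ n) h t"
  using assms(2)
proof (induction n arbitrary: t)
  case 0
  then show ?case using assms by simp
next
  case (Suc n)
  then show ?case using dt0_cong[OF assms(1), of t "(dt0 ^^ n) g" "(dt0 ^^ n) h"] by simp
qed

text \<open>Finite order is what the inductions need: \<open>dt0\<close> has an unspecified value
  where no derivative exists, so a formula for an iterated derivative has to be proved together with
  differentiability to the order reached, see \<open>cdiff_step\<close>.\<close>

definition cdiff :: "nat \<Rightarrow> real set \<Rightarrow> (real \<Rightarrow> complex) \<Rightarrow> bool" where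
  "cdiff n U g \<longleftrightarrow> (\<forall>k<n. \<forall>t\<in>U. (dt0 ^^ k) g differentiable (at t))"

lemma smooth_cdiff: "smooth_fun_on U g \<longleftrightarrow> (\<forall>n. cdiff n U g)"
  by (auto simp: smooth_fun_on_def cdiff_def)

lemma cdiff_mono: "cdiff n U g \<Longrightarrow> m \<le> n \<Longrightarrow> cdiff m U g"
  by (auto simp: cdiff_def)

lemma dt0_has_derivative:
  "cdiff n U g \<Longrightarrow> k < n \<Longrightarrow> t \<in> U \<Longrightarrow>
    ((dt0 ^^ k) g has_vector_derivative (dt0 ^^ Suc k) g t) (at t)"
  by (simp add: cdiff_def dt0_def vector_derivative_works)

lemma cdiff_cong:
  assumes "open U" "\<And>t. t \<in> U \<Longrightarrow> g t = h t" "cdiff n U g"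
  shows "cdiff n U h"
  unfolding cdiff_def
proof (intro allI impI ballI)
  fix k t assume k: "k < n" and t: "t \<in> U"
  have "((dt0 ^^ k) h has_vector_derivative (dt0 ^^ Suc k) g t) (at t)"
    by (rule has_vector_derivative_transform_within_open[OF dt0_has_derivative[OF assms(3) k t] assms(1) t])
       (rule dt0_pow_cong[OF assms(1) _ assms(2)])
  then show "(dt0 ^^ k) h differentiable (at t)"
    by (rule differentiableI_vector)
qed

lemma cdiff_step:
  assumes "open U" "cdiff n U g"
    and "\<And>t. t \<in> U \<Longrightarrow> (dt0 ^^ n) g t = G t"
    and "\<And>t. t \<in> U \<Longrightarrow> (G has_vector_derivative G' t) (at t)"
  shows "cdiff (Suc n) U g" "\<And>t. t \<in> U \<Longrightarrow> (dt0 ^^ Suc n) g t = G' t"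
proof -
  have *: "((dt0 ^^ n) g has_vector_derivative G' t) (at t)" if "t \<in> U" for t
    by (rule has_vector_derivative_transform_within_open[OF assms(4)[OF that] assms(1) that])
       (simp add: assms(3))
  show "(dt0 ^^ Suc n) g t = G' t" if "t \<in> U" for t
    using vector_derivative_at[OF *[OF that]] by (simp add: dt0_def)
  show "cdiff (Suc n) U g"
    using assms(2) * by (auto simp: cdiff_def less_Suc_eq intro: differentiableI_vector)
qed

context
  fixes U :: "real set" and g h :: "real \<Rightarrow> complex"
  assumes U: "open U"
begin

lemma dt0_pow_add:
  assumes "cdiff n U g" "cdiff n U h"
  shows "cdiff n U (\<lambda>t. g t + h t) \<and>
    (\<forall>t\<in>U. (dt0 ^^ n) (\<lambda>t. g t + h t) t = (dt0 ^^ n) g t + (dt0 ^^ n) h t)"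
  using assms
proof (induction n)
  case (Suc n)
  have p: "cdiff n U g" "cdiff n U h" using Suc.prems by (auto intro: cdiff_mono)
  have IH: "cdiff n U (\<lambda>t. g t + h t)"
      "\<And>t. t \<in> U \<Longrightarrow> (dt0 ^^ n) (\<lambda>t. g t + h t) t = (dt0 ^^ n) g t + (dt0 ^^ n) h t"
    using Suc.IH[OF p] by blast+
  have "((\<lambda>t. (dt0 ^^ n) g t + (dt0 ^^ n) h t) has_vector_derivative
      (dt0 ^^ Suc n) g t + (dt0 ^^ Suc n) h t) (at t)" if "t \<in> U" for t
    using Suc.prems that by (intro has_vector_derivative_add dt0_has_derivative) auto
  from cdiff_step[OF U IH this] show ?case by blast
qed (simp add: cdiff_def)

lemma dt0_pow_mult:
  assumes "cdiff n U g" "cdiff n U h"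
  shows "cdiff n U (\<lambda>t. g t * h t) \<and> (\<forall>t\<in>U. (dt0 ^^ n) (\<lambda>t. g t * h t) t =
    (\<Sum>k\<le>n. real (n choose k) *\<^sub>R ((dt0 ^^ k) g t * (dt0 ^^ (n - k)) h t)))"
  using assms
proof (induction n)
  case (Suc n)
  have p: "cdiff n U g" "cdiff n U h" using Suc.prems by (auto intro: cdiff_mono)
  have IH: "cdiff n U (\<lambda>t. g t * h t)"
      "\<And>t. t \<in> U \<Longrightarrow> (dt0 ^^ n) (\<lambda>t. g t * h t) t =
        (\<Sum>k\<le>n. real (n choose k) *\<^sub>R ((dt0 ^^ k) g t * (dt0 ^^ (n - k)) h t))"
    using Suc.IH[OF p] by blast+
  have "((\<lambda>t. \<Sum>k\<le>n. real (n choose k) *\<^sub>R ((dt0 ^^ k) g t * (dt0 ^^ (n - k)) h t)) has_vector_derivative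
      (\<Sum>k\<le>n. real (n choose k) *\<^sub>R ((dt0 ^^ Suc k) g t * (dt0 ^^ (n - k)) h t +
        (dt0 ^^ k) g t * (dt0 ^^ Suc (n - k)) h t))) (at t)" if "t \<in> U" for t
  proof (intro has_vector_derivative_sum)
    fix k assume k: "k \<in> {..n}"
    have "((dt0 ^^ k) g has_vector_derivative (dt0 ^^ Suc k) g t) (at t)"
      "((dt0 ^^ (n - k)) h has_vector_derivative (dt0 ^^ Suc (n - k)) h t) (at t)"
      using Suc.prems that k by (auto intro!: dt0_has_derivative simp del: funpow.simps)
    from has_vector_derivative_mult[OF this]
    show "((\<lambda>t. real (n choose k) *\<^sub>R ((dt0 ^^ k) g t * (dt0 ^^ (n - k)) h t)) has_vector_derivative
      real (n choose k) *\<^sub>R ((dt0 ^^ Suc k) g t * (dt0 ^^ (n - k)) h t +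
        (dt0 ^^ k) g t * (dt0 ^^ Suc (n - k)) h t)) (at t)"
      by (intro bounded_linear.has_vector_derivative[OF bounded_linear_scaleR_right]) (simp only: add.commute)
  qed
  from cdiff_step[OF U IH this]
  show ?case
    by (simp only: sum_binomial_Suc[of n "\<lambda>k m. (dt0 ^^ k) g _ * (dt0 ^^ m) h _"]) blast
qed (simp add: cdiff_def)

end

lemma dt0_pow_const: "(dt0 ^^ n) (\<lambda>_. c) t = (if n = 0 then c else 0)"
proof (induction n arbitrary: t)
  case (Suc n)
  have "(dt0 ^^ n) (\<lambda>_. c) = (\<lambda>_. if n = 0 then c else 0)" using Suc.IH by blast
  then have "(dt0 ^^ Suc n) (\<lambda>_. c) t = dt0 (\<lambda>_. if n = 0 then c else 0) t"
    by (simp only: funpow.simps comp_apply)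
  also have "\<dots> = 0" by (simp add: dt0_def)
  finally show ?case by (simp del: funpow.simps)
qed simp

lemma smooth_const: "smooth_fun_on U (\<lambda>_. c)"
proof -
  have "(dt0 ^^ n) (\<lambda>_. c) = (\<lambda>_. if n = 0 then c else 0)" for n using dt0_pow_const by blast
  then show ?thesis by (simp add: smooth_fun_on_def)
qed

lemma smooth_add:
  assumes "open U" "smooth_fun_on U g" "smooth_fun_on U h"
  shows "smooth_fun_on U (\<lambda>t. g t + h t)"
    and "t \<in> U \<Longrightarrow> (dt0 ^^ n) (\<lambda>t. g t + h t) t = (dt0 ^^ n) g t + (dt0 ^^ n) h t"
  using assms dt0_pow_add[OF assms(1)] by (auto simp: smooth_cdiff)

lemma smooth_mult:
  assumes "open U" "smooth_fun_on U g" "smooth_fun_on U h"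
  shows "smooth_fun_on U (\<lambda>t. g t * h t)"
    and "t \<in> U \<Longrightarrow> (dt0 ^^ n) (\<lambda>t. g t * h t) t =
      (\<Sum>k\<le>n. real (n choose k) *\<^sub>R ((dt0 ^^ k) g t * (dt0 ^^ (n - k)) h t))"
  using assms dt0_pow_mult[OF assms(1)] by (auto simp: smooth_cdiff)

lemma smooth_cmult:
  assumes "open U" "smooth_fun_on U g"
  shows "smooth_fun_on U (\<lambda>t. c * g t)"
    and "t \<in> U \<Longrightarrow> (dt0 ^^ n) (\<lambda>t. c * g t) t = c * (dt0 ^^ n) g t"
proof -
  show "smooth_fun_on U (\<lambda>t. c * g t)"
    using smooth_mult(1)[OF assms(1) smooth_const assms(2)] .
  assume "t \<in> U"
  from smooth_mult(2)[OF assms(1) smooth_const assms(2) this, of n c]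
  have "(dt0 ^^ n) (\<lambda>t. c * g t) t =
    (\<Sum>k\<le>n. real (n choose k) *\<^sub>R ((if k = 0 then c else 0) * (dt0 ^^ (n - k)) g t))"
    by (simp only: dt0_pow_const)
  also have "\<dots> = (\<Sum>k\<le>n. if k = 0 then c * (dt0 ^^ n) g t else 0)"
    by (rule sum.cong) auto
  finally show "(dt0 ^^ n) (\<lambda>t. c * g t) t = c * (dt0 ^^ n) g t" by simp
qed

lemma smooth_sum:
  assumes "open U" "\<And>x. x \<in> S \<Longrightarrow> smooth_fun_on U (g x)"
  shows "smooth_fun_on U (\<lambda>t. \<Sum>x\<in>S. g x t) \<and>
    (\<forall>t\<in>U. \<forall>n. (dt0 ^^ n) (\<lambda>t. \<Sum>x\<in>S. g x t) t = (\<Sum>x\<in>S. (dt0 ^^ n) (g x) t))"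
  using assms(2)
proof (induction S rule: infinite_finite_induct)
  case (insert x S)
  then have "smooth_fun_on U (g x)" "smooth_fun_on U (\<lambda>t. \<Sum>x\<in>S. g x t)" by auto
  from smooth_add[OF assms(1) this] show ?case using insert by simp
qed (simp_all add: smooth_const dt0_pow_const)

lemma smooth_cong:
  assumes "open U" "\<And>t. t \<in> U \<Longrightarrow> g t = h t" "smooth_fun_on U g"
  shows "smooth_fun_on U h"
  using assms cdiff_cong[OF assms(1), of g h] by (auto simp: smooth_cdiff)

lemma smooth_dt0: "smooth_fun_on U g \<Longrightarrow> smooth_fun_on U (dt0 g)"
  unfolding smooth_fun_on_def by (metis funpow_swap1 funpow.simps(2) comp_apply)

text \<open>Bootstrapping from y' = g' y: once y is differentiable to order n, so is the right side,
  and hence y to order n + 1.\<close>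

lemma smooth_exp:
  assumes "open U" "smooth_fun_on U g"
  shows "smooth_fun_on U (\<lambda>t. exp (g t))"
proof -
  define y where "y = (\<lambda>t. exp (g t))"
  have y': "(y has_vector_derivative dt0 g t * y t) (at t)" if "t \<in> U" for t
  proof -
    have "(g has_vector_derivative dt0 g t) (at t)"
      using dt0_has_derivative[of 1 U g 0 t] assms that by (simp add: smooth_cdiff)
    from field_vector_diff_chain_at[OF this DERIV_exp]
    show ?thesis by (simp add: y_def comp_def)
  qed
  have "cdiff n U y" for n
  proof (induction n)
    case (Suc n)
    have *: "dt0 y t = dt0 g t * y t" if "t \<in> U" for t
      using vector_derivative_at[OF y'[OF that]] by (simp add: dt0_def)
    have "cdiff n U (\<lambda>t. dt0 g t * y t)"
      using dt0_pow_mult[OF assms(1) _ Suc.IH, of "dt0 g"] smooth_dt0[OF assms(2)]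
      by (auto simp: smooth_cdiff)
    then have "cdiff n U (dt0 y)"
      by (rule cdiff_cong[OF assms(1), rotated]) (simp add: *)
    moreover have "y differentiable (at t)" if "t \<in> U" for t
      using y'[OF that] by (rule differentiableI_vector)
    ultimately show ?case
      unfolding cdiff_def by (auto simp: less_Suc_eq_0_disj funpow_Suc_right simp del: funpow.simps)
  qed (simp add: cdiff_def)
  then show ?thesis by (simp add: smooth_cdiff y_def)
qed

section \<open>Smoothness of the series in the hierarchy\<close>

definition smooth_series :: "real set \<Rightarrow> series \<Rightarrow> bool" where
  "smooth_series U a \<longleftrightarrow> (\<forall>M. smooth_fun_on U (a M))"

lemma smooth_smult:
  assumes "open U" "smooth_series U a" "smooth_series U b"
  shows "smooth_series U (a \<star> b)"
  unfolding smooth_series_def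
proof
  fix M
  have "smooth_fun_on U (\<lambda>t. \<Sum>A | A \<subseteq># M. a A t * b (M - A) t)"
    using assms by (intro conjunct1[OF smooth_sum] smooth_mult) (auto simp: smooth_series_def)
  then show "smooth_fun_on U ((a \<star> b) M)" by (simp add: smult_def[abs_def])
qed

lemma smooth_sone: "smooth_series U sone"
  by (simp add: smooth_series_def sone_def[abs_def] smooth_const)

lemma smooth_svar: "smooth_series U (svar w)"
  by (simp add: smooth_series_def svar_def[abs_def] smooth_const)

lemma smooth_spow: "open U \<Longrightarrow> smooth_series U a \<Longrightarrow> smooth_series U (spow a n)"
  by (induction n) (auto intro: smooth_smult smooth_sone)

lemma smooth_uminus:
  assumes "open U" "smooth_series U a"
  shows "smooth_series U (- a)"
  using smooth_cmult(1)[OF assms(1), where c = "-1"] assms(2)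
  by (simp add: smooth_series_def fun_Compl_def)

lemma smooth_plus:
  assumes "open U" "smooth_series U a" "smooth_series U b"
  shows "smooth_series U (a + b)"
  using smooth_add(1)[OF assms(1)] assms(2,3) by (simp add: smooth_series_def plus_fun_def)

lemma smooth_minus:
  assumes "open U" "smooth_series U a" "smooth_series U b"
  shows "smooth_series U (a - b)"
  using smooth_plus[OF assms(1,2) smooth_uminus[OF assms(1,3)]]
  by (simp add: plus_fun_def fun_Compl_def fun_diff_def)

lemma smooth_d0: "smooth_series U a \<Longrightarrow> smooth_series U (d0 a)"
  by (simp add: smooth_series_def d0_def smooth_dt0)

lemma smooth_dvar: "open U \<Longrightarrow> smooth_series U a \<Longrightarrow> smooth_series U (dvar v a)"
  by (simp add: smooth_series_def dvar_def[abs_def] smooth_cmult(1))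

text \<open>\<open>DD\<close> and \<open>DDb\<close> are the cases \<open>tv = T\<close> and \<open>tv = Tb\<close>.\<close>

definition sDD :: "(nat \<Rightarrow> var) \<Rightarrow> var \<Rightarrow> series \<Rightarrow> series" where
  "sDD tv w a M t = (\<Sum>k = 1..count M w. dvar (tv k) a (M - replicate_mset k w) t / of_nat k)"

lemma DD_eq_sDD: "DD = sDD T" "DDb = sDD Tb"
  by (simp_all add: fun_eq_iff DD_def DDb_def sDD_def)

lemma smooth_sDD:
  assumes "open U" "smooth_series U a"
  shows "smooth_series U (sDD tv w a)"
  unfolding smooth_series_def
proof
  fix M
  have "smooth_fun_on U (\<lambda>t. \<Sum>k = 1..count M w. (1 / of_nat k) * dvar (tv k) a (M - replicate_mset k w) t)"
    using smooth_dvar[OF assms]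
    by (intro conjunct1[OF smooth_sum[OF assms(1)]] smooth_cmult assms(1)) (auto simp: smooth_series_def)
  then show "smooth_fun_on U (sDD tv w a M)" by (simp add: sDD_def[abs_def])
qed

lemma smooth_sexp:
  assumes "open U" "smooth_series U a"
  shows "smooth_series U (sexp a)"
  unfolding smooth_series_def
proof
  fix M
  define c where "c = (\<lambda>M'. if M' = {#} then 0 else a M')"
  have "smooth_series U c"
    using assms(2) smooth_const[of U 0] by (auto simp: smooth_series_def c_def zero_fun_def)
  then have "smooth_fun_on U (spow c n M)" for n
    using smooth_spow[OF assms(1)] by (auto simp: smooth_series_def)
  then have "smooth_fun_on U (\<lambda>t. exp (a {#} t) * (\<Sum>n\<le>size M. (1 / fact n) * spow c n M t))"
    using assms by (intro smooth_mult smooth_exp conjunct1[OF smooth_sum] smooth_cmult)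
      (auto simp: smooth_series_def)
  then show "smooth_fun_on U (sexp a M)" by (simp add: sexp_def[abs_def] c_def)
qed

subsection \<open>The Taylor homomorphism\<close>

definition strip :: "'v option multiset \<Rightarrow> 'v multiset" where
  "strip N = image_mset the (filter_mset (\<lambda>v. v \<noteq> None) N)"

lemma strip_Some: "strip (image_mset Some M + replicate_mset n None) = M"
  by (simp add: strip_def filter_mset_image_mset image_mset.compositionality comp_def filter_mset_eq_conv)

lemma strip_decomp: "N = image_mset Some (strip N) + replicate_mset (count N None) None"
proof (induction N)
  case (add v N)
  then show ?case by (cases v) (auto simp: strip_def)
qed (simp add: strip_def)

lemma count_image_Some [simp]:
  "count (image_mset Some M) None = 0" "count (image_mset Some M) (Some v) = count M v"
  by (induction M) auto

text \<open>The variable \<open>None\<close> stands for the increment of \<open>t\<^sub>0\<close>.\<close>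

definition tay :: "real \<Rightarrow> series \<Rightarrow> var option mser" where
  "tay t a = Mser (\<lambda>N. (dt0 ^^ count N None) (a (strip N)) t / fact (count N None))"

lemma mcf_tay: "mcf (tay t a) (image_mset Some M + replicate_mset n None) = (dt0 ^^ n) (a M) t / fact n"
  by (simp add: tay_def strip_Some)

lemma tay_eqI:
  assumes "\<And>M n. mcf (tay t a) (image_mset Some M + replicate_mset n None) =
    mcf B (image_mset Some M + replicate_mset n None)"
  shows "tay t a = B"
  by (rule mser_eqI) (metis assms strip_decomp)

lemma sum_submsets_Some:
  "(\<Sum>A | A \<subseteq># image_mset Some M. g A) = (\<Sum>A | A \<subseteq># M. g (image_mset Some A))"
proof (rule sum.reindex_bij_witness[of _ "image_mset Some" "image_mset the"], goal_cases)
  case (1 A)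
  then show ?case by (auto simp: image_mset.compositionality comp_def intro!: multiset.map_ident_strong dest!: mset_subset_eqD)
next
  case (2 A)
  then show ?case using image_mset_subseteq_mono[of A "image_mset Some M" the] by (simp add: image_mset.compositionality comp_def)
next
  case (3 A)
  then show ?case by (simp add: image_mset.compositionality comp_def)
next
  case (4 A)
  then show ?case by (simp add: image_mset_subseteq_mono)
next
  case (5 A)
  then show ?case by (auto simp: image_mset.compositionality comp_def intro!: arg_cong[of _ _ g] multiset.map_ident_strong dest!: mset_subset_eqD)
qed

lemma tay_sone: "tay t sone = 1"
  by (rule tay_eqI) (auto simp: mcf_tay sone_def[abs_def] dt0_pow_const)

lemma tay_svar: "tay t (svar w) = mvar (Some w)"
proof (rule tay_eqI)
  fix M :: "var multiset" and n
  have "image_mset Some M + replicate_mset n None = {#Some w#} \<longleftrightarrow> M = {#w#} \<and> n = 0"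
  proof
    assume *: "image_mset Some M + replicate_mset n None = {#Some w#}"
    then have "n = 0" by (metis count_single count_union count_image_Some(1) count_replicate_mset add_0 option.distinct(1))
    moreover have "M = {#w#}" using strip_Some[of M n] unfolding * by (simp add: strip_def)
    ultimately show "M = {#w#} \<and> n = 0" by simp
  qed auto
  then show "mcf (tay t (svar w)) (image_mset Some M + replicate_mset n None) =
      mcf (mvar (Some w)) (image_mset Some M + replicate_mset n None)"
    unfolding mcf_tay by (auto simp: svar_def[abs_def] mvar_def dt0_pow_const)
qed

lemma tay_d0: "tay t (d0 a) = pd None (tay t a)"
proof (rule tay_eqI)
  fix M :: "var multiset" and n
  have "mcf (pd None (tay t a)) (image_mset Some M + replicate_mset n None) =
    of_nat (n + 1) * mcf (tay t a) (image_mset Some M + replicate_mset (Suc n) None)"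
    unfolding mcf_pd by simp
  then show "mcf (tay t (d0 a)) (image_mset Some M + replicate_mset n None) =
     mcf (pd None (tay t a)) (image_mset Some M + replicate_mset n None)"
    unfolding mcf_tay by (simp add: d0_def funpow_swap1 del: of_nat_Suc)
qed

context
  fixes U :: "real set" and t :: real
  assumes U: "open U" and t: "t \<in> U"
begin

lemma tay_cong: "series_eq_on U a b \<Longrightarrow> tay t a = tay t b"
  by (rule tay_eqI) (auto simp: mcf_tay series_eq_on_def intro!: dt0_pow_cong[OF U t])

text \<open>Since (n choose k) / n! = 1 / (k! (n - k)!), the Leibniz rule divided by n! is the
  Cauchy product in the variable \<open>None\<close>.\<close>

lemma tay_smult:
  assumes "smooth_series U a" "smooth_series U b"
  shows "tay t (a \<star> b) = tay t a * tay t b"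
proof (rule tay_eqI)
  fix M :: "var multiset" and n
  have ab: "smooth_fun_on U (a A)" "smooth_fun_on U (b A)" for A
    using assms by (auto simp: smooth_series_def)
  have diff: "image_mset Some M + replicate_mset n None - (image_mset Some A + replicate_mset k None) =
      image_mset Some (M - A) + replicate_mset (n - k) None" for A k
  proof (rule multiset_eqI)
    fix v
    show "count (image_mset Some M + replicate_mset n None - (image_mset Some A + replicate_mset k None)) v =
      count (image_mset Some (M - A) + replicate_mset (n - k) None) v"
      by (cases v) simp_all
  qed
  have "mcf (tay t a * tay t b) (image_mset Some M + replicate_mset n None) =
    (\<Sum>k\<le>n. \<Sum>A | A \<subseteq># M. (dt0 ^^ k) (a A) t / fact k * ((dt0 ^^ (n - k)) (b (M - A)) t / fact (n - k)))"
    unfolding mcf_mult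
    by (subst sum_submsets_replicate) (auto simp: sum_submsets_Some mcf_tay diff intro!: sum.cong)
  also have "\<dots> = (\<Sum>A | A \<subseteq># M. \<Sum>k\<le>n. (dt0 ^^ k) (a A) t / fact k * ((dt0 ^^ (n - k)) (b (M - A)) t / fact (n - k)))"
    by (rule sum.swap)
  also have "\<dots> = (\<Sum>A | A \<subseteq># M. (dt0 ^^ n) (\<lambda>t. a A t * b (M - A) t) t / fact n)"
    unfolding smooth_mult(2)[OF U ab t] sum_divide_distrib
    by (intro sum.cong refl) (simp add: binomial_fact scaleR_conv_of_real)
  also have "\<dots> = (dt0 ^^ n) ((a \<star> b) M) t / fact n"
    using smooth_sum[OF U, of "{A. A \<subseteq># M}" "\<lambda>A t. a A t * b (M - A) t"] smooth_mult(1)[OF U ab] t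
    by (simp add: smult_def[abs_def] sum_divide_distrib)
  finally show "mcf (tay t (a \<star> b)) (image_mset Some M + replicate_mset n None) =
      mcf (tay t a * tay t b) (image_mset Some M + replicate_mset n None)"
    by (simp add: mcf_tay)
qed

lemma tay_uminus:
  assumes "smooth_series U a"
  shows "tay t (- a) = - tay t a"
proof (rule tay_eqI)
  fix M :: "var multiset" and n
  show "mcf (tay t (- a)) (image_mset Some M + replicate_mset n None) =
      mcf (- tay t a) (image_mset Some M + replicate_mset n None)"
    using smooth_cmult(2)[OF U _ t, where c = "-1"] assms
    by (simp add: mcf_tay smooth_series_def fun_Compl_def)
qed

lemma tay_plus:
  assumes "smooth_series U a" "smooth_series U b"
  shows "tay t (a + b) = tay t a + tay t b"
proof (rule tay_eqI)
  fix M :: "var multiset" and n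
  show "mcf (tay t (a + b)) (image_mset Some M + replicate_mset n None) =
      mcf (tay t a + tay t b) (image_mset Some M + replicate_mset n None)"
    using smooth_add(2)[OF U _ _ t] assms
    by (simp add: mcf_tay smooth_series_def plus_fun_def add_divide_distrib)
qed

lemma tay_minus:
  assumes "smooth_series U a" "smooth_series U b"
  shows "tay t (a - b) = tay t a - tay t b"
proof -
  have "a - b = a + (- b)" by (simp add: fun_eq_iff)
  then show ?thesis
    using tay_plus[OF assms(1) smooth_uminus[OF U assms(2)]] tay_uminus[OF assms(2)] by simp
qed

lemma tay_dvar:
  assumes "smooth_series U a"
  shows "tay t (dvar v a) = pd (Some v) (tay t a)"
proof (rule tay_eqI)
  fix M :: "var multiset" and n
  have "mcf (pd (Some v) (tay t a)) (image_mset Some M + replicate_mset n None) =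
    of_nat (count M v + 1) * mcf (tay t a) (image_mset Some (add_mset v M) + replicate_mset n None)"
    unfolding mcf_pd by simp
  then show "mcf (tay t (dvar v a)) (image_mset Some M + replicate_mset n None) =
     mcf (pd (Some v) (tay t a)) (image_mset Some M + replicate_mset n None)"
    using smooth_cmult(2)[OF U _ t, of "a (add_mset v M)" n "of_nat (count M v + 1)"] assms
    unfolding mcf_tay by (simp add: dvar_def[abs_def] smooth_series_def)
qed

lemma tay_spow: "smooth_series U a \<Longrightarrow> tay t (spow a n) = tay t a ^ n"
  by (induction n) (simp_all add: tay_sone tay_smult smooth_spow U)

end

definition mDD :: "(nat \<Rightarrow> var) \<Rightarrow> var \<Rightarrow> var option mser \<Rightarrow> var option mser" where
  "mDD tv w a = Mser (\<lambda>N. \<Sum>k = 1..count N (Some w).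
     mcf (pd (Some (tv k)) a) (N - replicate_mset k (Some w)) / of_nat k)"

lemma tay_sDD:
  assumes U: "open U" and t: "t \<in> U" and a: "smooth_series U a"
  shows "tay t (sDD tv w a) = mDD tv w (tay t a)"
proof (rule tay_eqI)
  fix M :: "var multiset" and n
  have diff: "image_mset Some M + replicate_mset n None - replicate_mset k (Some w) =
      image_mset Some (M - replicate_mset k w) + replicate_mset n None" for k
  proof (rule multiset_eqI)
    fix v
    show "count (image_mset Some M + replicate_mset n None - replicate_mset k (Some w)) v =
      count (image_mset Some (M - replicate_mset k w) + replicate_mset n None) v"
      by (cases v) simp_all
  qed
  have s: "smooth_fun_on U (\<lambda>t. (1 / of_nat k) * dvar (tv k) a (M - replicate_mset k w) t)" for k
    using smooth_dvar[OF U a] by (intro smooth_cmult U) (auto simp: smooth_series_def)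
  have "mcf (mDD tv w (tay t a)) (image_mset Some M + replicate_mset n None) =
     (\<Sum>k = 1..count M w. (1 / of_nat k) * ((dt0 ^^ n) (dvar (tv k) a (M - replicate_mset k w)) t / fact n))"
    unfolding mDD_def mcf_Mser
    by (intro sum.cong)
       (auto simp: diff mcf_tay simp flip: tay_dvar[OF U t a])
  also have "\<dots> = (\<Sum>k = 1..count M w. (dt0 ^^ n) (\<lambda>t. (1 / of_nat k) * dvar (tv k) a (M - replicate_mset k w) t) t / fact n)"
    using smooth_dvar[OF U a] by (subst smooth_cmult(2)[OF U _ t]) (auto simp: smooth_series_def)
  also have "\<dots> = (dt0 ^^ n) (sDD tv w a M) t / fact n"
    using conjunct2[OF smooth_sum[OF U s, where S = "{1..count M w}"]] t
    by (simp add: sDD_def[abs_def] sum_divide_distrib)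
  finally show "mcf (tay t (sDD tv w a)) (image_mset Some M + replicate_mset n None) =
      mcf (mDD tv w (tay t a)) (image_mset Some M + replicate_mset n None)"
    by (simp add: mcf_tay)
qed

lemma spow_eq_0:
  assumes "c {#} = 0" "size M < n"
  shows "spow c n M = 0"
  using assms(2)
proof (induction n arbitrary: M)
  case (Suc n)
  have "c A t * spow c n (M - A) t = 0" if "A \<subseteq># M" for A t
  proof (cases "A = {#}")
    case False
    then have "size A > 0" by (simp add: nonempty_has_size)
    then have "size (M - A) < n" using that Suc.prems size_mset_mono[OF that]
      by (simp add: size_Diff_submset)
    then show ?thesis using Suc.IH by simp
  qed (simp add: assms(1))
  then show ?case by (intro ext) (auto simp: smult_def intro!: sum.neutral)
qed simp

text \<open>A constant term that vanishes on U makes the factor \<open>exp (a {#} t)\<close> equal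
  to 1, so the formal \<open>mexp\<close> suffices. This covers every exponential of the hierarchy
  except the one on the right of the third equation.\<close>

lemma tay_sexp:
  assumes U: "open U" and t: "t \<in> U" and a: "smooth_series U a"
    and a0: "\<And>t. t \<in> U \<Longrightarrow> a {#} t = 0"
  shows "tay t (sexp a) = mexp (tay t a)"
proof (rule tay_eqI)
  fix M :: "var multiset" and n
  define N where "N = image_mset Some M + replicate_mset n (None :: var option)"
  \<comment> \<open>The powers in \<open>sexp\<close> are those of \<open>c\<close>, which is known
    to agree with a only on U; their Taylor expansions at t nevertheless coincide.\<close>
  define c where "c = (\<lambda>M'. if M' = {#} then 0 else a M')"
  have c: "smooth_series U c"
    using a smooth_const[of U 0] by (auto simp: smooth_series_def c_def zero_fun_def)
  have ca: "tay t c = tay t a"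
    by (rule tay_cong[OF U t]) (auto simp: series_eq_on_def c_def a0)
  have p: "smooth_fun_on U (spow c m M)" for m
    using smooth_spow[OF U c] by (auto simp: smooth_series_def)
  have s: "smooth_fun_on U (\<lambda>t. (1 / fact m) * spow c m M t)" for m
    by (rule smooth_cmult(1)[OF U p])
  have pow: "mcf (tay t a ^ m) N = (dt0 ^^ n) (spow c m M) t / fact n" for m
    unfolding N_def mcf_tay[symmetric] tay_spow[OF U t c] ca ..
  have a00: "mcf (tay t a) {#} = 0"
    using mcf_tay[of t a "{#}" 0] a0[OF t] by simp
  have "mcf (mexp (tay t a)) N = (\<Sum>m\<le>size N. mcf (tay t a ^ m) N / fact m)"
    by (rule mcf_mexp[OF a00]) simp
  \<comment> \<open>\<open>size N\<close> also counts the n copies of \<open>None\<close>, while the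
    powers of \<open>c\<close> already vanish at M beyond \<open>size M\<close>.\<close>
  also have "\<dots> = (\<Sum>m\<le>size M. mcf (tay t a ^ m) N / fact m)"
  proof (rule sum.mono_neutral_right)
    show "\<forall>m\<in>{..size N} - {..size M}. mcf (tay t a ^ m) N / fact m = 0"
      using spow_eq_0[of c M] dt0_pow_const[of n 0 t] by (auto simp: pow c_def zero_fun_def)
  qed (auto simp: N_def)
  also have "\<dots> = (\<Sum>m\<le>size M. (dt0 ^^ n) (\<lambda>t. (1 / fact m) * spow c m M t) t / fact n)"
    by (subst smooth_cmult(2)[OF U p t]) (simp add: pow mult.commute)
  also have "\<dots> = (dt0 ^^ n) (\<lambda>t. \<Sum>m\<le>size M. (1 / fact m) * spow c m M t) t / fact n"
    using conjunct2[OF smooth_sum[OF U s, where S = "{..size M}"]] t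
    by (simp add: sum_divide_distrib)
  also have "(dt0 ^^ n) (\<lambda>t. \<Sum>m\<le>size M. (1 / fact m) * spow c m M t) t = (dt0 ^^ n) (sexp a M) t"
    by (rule dt0_pow_cong[OF U t]) (simp add: sexp_def a0 c_def)
  finally show "mcf (tay t (sexp a)) (image_mset Some M + replicate_mset n None) =
      mcf (mexp (tay t a)) (image_mset Some M + replicate_mset n None)"
    by (simp add: mcf_tay N_def)
qed

subsection \<open>The hierarchy as a system of equations between Taylor coefficients\<close>

text \<open>Independence of v. F contains no spectral parameters, and this is why extracting a power
  of w from \<open>mDD tv w\<close> applied to it yields exactly one derivative, see
  \<open>cf_mDD\<close>.\<close>

definition free :: "'v \<Rightarrow> 'v mser \<Rightarrow> bool" where
  "free v a \<longleftrightarrow> (\<forall>N. v \<in># N \<longrightarrow> mcf a N = 0)"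

lemma free_pd: "free v a \<Longrightarrow> free v (pd w a)"
  by (simp add: free_def mcf_pd)

lemma cf_pd:
  assumes "v \<noteq> x" "v \<noteq> y"
  shows "cf x y i j (pd v a) = pd v (cf x y i j a)"
  by (rule mser_eqI) (use assms in \<open>auto simp: mcf_cf mcf_pd\<close>)

lemma mcf_mDD_free:
  assumes "\<And>k. free (Some w) (pd (Some (tv k)) a)" "Some w \<notin># N"
  shows "mcf (mDD tv w a) (N + replicate_mset i (Some w)) =
    (if i \<ge> 1 then mcf (pd (Some (tv i)) a) N / of_nat i else 0)"
proof -
  have "mcf (pd (Some (tv k)) a) (N + replicate_mset i (Some w) - replicate_mset k (Some w)) =
      (if k = i then mcf (pd (Some (tv i)) a) N else 0)" if "k \<le> i" for k
  proof -
    have *: "N + replicate_mset i (Some w) - replicate_mset k (Some w) = N + replicate_mset (i - k) (Some w)"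
      using that by (simp add: multiset_eq_iff)
    show ?thesis
    proof (cases "k = i")
      case False
      then have "Some w \<in># N + replicate_mset (i - k) (Some w)" using that by simp
      then show ?thesis using assms(1)[of k] False by (simp add: * free_def)
    qed (simp add: *)
  qed
  then have "mcf (mDD tv w a) (N + replicate_mset i (Some w)) =
      (\<Sum>k = 1..i. if k = i then mcf (pd (Some (tv i)) a) N / of_nat i else 0)"
    unfolding mDD_def mcf_Mser using assms(2) by (intro sum.cong) (auto simp: not_in_iff)
  then show ?thesis by (simp add: sum.delta)
qed

lemma free_mDD:
  assumes "w \<noteq> w'" "\<And>k. free (Some w') (pd (Some (tv k)) a)"
  shows "free (Some w') (mDD tv w a)"
  unfolding free_def mDD_def mcf_Mser
  using assms by (auto simp: free_def intro!: sum.neutral) (metis count_diff count_greater_zero_iff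
      count_replicate_mset diff_zero option.inject)

lemma cf_mDD:
  assumes "w \<noteq> w'" "free (Some w) a" "free (Some w') a"
  shows "cf (Some w) (Some w') i j (mDD tv w a) =
    (if i \<ge> 1 \<and> j = 0 then (1 / real i) *\<^sub>R pd (Some (tv i)) a else 0)"
proof (rule mser_eqI)
  fix N
  let ?x = "Some w" and ?y = "Some w'"
  have fr: "free ?x (pd (Some (tv k)) a)" "free ?y (pd (Some (tv k)) a)" for k
    using assms by (auto intro: free_pd)
  have eq: "N + replicate_mset i ?x + replicate_mset j ?y = N + replicate_mset j ?y + replicate_mset i ?x"
    by (simp add: add_ac)
  show "mcf (cf ?x ?y i j (mDD tv w a)) N =
    mcf (if i \<ge> 1 \<and> j = 0 then (1 / real i) *\<^sub>R pd (Some (tv i)) a else 0) N"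
  proof (cases "?x \<in># N \<or> ?y \<in># N")
    case True
    then show ?thesis using fr by (auto simp: mcf_cf free_def)
  next
    case False
    have "mcf (cf ?x ?y i j (mDD tv w a)) N =
        (if i \<ge> 1 then mcf (pd (Some (tv i)) a) (N + replicate_mset j ?y) / of_nat i else 0)"
      unfolding mcf_cf eq using False assms(1) mcf_mDD_free[of w tv a "N + replicate_mset j ?y" i] fr(1)
      by auto
    also have "\<dots> = mcf (if i \<ge> 1 \<and> j = 0 then (1 / real i) *\<^sub>R pd (Some (tv i)) a else 0) N"
      using fr(2)[of i] by (auto simp: free_def scaleR_conv_of_real[where 'a=complex])
    finally show ?thesis .
  qed
qed

lemma cf_mDD_mDD:
  assumes "w \<noteq> w'" "free (Some w) a" "free (Some w') a" "\<And>k. tv k \<noteq> w" "\<And>k. tv k \<noteq> w'"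
  shows "cf (Some w) (Some w') i j (mDD tv w (mDD tv' w' a)) = (if i \<ge> 1 \<and> j \<ge> 1
    then (1 / (real i * real j)) *\<^sub>R pd (Some (tv i)) (pd (Some (tv' j)) a) else 0)"
proof (rule mser_eqI)
  fix N
  let ?x = "Some w" and ?y = "Some w'"
  have fr: "free ?x (pd (Some (tv' k)) a)" "free ?y (pd (Some (tv' k)) a)" for k
    using assms by (auto intro: free_pd)
  have fr': "free ?x (pd (Some (tv k)) (mDD tv' w' a))" for k
    by (rule free_pd, rule free_mDD) (use assms(1) fr in auto)
  have eq: "N + replicate_mset i ?x + replicate_mset j ?y = N + replicate_mset j ?y + replicate_mset i ?x"
    by (simp add: add_ac)
  show "mcf (cf ?x ?y i j (mDD tv w (mDD tv' w' a))) N = mcf (if i \<ge> 1 \<and> j \<ge> 1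
    then (1 / (real i * real j)) *\<^sub>R pd (Some (tv i)) (pd (Some (tv' j)) a) else 0) N"
  proof (cases "?x \<in># N \<or> ?y \<in># N")
    case True
    have "free ?x (pd (Some (tv i)) (pd (Some (tv' j)) a))" "free ?y (pd (Some (tv i)) (pd (Some (tv' j)) a))"
      using fr by (auto intro: free_pd)
    then show ?thesis using True by (auto simp: mcf_cf free_def)
  next
    case False
    have "mcf (cf ?x ?y i j (mDD tv w (mDD tv' w' a))) N =
        (if i \<ge> 1 then mcf (pd (Some (tv i)) (mDD tv' w' a)) (N + replicate_mset j ?y) / of_nat i else 0)"
      unfolding mcf_cf eq using False assms(1) mcf_mDD_free[of w tv "mDD tv' w' a" "N + replicate_mset j ?y" i] fr'
      by auto
    also have "mcf (pd (Some (tv i)) (mDD tv' w' a)) (N + replicate_mset j ?y) =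
        of_nat (count N (Some (tv i)) + 1) * mcf (mDD tv' w' a) (add_mset (Some (tv i)) N + replicate_mset j ?y)"
      using assms(5)[of i] by (simp add: mcf_pd)
    also have "mcf (mDD tv' w' a) (add_mset (Some (tv i)) N + replicate_mset j ?y) =
        (if j \<ge> 1 then mcf (pd (Some (tv' j)) a) (add_mset (Some (tv i)) N) / of_nat j else 0)"
      using fr(2) False assms(5)[of i] by (intro mcf_mDD_free) auto
    finally show ?thesis by (simp add: mcf_pd scaleR_conv_of_real[where 'a=complex])
  qed
qed

lemma mDD_empty: "mcf (mDD tv w a) {#} = 0"
  by (simp add: mDD_def)

lemma sDD_empty: "sDD tv w a {#} = (\<lambda>t. 0)"
  by (simp add: sDD_def fun_eq_iff)

text \<open>Taylor expansion turns the hypothesis into that of \<open>log_equation\<close> with u_p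
  = (1/p) d0 D_p F. The first equation of the hierarchy is the case \<open>tv = T\<close>, the
  second the case \<open>tv = Tb\<close>.\<close>

lemma hierarchy_log:
  assumes U: "open U" and t: "t \<in> U" and F: "smooth_series U F"
    and w: "w \<noteq> w'" and fr: "free (Some w) (tay t F)" "free (Some w') (tay t F)"
    and tv: "\<And>k. tv k \<noteq> w" "\<And>k. tv k \<noteq> w'"
    and eq: "series_eq_on U ((svar w' - svar w) \<star> sexp (sDD tv w (sDD tv w' F)))
       (svar w' \<star> sexp (- d0 (sDD tv w F)) - svar w \<star> sexp (- d0 (sDD tv w' F)))"
    and ij: "i \<ge> 1" "j \<ge> 1"
  shows "pd (Some (tv i)) (pd (Some (tv j)) (tay t F)) = (real i * real j) *\<^sub>R
    (\<Sum>ps\<in>comps (i + j). (of_rat (T2 i j ps) :: real) *\<^sub>R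
      (\<Prod>p\<leftarrow>ps. (1 / real p) *\<^sub>R pd None (pd (Some (tv p)) (tay t F))))"
proof -
  define W A B where "W = mDD tv w (mDD tv w' (tay t F))" and "A = - pd None (mDD tv w (tay t F))"
    and "B = - pd None (mDD tv w' (tay t F))"
  note sm = smooth_svar smooth_sDD[OF U] smooth_d0 smooth_plus[OF U] smooth_minus[OF U] smooth_uminus[OF U] smooth_sexp[OF U] smooth_smult[OF U] F
  have texp: "tay t (sexp (- d0 (sDD tv v F))) = mexp (- pd None (mDD tv v (tay t F)))" for v
  proof -
    have "(- d0 (sDD tv v F)) {#} t = 0" for t
      using dt0_pow_const[of 1 0] by (simp add: d0_def sDD_empty)
    then show ?thesis
      using tay_sexp[OF U t, of "- d0 (sDD tv v F)"]
      by (simp only: tay_uminus[OF U t] tay_d0 tay_sDD[OF U t] sm simp_thms)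
  qed
  have "tay t ((svar w' - svar w) \<star> sexp (sDD tv w (sDD tv w' F))) =
      tay t (svar w' \<star> sexp (- d0 (sDD tv w F)) - svar w \<star> sexp (- d0 (sDD tv w' F)))"
    by (rule tay_cong[OF U t eq])
  then have "(mvar (Some w') - mvar (Some w)) * mexp W =
      mvar (Some w') * mexp A - mvar (Some w) * mexp B"
    by (simp add: tay_smult[OF U t] tay_minus[OF U t] tay_uminus[OF U t] tay_svar tay_sexp[OF U t]
        tay_sDD[OF U t] texp sm sDD_empty W_def A_def B_def)
  then have "cf (Some w) (Some w') i j W = (\<Sum>ps\<in>comps (i + j). (of_rat (T2 i j ps) :: real) *\<^sub>R
      (\<Prod>p\<leftarrow>ps. (1 / real p) *\<^sub>R pd None (pd (Some (tv p)) (tay t F))))"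
  proof (intro log_equation[where A = A and B = B])
    show "mcf W {#} = 0" by (simp add: W_def mDD_empty)
    have z: "mcf (pd None (mDD tv v (tay t F))) {#} = 0" for v
      by (simp add: mcf_pd mDD_def)
    show "mcf A {#} = 0" "mcf B {#} = 0" by (simp_all add: A_def B_def z)
    show "cf (Some w) (Some w') i j A =
      (if i \<ge> 1 \<and> j = 0 then - ((1 / real i) *\<^sub>R pd None (pd (Some (tv i)) (tay t F))) else 0)" for i j
      using w fr by (simp add: A_def cf_pd cf_mDD pd_linear) (simp add: mser_eqI mcf_pd)
    show "cf (Some w') (Some w) i j B =
      (if i \<ge> 1 \<and> j = 0 then - ((1 / real i) *\<^sub>R pd None (pd (Some (tv i)) (tay t F))) else 0)" for i j
      using w fr by (simp add: B_def cf_pd cf_mDD pd_linear) (simp add: mser_eqI mcf_pd)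
  qed (use w ij in auto)
  moreover have "cf (Some w) (Some w') i j W =
      (1 / (real i * real j)) *\<^sub>R pd (Some (tv i)) (pd (Some (tv j)) (tay t F))"
    using w fr tv ij by (simp add: W_def cf_mDD_mDD)
  ultimately have "(real i * real j) *\<^sub>R (1 / (real i * real j)) *\<^sub>R
      pd (Some (tv i)) (pd (Some (tv j)) (tay t F)) = (real i * real j) *\<^sub>R
    (\<Sum>ps\<in>comps (i + j). (of_rat (T2 i j ps) :: real) *\<^sub>R
      (\<Prod>p\<leftarrow>ps. (1 / real p) *\<^sub>R pd None (pd (Some (tv p)) (tay t F))))"
    by (simp only:)
  then show ?thesis using ij by simp
qed

text \<open>The restriction to t_k = 0 of both kinds. The spectral parameters are set to 0 as well,
  so only powers of \<open>None\<close> remain.\<close>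

definition rho :: "var option mser \<Rightarrow> var option mser" where
  "rho a = Mser (\<lambda>N. if set_mset N \<subseteq> {None} then mcf a N else 0)"

lemma mcf_rho: "mcf (rho a) N = (if set_mset N \<subseteq> {None} then mcf a N else 0)"
  by (simp add: rho_def)

lemma rho_hom:
  "rho (a + b) = rho a + rho b" "rho (r *\<^sub>R a) = r *\<^sub>R rho a" "rho (a * b) = rho a * rho b"
  "rho 1 = 1" "rho (pd None a) = pd None (rho a)" "rho 0 = 0" "rho (- a) = - rho a"
proof -
  show "rho (a * b) = rho a * rho b"
  proof (rule mser_eqI)
    fix N
    show "mcf (rho (a * b)) N = mcf (rho a * rho b) N"
    proof (cases "set_mset N \<subseteq> {None}")
      case True
      have "set_mset A \<subseteq> {None} \<and> set_mset (N - A) \<subseteq> {None}" if "A \<subseteq># N" for A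
        using set_mset_mono[OF that] True in_diffD[of _ N A] by blast
      then show ?thesis unfolding mcf_rho mcf_mult using True by (auto intro!: sum.cong)
    next
      case False
      have "\<not> (set_mset A \<subseteq> {None} \<and> set_mset (N - A) \<subseteq> {None})" if "A \<subseteq># N" for A
      proof
        assume "set_mset A \<subseteq> {None} \<and> set_mset (N - A) \<subseteq> {None}"
        then have "set_mset (A + (N - A)) \<subseteq> {None}" by (simp only: set_mset_union Un_subset_iff)
        then show False using False that by simp
      qed
      then show ?thesis unfolding mcf_mult using False by (auto simp: mcf_rho intro!: sum.neutral)
    qed
  qed
qed (rule mser_eqI; simp add: mcf_rho mcf_pd)+

lemma rho_sum_prod: "rho (sum f S) = (\<Sum>x\<in>S. rho (f x))" "rho (prod_list xs) = prod_list (map rho xs)"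
proof -
  show "rho (sum f S) = (\<Sum>x\<in>S. rho (f x))"
    by (induction S rule: infinite_finite_induct) (simp_all add: rho_hom)
  show "rho (prod_list xs) = prod_list (map rho xs)"
    by (induction xs) (simp_all add: rho_hom)
qed

text \<open>This is the coefficient of x^i y^j in (c x y)^k. Restricted, the right side of the third
  equation has the form c x y with c = f.\<close>

lemma sum_cells_diagonal:
  fixes c :: "'a :: comm_ring_1"
  shows "(\<Sum>ps\<in>cells k i j. \<Prod>(p, q)\<leftarrow>ps. if p = 1 \<and> q = 1 then c else 0) =
    (if i = k \<and> j = k then c ^ k else 0)"
proof -
  have z: "(\<Prod>(p, q)\<leftarrow>ps. if p = 1 \<and> q = 1 then c else 0) = 0"
    if "ps \<in> cells k i j" "ps \<noteq> replicate k (1, 1)" for ps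
  proof -
    have "\<exists>pq\<in>set ps. pq \<noteq> (1, 1)"
      using that replicate_eqI[of ps k "(1, 1)"] by (auto simp: cells_def)
    then show ?thesis by (intro prod_list_eq_0) force
  qed
  have r: "replicate k (1, 1) \<in> cells k i j \<longleftrightarrow> i = k \<and> j = k"
    by (auto simp: cells_def sum_list_replicate)
  have "(\<Prod>(p, q)\<leftarrow>ps. if p = 1 \<and> q = 1 then c else 0) = (if ps = replicate k (1, 1) then c ^ k else 0)"
    if "ps \<in> cells k i j" for ps
    using z[OF that] by (cases "ps = replicate k (1, 1)") (simp_all add: prod_list_replicate)
  then have "(\<Sum>ps\<in>cells k i j. \<Prod>(p, q)\<leftarrow>ps. if p = 1 \<and> q = 1 then c else 0) =
      (\<Sum>ps\<in>cells k i j. if ps = replicate k (1, 1) then c ^ k else 0)"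
    by (rule sum.cong[OF refl])
  then show ?thesis using r by (simp add: sum.delta)
qed

section \<open>Factorials of monomials and iterated derivatives\<close>

definition mfact :: "'v multiset \<Rightarrow> nat" where
  "mfact M = (\<Prod>v\<in>set_mset M. fact (count M v))"

lemma mfact_add_mset: "mfact (add_mset v M) = (count M v + 1) * mfact M"
proof -
  have *: "mfact N = fact (count N v) * (\<Prod>w\<in>set_mset M - {v}. fact (count N w))"
    if "set_mset N \<subseteq> insert v (set_mset M)" for N
  proof -
    have "mfact N = (\<Prod>w\<in>insert v (set_mset M). fact (count N w))"
      unfolding mfact_def using that by (intro prod.mono_neutral_left) (auto simp: not_in_iff)
    then show ?thesis by (simp add: prod.insert_remove)
  qed
  have "(\<Prod>w\<in>set_mset M - {v}. fact (count (add_mset v M) w)) =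
      (\<Prod>w\<in>set_mset M - {v}. fact (count M w) :: nat)"
    by (rule prod.cong) auto
  then show ?thesis
    using *[of M] *[of "add_mset v M"] by (simp add: subset_insertI algebra_simps)
qed

text \<open>Each \<open>pd v\<close> contributes the multiplicity of v plus 1, and these factors
  telescope to a quotient of factorials of monomials. For M = \<open>{#}\<close> and the variables
  of two diagrams this is the product of their \<open>sigma\<close>, the denominator of
  \<open>NN\<close>.\<close>

lemma mcf_fold_pd:
  "mcf (fold pd vs a) M * of_nat (mfact M) = of_nat (mfact (M + mset vs)) * mcf a (M + mset vs)"
proof (induction vs arbitrary: a)
  case (Cons v vs)
  then show ?case by (simp add: mfact_add_mset mcf_pd algebra_simps)
qed simp

lemma mfact_image: "inj g \<Longrightarrow> mfact (image_mset g M) = mfact M"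
proof -
  assume g: "inj g"
  have "count (image_mset g M) (g v) = count M v" for v
    using g by (induction M) (auto simp: inj_def)
  then show ?thesis using g by (simp add: mfact_def prod.reindex inj_on_def inj_def)
qed

lemma mfact_plus:
  assumes "set_mset A \<inter> set_mset B = {}"
  shows "mfact (A + B) = mfact A * mfact B"
proof -
  have "mfact (A + B) = (\<Prod>v\<in>set_mset A. fact (count (A + B) v)) * (\<Prod>v\<in>set_mset B. fact (count (A + B) v))"
    unfolding mfact_def set_mset_union using assms by (intro prod.union_disjoint) auto
  also have "(\<Prod>v\<in>set_mset A. fact (count (A + B) v)) = mfact A"
    unfolding mfact_def using assms by (intro prod.cong refl) (simp, metis disjoint_iff not_in_iff add_0 add.commute)
  also have "(\<Prod>v\<in>set_mset B. fact (count (A + B) v)) = mfact B"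
    unfolding mfact_def using assms by (intro prod.cong refl) (simp, metis disjoint_iff not_in_iff add_0 add.commute)
  finally show ?thesis .
qed

lemma mfact_mset: "mfact (mset xs) = sigma xs"
  by (simp add: mfact_def sigma_def count_mset)

section \<open>Symmetric solutions and the third equation\<close>

definition ffun :: "series \<Rightarrow> real \<Rightarrow> complex" where
  "ffun F t = exp ((dt0 ^^ 2) (F {#}) t)"

definition fser :: "series \<Rightarrow> series" where
  "fser F M = (if M = {#} then ffun F else (\<lambda>_. 0))"

context
  fixes U :: "real set" and F :: series
  assumes U: "open U" and sym: "symmetric_solution U F"
begin

lemma F_eq_0: "v \<in># M \<Longrightarrow> v \<notin> range T \<union> range Tb \<Longrightarrow> t \<in> U \<Longrightarrow> F M t = 0"
proof -
  assume v: "v \<in># M" "v \<notin> range T \<union> range Tb" and t: "t \<in> U"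
  have "\<nexists>\<Delta> \<Delta>b. young \<Delta> \<and> young \<Delta>b \<and> M = tmon \<Delta> \<Delta>b"
    using v by (auto simp: tmon_def)
  then show "F M t = 0"
    using sym t by (auto simp: symmetric_solution_def formal_solution_def toda_series_def)
qed

lemma F_smooth: "smooth_series U F"
  unfolding smooth_series_def
proof
  fix M
  show "smooth_fun_on U (F M)"
  proof (cases "\<exists>\<Delta> \<Delta>b. young \<Delta> \<and> young \<Delta>b \<and> M = tmon \<Delta> \<Delta>b")
    case True
    then show ?thesis
      using sym by (auto simp: symmetric_solution_def formal_solution_def toda_series_def)
  next
    case False
    then have "F M t = 0" if "t \<in> U" for t
      using sym that by (simp add: symmetric_solution_def formal_solution_def toda_series_def)
    then show ?thesis
      using smooth_cong[OF U, of "\<lambda>_. 0" "F M"] smooth_const by simp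
  qed
qed

lemma F_single: "k \<ge> 1 \<Longrightarrow> t \<in> U \<Longrightarrow> F {#T k#} t = 0" "k \<ge> 1 \<Longrightarrow> t \<in> U \<Longrightarrow> F {#Tb k#} t = 0"
  using sym by (simp_all add: symmetric_solution_def restr_def dvar_def)

lemma hierarchy: "toda_hierarchy U F"
  using sym by (simp add: symmetric_solution_def formal_solution_def)

text \<open>Once the k copies of w are removed, either nothing is left and a coefficient of first
  order vanishes by symmetry, or a spectral parameter is left and F contains none.\<close>

lemma sDD_eq_0:
  assumes "tv = T \<or> tv = Tb" "set_mset M \<subseteq> {Zinv, Xbinv}" "t \<in> U"
  shows "sDD tv w F M t = 0"
  unfolding sDD_def
proof (rule sum.neutral, rule ballI)
  fix k assume k: "k \<in> {1..count M w}"
  let ?M = "M - replicate_mset k w"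
  have "F (add_mset (tv k) ?M) t = 0"
  proof (cases "?M = {#}")
    case True
    then show ?thesis using F_single[of k t] assms k by auto
  next
    case False
    then obtain v where v: "v \<in># ?M" by blast
    then have "v \<in> {Zinv, Xbinv}" using assms(2) in_diffD by fastforce
    then show ?thesis using v assms(3) by (intro F_eq_0[of v]) auto
  qed
  then show "dvar (tv k) F ?M t / of_nat k = 0" by (simp add: dvar_def)
qed

lemma sexp_third:
  assumes "set_mset M \<subseteq> {Zinv, Xbinv}" "t \<in> U"
  shows "sexp (d0 (d0 F + sDD T Zinv F + sDD Tb Xbinv F)) M t = (if M = {#} then ffun F t else 0)"
proof -
  define R where "R = d0 (d0 F + sDD T Zinv F + sDD Tb Xbinv F)"
  have R0: "R {#} = (dt0 ^^ 2) (F {#})"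
    by (simp add: R_def d0_def sDD_empty numeral_2_eq_2 plus_fun_def)
  have R: "R M' t = 0" if sub: "M' \<subseteq># M" and ne: "M' \<noteq> {#}" for M'
  proof -
    have M': "set_mset M' \<subseteq> {Zinv, Xbinv}" using sub assms(1) set_mset_mono by blast
    obtain v where v: "v \<in># M'" using ne by blast
    then have nv: "v \<notin> range T \<union> range Tb" using M' by auto
    have "(d0 F + sDD T Zinv F + sDD Tb Xbinv F) M' t = 0" if t: "t \<in> U" for t
    proof -
      have "d0 F M' t = dt0 (\<lambda>_. 0) t"
        unfolding d0_def by (rule dt0_cong[OF U t]) (rule F_eq_0[OF v nv])
      then show ?thesis
        using dt0_pow_const[of 1 0 t] sDD_eq_0[OF _ M' t] by simp
    qed
    then have "R M' t = dt0 (\<lambda>_. 0) t"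
      unfolding R_def d0_def[of "_ + _"] by (intro dt0_cong[OF U assms(2)])
    then show ?thesis using dt0_pow_const[of 1 0 t] by simp
  qed
  define c where "c = (\<lambda>M'. if M' = {#} then 0 else R M')"
  have c: "spow c n M t = (if n = 0 \<and> M = {#} then 1 else 0)" for n
  proof (cases n)
    case 0
    then show ?thesis by (simp add: sone_def)
  next
    case (Suc m)
    have "c A t * spow c m (M - A) t = 0" if "A \<subseteq># M" for A
      using R[OF that] by (simp add: c_def)
    then show ?thesis by (auto simp: Suc smult_def intro!: sum.neutral)
  qed
  have "sexp R M t = exp (R {#} t) * (\<Sum>n\<le>size M. spow c n M t / fact n)"
    by (simp add: sexp_def c_def)
  also have "(\<Sum>n\<le>size M. spow c n M t / fact n) = (\<Sum>n\<le>size M. if n = 0 then (if M = {#} then 1 else 0) else 0)"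
    by (rule sum.cong) (auto simp: c)
  finally show ?thesis by (simp add: R_def[symmetric] R0 ffun_def)
qed

lemma ffun_smooth: "smooth_fun_on U (ffun F)"
proof -
  have "smooth_fun_on U ((dt0 ^^ 2) (F {#}))"
    using F_smooth by (simp add: smooth_series_def smooth_dt0 numeral_2_eq_2)
  from smooth_exp[OF U this] show ?thesis by (simp add: ffun_def[abs_def])
qed

lemma fser_smooth: "smooth_series U (fser F)"
  by (simp add: smooth_series_def fser_def ffun_smooth smooth_const)

lemma mcf_d0_pow:
  assumes "t \<in> U"
  shows "mcf ((pd None ^^ r) (tay t (fser F) ^ s)) {#} = (dt0 ^^ r) (\<lambda>t. ffun F t ^ s) t"
proof -
  have "(pd None ^^ r) (tay t a) = tay t ((d0 ^^ r) a)" for a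
    by (induction r) (simp_all add: tay_d0)
  moreover have "(d0 ^^ r) a {#} = (dt0 ^^ r) (a {#})" for a
    by (induction r) (simp_all add: d0_def)
  moreover have "spow (fser F) s {#} = (\<lambda>t. ffun F t ^ s)"
    by (induction s) (auto simp: sone_def smult_def fser_def fun_eq_iff)
  ultimately show ?thesis
    using mcf_tay[of t "(d0 ^^ r) (spow (fser F) s)" "{#}" 0]
    by (simp add: tay_spow[OF U assms fser_smooth, symmetric])
qed

lemma F_free: "w \<notin> range T \<union> range Tb \<Longrightarrow> t \<in> U \<Longrightarrow> free (Some w) (tay t F)"
  unfolding free_def
proof (intro allI impI)
  fix N assume w: "w \<notin> range T \<union> range Tb" and t: "t \<in> U" and N: "Some w \<in># N"
  have "w \<in># strip N" using N by (force simp: strip_def)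
  then have "(dt0 ^^ n) (F (strip N)) t = (dt0 ^^ n) (\<lambda>_. 0) t" for n
    by (intro dt0_pow_cong[OF U t] F_eq_0[OF _ w])
  then show "mcf (tay t F) N = 0" by (simp add: tay_def dt0_pow_const)
qed

lemma None_only: "set_mset N \<subseteq> {None} \<Longrightarrow> N = replicate_mset (count N None) None"
  by (rule multiset_eqI) (metis count_replicate_mset insertE not_in_iff singletonD subsetD)

lemma rho_third:
  assumes t: "t \<in> U"
  shows "rho (cf (Some Zinv) (Some Xbinv) p q (tay t (sexp (d0 (d0 F + sDD T Zinv F + sDD Tb Xbinv F))))) =
    (if p = 0 \<and> q = 0 then tay t (fser F) else 0)"
proof (rule mser_eqI)
  fix N
  define S where "S = sexp (d0 (d0 F + sDD T Zinv F + sDD Tb Xbinv F))"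
  show "mcf (rho (cf (Some Zinv) (Some Xbinv) p q (tay t S))) N =
    mcf (if p = 0 \<and> q = 0 then tay t (fser F) else 0) N"
  proof (cases "set_mset N \<subseteq> {None}")
    case True
    define n where "n = count N None"
    have N: "N = replicate_mset n None" unfolding n_def by (rule None_only[OF True])
    define M where "M = replicate_mset p Zinv + replicate_mset q Xbinv"
    have NM: "N + replicate_mset p (Some Zinv) + replicate_mset q (Some Xbinv) =
        image_mset Some M + replicate_mset n None"
      by (simp add: N M_def add_ac)
    have "mcf (rho (cf (Some Zinv) (Some Xbinv) p q (tay t S))) N = (dt0 ^^ n) (S M) t / fact n"
      using True unfolding mcf_rho mcf_cf NM mcf_tay by auto
    also have "(dt0 ^^ n) (S M) t = (dt0 ^^ n) (fser F M) t"
      unfolding S_def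
    proof (rule dt0_pow_cong[OF U t])
      fix t assume "t \<in> U"
      have "set_mset M \<subseteq> {Zinv, Xbinv}" by (auto simp: M_def)
      from sexp_third[OF this \<open>t \<in> U\<close>]
      show "sexp (d0 (d0 F + sDD T Zinv F + sDD Tb Xbinv F)) M t = fser F M t"
        by (simp add: fser_def)
    qed
    also have "\<dots> / fact n = mcf (if p = 0 \<and> q = 0 then tay t (fser F) else 0) N"
      using mcf_tay[of t "fser F" "{#}" n] by (auto simp: N M_def fser_def dt0_pow_const)
    finally show ?thesis .
  next
    case False
    then obtain x where "x \<in># N" "x \<noteq> None" by blast
    then obtain v where v: "Some v \<in># N" by auto
    then have "v \<in># strip N" by (force simp: strip_def)
    then have "strip N \<noteq> {#}" by auto
    then show ?thesis using False by (simp add: mcf_rho tay_def fser_def dt0_pow_const)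
  qed
qed

text \<open>With x and y the two inverse spectral parameters and W the negative of the mixed
  derivative of F, the third equation restricts to 1 - e^W = f x y, so that -W becomes the sum of (f
  x y)^k / k. The operators contribute 1/(i j), which leaves i f^i for i = j. As \<open>rho\<close>
  also sends x and y to 0, it is applied to the coefficients \<open>cf\<close> and not to the
  series.\<close>

lemma rho_D_Db_F:
  assumes t: "t \<in> U" and ij: "i \<ge> 1" "j \<ge> 1"
  shows "rho (pd (Some (T i)) (pd (Some (Tb j)) (tay t F))) =
    (if i = j then real i *\<^sub>R tay t (fser F) ^ i else 0)"
proof -
  define W where "W = - mDD T Zinv (mDD Tb Xbinv (tay t F))"
  define S where "S = sexp (d0 (d0 F + sDD T Zinv F + sDD Tb Xbinv F))"
  let ?x = "Some Zinv" and ?y = "Some Xbinv"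
  note sm = smooth_svar smooth_sone smooth_sDD[OF U] smooth_d0 smooth_plus[OF U] smooth_minus[OF U] smooth_uminus[OF U] smooth_sexp[OF U]
    smooth_smult[OF U] F_smooth
  have S: "smooth_series U S" by (simp add: S_def sm)
  have eq: "series_eq_on U (sone - sexp (- sDD T Zinv (sDD Tb Xbinv F))) (svar Zinv \<star> svar Xbinv \<star> S)"
    using hierarchy by (simp add: toda_hierarchy_def DD_eq_sDD S_def)
  have "1 - mexp W = mvar ?x * mvar ?y * tay t S"
    using tay_cong[OF U t eq]
    by (simp add: tay_smult[OF U t] tay_minus[OF U t] tay_uminus[OF U t] tay_svar tay_sone tay_sexp[OF U t]
        tay_sDD[OF U t] sm sDD_empty W_def S)
  then have X: "1 - mexp W = mvar ?x * (mvar ?y * tay t S)" by (simp add: mult.assoc)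
  have cX: "cf ?x ?y p q (1 - mexp W) = (if p = 0 \<or> q = 0 then 0 else cf ?x ?y (p - 1) (q - 1) (tay t S))" for p q
    unfolding X by (simp add: cf_mvar_mult)
  have rX: "rho (cf ?x ?y p q (1 - mexp W)) = (if p = 1 \<and> q = 1 then tay t (fser F) else 0)" for p q
    unfolding cX S_def using rho_third[OF t, of "p - 1" "q - 1"] by (auto simp: rho_hom)
  have W0: "mcf W {#} = 0" by (simp add: W_def mDD_empty)
  have "cf ?x ?y i j W = - (\<Sum>k=1..i. (1 / real k) *\<^sub>R
      (\<Sum>ps\<in>cells k i j. \<Prod>(p, q)\<leftarrow>ps. cf ?x ?y p q (1 - mexp W)))"
    by (rule cf_log[OF _ W0]) (simp_all add: cX del: cf_linear)
  then have "rho (cf ?x ?y i j W) = - (\<Sum>k=1..i. (1 / real k) *\<^sub>R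
      (\<Sum>ps\<in>cells k i j. \<Prod>(p, q)\<leftarrow>ps. if p = 1 \<and> q = 1 then tay t (fser F) else 0))"
    by (simp only: rho_hom rho_sum_prod map_map comp_def case_prod_unfold rX)
  also have "\<dots> = - (\<Sum>k=1..i. if k = i then (if i = j then (1 / real i) *\<^sub>R tay t (fser F) ^ i else 0) else 0)"
    unfolding sum_cells_diagonal by (intro arg_cong[of _ _ uminus] sum.cong) auto
  also have "\<dots> = - (if i = j then (1 / real i) *\<^sub>R tay t (fser F) ^ i else 0)"
    using ij by (simp add: sum.delta)
  finally have "rho (cf ?x ?y i j (- W)) = (if i = j then (1 / real i) *\<^sub>R tay t (fser F) ^ i else 0)"
    by (simp add: rho_hom)
  moreover have "cf ?x ?y i j (- W) = (1 / (real i * real j)) *\<^sub>R pd (Some (T i)) (pd (Some (Tb j)) (tay t F))"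
    using ij t F_free by (simp add: W_def del: cf_linear) (subst cf_mDD_mDD; auto)
  ultimately have "(1 / (real i * real j)) *\<^sub>R rho (pd (Some (T i)) (pd (Some (Tb j)) (tay t F))) =
      (if i = j then (1 / real i) *\<^sub>R tay t (fser F) ^ i else 0)"
    by (simp only: rho_hom)
  then have "(real i * real j) *\<^sub>R (1 / (real i * real j)) *\<^sub>R rho (pd (Some (T i)) (pd (Some (Tb j)) (tay t F))) =
      (real i * real j) *\<^sub>R (if i = j then (1 / real i) *\<^sub>R tay t (fser F) ^ i else 0)"
    by simp
  then show ?thesis using ij by (auto split: if_splits)
qed

lemma rho_single:
  assumes "t \<in> U" "k \<ge> 1" "tv = T \<or> tv = Tb"
  shows "rho (pd (Some (tv k)) (tay t F)) = 0"
proof (rule mser_eqI)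
  fix N
  show "mcf (rho (pd (Some (tv k)) (tay t F))) N = mcf 0 N"
  proof (cases "set_mset N \<subseteq> {None}")
    case True
    define n where "n = count N None"
    have N: "N = replicate_mset n None" unfolding n_def by (rule None_only[OF True])
    have "(dt0 ^^ n) (F {#tv k#}) t = (dt0 ^^ n) (\<lambda>_. 0) t"
      by (rule dt0_pow_cong[OF U assms(1)]) (use F_single assms in auto)
    then have "mcf (tay t F) (image_mset Some {#tv k#} + replicate_mset n None) = 0"
      unfolding mcf_tay by (simp add: dt0_pow_const)
    then show ?thesis by (simp add: mcf_rho mcf_pd N)
  qed (simp add: mcf_rho)
qed

lemma toda_ring_tay:
  assumes t: "t \<in> U"
  shows "toda_ring (pd None) (\<lambda>i. pd (Some (T i))) (\<lambda>i. pd (Some (Tb i))) (tay t F) rho (tay t (fser F))"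
proof -
  have der: "derivation (pd v)" for v :: "var option"
    by unfold_locales (simp_all add: pd_linear pd_mult)
  have eq1: "series_eq_on U ((svar Xinv - svar Zinv) \<star> sexp (sDD T Zinv (sDD T Xinv F)))
       (svar Xinv \<star> sexp (- d0 (sDD T Zinv F)) - svar Zinv \<star> sexp (- d0 (sDD T Xinv F)))"
    and eq2: "series_eq_on U ((svar Xbinv - svar Zbinv) \<star> sexp (sDD Tb Zbinv (sDD Tb Xbinv F)))
       (svar Xbinv \<star> sexp (- d0 (sDD Tb Zbinv F)) - svar Zbinv \<star> sexp (- d0 (sDD Tb Xbinv F)))"
    using hierarchy by (simp_all add: toda_hierarchy_def DD_eq_sDD)
  have fr: "free (Some Zinv) (tay t F)" "free (Some Xinv) (tay t F)"
      "free (Some Zbinv) (tay t F)" "free (Some Xbinv) (tay t F)"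
    using t by (auto intro!: F_free)
  show ?thesis
  proof (intro toda_ring.intro toda_half.intro toda_half_axioms.intro toda_ring_axioms.intro der)
    fix i j :: nat assume ij: "i \<ge> 1" "j \<ge> 1"
    show "pd (Some (T i)) (pd (Some (T j)) (tay t F)) = (real i * real j) *\<^sub>R
      (\<Sum>ps\<in>comps (i + j). (of_rat (T2 i j ps) :: real) *\<^sub>R
        (\<Prod>p\<leftarrow>ps. (1 / real p) *\<^sub>R pd None (pd (Some (T p)) (tay t F))))"
      by (rule hierarchy_log[OF U t F_smooth _ fr(1,2) _ _ eq1 ij]) auto
    show "pd (Some (Tb i)) (pd (Some (Tb j)) (tay t F)) = (real i * real j) *\<^sub>R
      (\<Sum>ps\<in>comps (i + j). (of_rat (T2 i j ps) :: real) *\<^sub>R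
        (\<Prod>p\<leftarrow>ps. (1 / real p) *\<^sub>R pd None (pd (Some (Tb p)) (tay t F))))"
      by (rule hierarchy_log[OF U t F_smooth _ fr(3,4) _ _ eq2 ij]) auto
    show "rho (pd (Some (T i)) (pd (Some (Tb j)) (tay t F))) =
        (if i = j then real i *\<^sub>R tay t (fser F) ^ i else 0)"
      by (rule rho_D_Db_F[OF t ij])
  qed (simp_all add: pd_commute rho_hom rho_single t)
qed

lemma mcf_iterated:
  "mcf (fold (\<lambda>i. pd (Some (Tb i))) \<Delta>b (fold (\<lambda>i. pd (Some (T i))) \<Delta> (tay t F))) {#} =
    of_nat (sigma \<Delta> * sigma \<Delta>b) * F (tmon \<Delta> \<Delta>b) t"
proof -
  define vs where "vs = map (\<lambda>i. Some (T i)) \<Delta> @ map (\<lambda>i. Some (Tb i)) \<Delta>b"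
  have vs: "mset vs = image_mset Some (tmon \<Delta> \<Delta>b)"
    by (simp add: vs_def tmon_def image_mset.compositionality comp_def)
  have "mfact (mset vs) = mfact (image_mset T (mset \<Delta>) + image_mset Tb (mset \<Delta>b))"
    unfolding vs by (subst mfact_image) (auto simp: tmon_def inj_def)
  also have "\<dots> = sigma \<Delta> * sigma \<Delta>b"
    by (subst mfact_plus) (auto simp: mfact_image mfact_mset inj_def)
  finally have mf: "mfact (mset vs) = sigma \<Delta> * sigma \<Delta>b" .
  have "mcf (fold pd vs (tay t F)) {#} = of_nat (mfact (mset vs)) * mcf (tay t F) (mset vs)"
    using mcf_fold_pd[of vs "tay t F" "{#}"] by (simp add: mfact_def)
  moreover have "mcf (tay t F) (mset vs) = F (tmon \<Delta> \<Delta>b) t"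
    using mcf_tay[of t F "tmon \<Delta> \<Delta>b" 0] by (simp add: vs)
  ultimately show ?thesis
    unfolding mf by (simp add: vs_def fold_map comp_def)
qed

end

section \<open>The coefficients of a symmetric solution\<close>

lemma of_real_of_rat: "complex_of_real (of_rat q) = of_rat q"
  by (cases q) (simp add: of_rat_rat)

lemma sigma_pos: "sigma \<Delta> > 0"
  unfolding sigma_def by (rule prod_pos) simp

theorem theorem2p1:
  fixes U :: "real set" and F :: series and f :: "real \<Rightarrow> complex"
  assumes "open U"
    and "symmetric_solution U F"
    and f_def: "f = (\<lambda>t. exp ((dt0 ^^ 2) (restr F) t))"
    and "young \<Delta>" and "young \<Delta>b" and "t0 \<in> U"
  shows "F (tmon \<Delta> \<Delta>b) t0 =
     (if \<Delta> = [] \<and> \<Delta>b = [] then restr F t0 else 0)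
   + (if \<exists>i>0. \<Delta> = [i] \<and> \<Delta>b = [i] then of_nat (hd \<Delta>) * f t0 ^ hd \<Delta> else 0)
   + (if \<Delta> \<noteq> [] \<and> \<Delta>b \<noteq> [] \<and> sum_list \<Delta> = sum_list \<Delta>b \<and> length \<Delta> + length \<Delta>b > 2
      then \<Sum>cols\<in>arrays (sum_list \<Delta>) (length \<Delta> + length \<Delta>b - 2).
             of_rat (NN \<Delta> \<Delta>b cols)
               * (\<Prod>(s, r)\<leftarrow>cols. (dt0 ^^ r) (\<lambda>t. f t ^ s) t0)
      else 0)"
proof -
  have f: "f = ffun F" by (simp add: f_def ffun_def restr_def fun_eq_iff)
  interpret toda_ring "pd None" "\<lambda>i. pd (Some (T i))" "\<lambda>i. pd (Some (Tb i))" "tay t0 F" rho "tay t0 (fser F)"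
    by (rule toda_ring_tay[OF assms(1,2,6)])
  interpret sw: toda_ring "pd None" "\<lambda>i. pd (Some (Tb i))" "\<lambda>i. pd (Some (T i))" "tay t0 F" rho "tay t0 (fser F)"
    by (rule swapped)
  define E where "E = fold (\<lambda>i. pd (Some (Tb i))) \<Delta>b (fold (\<lambda>i. pd (Some (T i))) \<Delta> (tay t0 F))"
  have pos: "0 \<notin> set \<Delta>" "0 \<notin> set \<Delta>b" using assms by (auto simp: young_def)
  have sig: "of_nat (sigma \<Delta> * sigma \<Delta>b) \<noteq> (0 :: complex)" using sigma_pos[of \<Delta>] sigma_pos[of \<Delta>b] by simp
  \<comment> \<open>\<open>rho\<close> does not change the constant term, so the coefficient of F
    can be read off from the restricted iterated derivative.\<close>
  have "mcf (rho E) {#} = of_nat (sigma \<Delta> * sigma \<Delta>b) * F (tmon \<Delta> \<Delta>b) t0"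
    using mcf_iterated[OF assms(1,2)] by (simp add: E_def mcf_rho)
  then have E: "F (tmon \<Delta> \<Delta>b) t0 = mcf (rho E) {#} / of_nat (sigma \<Delta> * sigma \<Delta>b)"
    using sig by (simp add: field_simps)
  note d0_pow = mcf_d0_pow[OF assms(1,2,6)]
  \<comment> \<open>With exactly one empty diagram the derivative involves one kind of variables and
    vanishes under \<open>rho\<close>; two diagrams with one row each give the sum of the i f^i, and
    the last case gives the general sum.\<close>
  consider "\<Delta> = []" "\<Delta>b = []" | "\<Delta> \<noteq> []" "\<Delta>b = []" | "\<Delta> = []" "\<Delta>b \<noteq> []"
    | i j where "\<Delta> = [i]" "\<Delta>b = [j]" | "\<Delta> \<noteq> []" "\<Delta>b \<noteq> []" "length \<Delta> + length \<Delta>b > 2"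
  proof -
    assume *: "\<Delta> = [] \<Longrightarrow> \<Delta>b = [] \<Longrightarrow> thesis" "\<Delta> \<noteq> [] \<Longrightarrow> \<Delta>b = [] \<Longrightarrow> thesis" "\<Delta> = [] \<Longrightarrow> \<Delta>b \<noteq> [] \<Longrightarrow> thesis"
      "\<And>i j. \<Delta> = [i] \<Longrightarrow> \<Delta>b = [j] \<Longrightarrow> thesis"
      "\<Delta> \<noteq> [] \<Longrightarrow> \<Delta>b \<noteq> [] \<Longrightarrow> length \<Delta> + length \<Delta>b > 2 \<Longrightarrow> thesis"
    have "(\<exists>i. \<Delta> = [i]) \<and> (\<exists>j. \<Delta>b = [j])" if "\<Delta> \<noteq> []" "\<Delta>b \<noteq> []" "\<not> length \<Delta> + length \<Delta>b > 2"
    proof -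
      have "length \<Delta> = 1" "length \<Delta>b = 1" using that by (cases \<Delta>; cases \<Delta>b; simp)+
      then show ?thesis by (auto simp: length_Suc_conv)
    qed
    then show thesis using * by blast
  qed
  then show ?thesis
  proof cases
    case 1
    then show ?thesis by (simp add: tmon_def restr_def)
  next
    case 2
    have "F (tmon \<Delta> \<Delta>b) t0 = 0"
      unfolding E E_def using rho_fold_D[OF 2(1) pos(1)] by (simp add: 2)
    then show ?thesis using 2 by simp
  next
    case 3
    have "F (tmon \<Delta> \<Delta>b) t0 = 0"
      unfolding E E_def using sw.rho_fold_D[OF 3(2) pos(2)] by (simp add: 3)
    then show ?thesis using 3 by simp
  next
    case (4 i j)
    have ij: "i \<ge> 1" "j \<ge> 1" using pos 4 by auto
    have "E = pd (Some (T i)) (pd (Some (Tb j)) (tay t0 F))"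
      by (simp add: E_def 4 pd_commute)
    then have "mcf (rho E) {#} = (if i = j then of_nat i * f t0 ^ i else 0)"
      using d0_pow[of 0 i] d0_pow[of 0 j] by (simp add: rho_D_Db[OF ij] f scaleR_conv_of_real[where 'a=complex])
    then have "F (tmon \<Delta> \<Delta>b) t0 = (if i = j then of_nat i * f t0 ^ i else 0)"
      unfolding E by (simp add: 4 sigma_def)
    then show ?thesis using ij 4 by auto
  next
    case 5
    \<comment> \<open>Taking the constant term is multiplicative, so each factor can be evaluated at
      t0 separately.\<close>
    have prod: "mcf (\<Prod>(s, r)\<leftarrow>cols. (pd None ^^ r) (tay t0 (fser F) ^ s)) {#} =
        (\<Prod>(s, r)\<leftarrow>cols. (dt0 ^^ r) (\<lambda>t. f t ^ s) t0)" for cols :: "(nat \<times> nat) list"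
      by (induction cols) (auto simp: d0_pow f)
    have mE: "mcf (rho E) {#} = (if sum_list \<Delta> = sum_list \<Delta>b
      then \<Sum>cols\<in>arrays (sum_list \<Delta>) (length \<Delta> + length \<Delta>b - 2).
        of_rat (Ntilde \<Delta> \<Delta>b cols) * (\<Prod>(s, r)\<leftarrow>cols. (dt0 ^^ r) (\<lambda>t. f t ^ s) t0) else 0)"
      unfolding E_def rho_mixed[OF 5(1) pos(1) 5(2) pos(2) 5(3)]
      by (simp add: prod scaleR_conv_of_real[where 'a=complex] of_real_of_rat)
    have no: "(\<exists>i>0. \<Delta> = [i] \<and> \<Delta>b = [i]) = False" using 5(3) by auto
    show ?thesis
      unfolding no E mE using 5 by (simp add: NN_def of_rat_divide of_rat_mult sum_divide_distrib)
  qed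
qed

end
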